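(* Let $d=1$, let $r\ge1$ be an integer, and choose integers $K,J\ge r$. Assume the standing regularity conditions of the context. Suppose all derivatives of $\log p(\cdot|\theta)$ of order $J+3$ or less exist and are continuous and are bounded in absolute value in an open set containing $\theta_0$ by a function $G(x)$ with $E_{\theta_0}G(X)$ finite, and that all derivatives of $w$ up to order $J+1$ exist and are continuous in a neighborhood of $\theta_0$. Assume Assumption EE of order $K$ for the maximum likelihood estimator $\hat\theta_n$, and also for the posterior mean $\bar\theta_n$ in place of $\hat\theta_n$. Suppose $\int|\theta|^r w(\theta)\,d\theta<\infty$. Then $$E_{\theta_0}E_{W_o(\cdot|X^n)}\big[(\theta-\bar\theta_n)^r\big]=I^{-r/2}(\theta_0)\,\lambda_{rr}\,n^{-r/2}+o(n^{-r/2})+R_n',$$ where $\lambda_{rr}=2^{r/2}\Gamma((r+1)/2)/\Gamma(1/2)$ and $R_n'=E_{\theta_0}\big(I_{S_n^c}\,E_{W_o(\cdot|X^n)}[(\theta-\bar\theta_n)^r]\big)$.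
   Context: Setting. $X^n=(X_1,\dots,X_n)$ is IID with density $p(\cdot|\theta)$, $\theta\in\Omega\subset\mathbb R$; $\theta_0$ is the data-generating value, with $P_{\theta_0}$, $E_{\theta_0}$ the corresponding probability and expectation. The prior has density $w(\theta)$; $W(\cdot|X^n)$ is the posterior distribution, with density $w(\theta)p(x^n|\theta)/\int w(t)p(x^n|t)\,dt$. $\hat\theta_n$ is the maximum likelihood estimator (MLE), $\bar\theta_n$ the posterior mean, and $I(\theta)=-E_\theta\,\partial^2\log p(X|\theta)/\partial\theta^2$ the Fisher information. $W_o(\cdot|X^n)$ denotes the posterior distribution function of $\psi=\sqrt n\,I^{1/2}(\theta_0)(\theta-\hat\theta_n)$, and $E_{W_o(\cdot|X^n)}$ is the posterior expectation over $\theta$ given $X^n$. Standing regularity conditions (the standard "expected local sup" conditions ensuring consistency, asymptotic normality and efficiency of the MLE): $\Omega$ is closed and $\theta_0$ is in its interior; different $\theta$ give different distributions; $p(x|\theta)$ is measurable in $x$ and continuous in $\theta$; $E_{\theta_0}|\log p(X|\theta_0)|<\infty$; for each $\theta'\in\Omega$ there is $\rho>0$ with $E_{\theta_0}\sup_{|\theta-\theta'|<\rho}[\log p(X|\theta)]^+<\infty$, and there is $R>0$ with $E_{\theta_0}\sup_{|\theta|>R}[\log p(X|\theta)]^+<\infty$; $p(x|\theta)\to0$ as $|\theta|\to\infty$; the first two derivatives of $\log p(x|\theta)$ in $\theta$ exist, are continuous and are dominated near $\theta_0$ by an integrable function; $E_{\theta_0}\partial\log p(X|\theta_0)/\partial\theta=0$,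 and $I(\theta_0)$ is finite, positive and equal to the variance of the score; $w$ is a probability density, continuous and positive at $\theta_0$. Good sets. $S_n$ denotes a sequence of sets of data strings with $P_{\theta_0}(S_n^c)=o(1)$ on which the posterior moment expansions hold: for $i=1,\dots,r$ there are functions $\lambda_{ij}(X^n)$, bounded in $X^n$, and constants $C>0$, $N$ such that for $n>N$ and $X^n\in S_n$, $$\Big|E_{W_o(\cdot|X^n)}\big(I^{i/2}(\theta_0)(\theta-\hat\theta_n)^i\big)-\sum_{j=i}^J\lambda_{ij}(X^n)n^{-j/2}\Big|\le Cn^{-(J+1)/2}.$$ $I_{S_n^c}$ is the indicator of the complement of $S_n$. Assumption EE (Edgeworth expansion of order $K$) for an estimator $\hat\theta_n$. With $\phi_{\mu,\sigma^2}$ the $N(\mu,\sigma^2)$ density and $\phi$ the standard normal density, the density $f_n$ of the estimator when $\theta_0$ is true satisfies $$f_n(\theta)=\phi_{\theta_0,(nI(\theta_0))^{-1}}(\theta)+\sum_{k=1}^K n^{-k/2}P_k(\sqrt n I^{1/2}(\theta_0)(\theta-\theta_0))\,\phi_{\theta_0,(nI(\theta_0))^{-1}}(\theta)+o(n^{-K/2})\frac{(nI(\theta_0))^{1/2}}{1+|\sqrt n I^{1/2}(\theta_0)(\theta-\theta_0)|^{K+2}},$$ where $\theta$ is a dummy variable for values of the estimator, the $o(n^{-K/2})$ is uniform for $\theta$ in a compact set, and the $P_k$ are the Edgeworth polynomials $$P_k(v)=\phi^{-1}(v)\sum_{q=1}^k\frac1{q!}\sum_{l_1+\cdots+l_q=k}\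 \sum_{r_m=l_m+2,\,1\le m\le q}\frac{\chi_{r_1}\cdots\chi_{r_q}}{r_1!\cdots r_q!}(-1)^{r_1+\cdots+r_q}D^{r_1+\cdots+r_q}\phi(v),$$ with $\chi_s$ the $s$th cumulant (the polynomials for $\bar\theta_n$ may differ from those for $\hat\theta_n$).
   Formalization: For odd r the displayed λ_rr is E|Z|^r and the claim fails (r=1: the left side and R_n' are 0), so λ_rr is taken as 0 for odd r and as displayed for even r; the identity is asserted for large n whenever the integrand of R_n' is integrable. *)

theory Defs
  imports "HOL-Probability.Probability" "HOL-Library.Landau_Symbols"
begin

definition Ck_on :: "nat \<Rightarrow> (real \<Rightarrow> real) \<Rightarrow> real set \<Rightarrow> bool" where
  "Ck_on m f U \<longleftrightarrow>
     (\<forall>k<m. \<forall>t\<in>U. (deriv ^^ k) f field_differentiable at t) \<and>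
     (\<forall>k\<le>m. continuous_on U ((deriv ^^ k) f))"

definition model :: "'a measure \<Rightarrow> ('a \<Rightarrow> real \<Rightarrow> real) \<Rightarrow> real \<Rightarrow> 'a measure" where
  "model M p \<theta> = density M (\<lambda>x. ennreal (p x \<theta>))"

definition sample :: "'a measure \<Rightarrow> ('a \<Rightarrow> real \<Rightarrow> real) \<Rightarrow> real \<Rightarrow> nat \<Rightarrow> (nat \<Rightarrow> 'a) measure" where
  "sample M p \<theta> n = Pi\<^sub>M {..<n} (\<lambda>_. model M p \<theta>)"

definition likelihood :: "('a \<Rightarrow> real \<Rightarrow> real) \<Rightarrow> nat \<Rightarrow> (nat \<Rightarrow> 'a) \<Rightarrow> real \<Rightarrow> real" where
  "likelihood p n x \<theta> = (\<Prod>i<n. p (x i) \<theta>)"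

definition loglik_deriv :: "('a \<Rightarrow> real \<Rightarrow> real) \<Rightarrow> nat \<Rightarrow> 'a \<Rightarrow> real \<Rightarrow> real" where
  "loglik_deriv p k x \<theta> = (deriv ^^ k) (\<lambda>t. ln (p x t)) \<theta>"

definition fisher :: "'a measure \<Rightarrow> ('a \<Rightarrow> real \<Rightarrow> real) \<Rightarrow> real \<Rightarrow> real" where
  "fisher M p \<theta> = - (\<integral>x. loglik_deriv p 2 x \<theta> \<partial>model M p \<theta>)"

(* The log-likelihood only makes sense where the density is positive, so smoothness near
   \<theta>0 includes positivity there; the exceptional x form a null set for the true law. *)
definition loglik_smooth ::
  "'a measure \<Rightarrow> ('a \<Rightarrow> real \<Rightarrow> real) \<Rightarrow> real set \<Rightarrow> real \<Rightarrow> nat \<Rightarrow> bool" where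
  "loglik_smooth M p \<Omega> \<theta>0 m \<longleftrightarrow>
     (\<exists>U G. open U \<and> \<theta>0 \<in> U \<and> U \<subseteq> \<Omega> \<and> integrable (model M p \<theta>0) G \<and>
        (AE x in model M p \<theta>0.
           (\<forall>\<theta>\<in>U. p x \<theta> > 0) \<and>
           Ck_on m (\<lambda>\<theta>. ln (p x \<theta>)) U \<and>
           (\<forall>k\<in>{1..m}. \<forall>\<theta>\<in>U. \<bar>loglik_deriv p k x \<theta>\<bar> \<le> G x)))"

(* The prior density w is a function on the whole line that vanishes off the parameter set,
   so integrals over \<Omega> against w are integrals over the line.  The values of p off \<Omega> are
   irrelevant.  Where the density is 0, ln gives 0, which is the positive part of the
   logarithm as required in log_sup_local and log_sup_tail. *)
locale regular_bayes_model = sigma_finite_measure M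
  for M :: "'a measure" +
  fixes p :: "'a \<Rightarrow> real \<Rightarrow> real" and \<Omega> :: "real set" and \<theta>0 :: real and w :: "real \<Rightarrow> real"
  assumes closed_param: "closed \<Omega>"
    and true_interior: "\<theta>0 \<in> interior \<Omega>"
    and dens_measurable: "\<theta> \<in> \<Omega> \<Longrightarrow> (\<lambda>x. p x \<theta>) \<in> borel_measurable M"
    and dens_nonneg: "x \<in> space M \<Longrightarrow> \<theta> \<in> \<Omega> \<Longrightarrow> 0 \<le> p x \<theta>"
    and dens_prob: "\<theta> \<in> \<Omega> \<Longrightarrow> prob_space (model M p \<theta>)"
    and identifiable: "inj_on (model M p) \<Omega>"
    and dens_cont: "x \<in> space M \<Longrightarrow> continuous_on \<Omega> (p x)"
    and log_integrable: "integrable (model M p \<theta>0) (\<lambda>x. \<bar>ln (p x \<theta>0)\<bar>)"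
    and log_sup_local: "\<theta>' \<in> \<Omega> \<Longrightarrow> \<exists>\<rho>>0.
          (\<integral>\<^sup>+x. (SUP \<theta>\<in>{\<theta>\<in>\<Omega>. \<bar>\<theta> - \<theta>'\<bar> < \<rho>}. ennreal (max 0 (ln (p x \<theta>)))) \<partial>model M p \<theta>0) < \<infinity>"
    and log_sup_tail: "\<exists>R>0.
          (\<integral>\<^sup>+x. (SUP \<theta>\<in>{\<theta>\<in>\<Omega>. \<bar>\<theta>\<bar> > R}. ennreal (max 0 (ln (p x \<theta>)))) \<partial>model M p \<theta>0) < \<infinity>"
    and dens_vanishes: "x \<in> space M \<Longrightarrow> (p x \<longlongrightarrow> 0) (inf at_infinity (principal \<Omega>))"
    and loglik_smooth2: "loglik_smooth M p \<Omega> \<theta>0 2"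
    and score_integrable: "integrable (model M p \<theta>0) (\<lambda>x. loglik_deriv p 1 x \<theta>0)"
    and score_centred: "(\<integral>x. loglik_deriv p 1 x \<theta>0 \<partial>model M p \<theta>0) = 0"
    and score_square_integrable: "integrable (model M p \<theta>0) (\<lambda>x. (loglik_deriv p 1 x \<theta>0)\<^sup>2)"
    and fisher_finite: "integrable (model M p \<theta>0) (\<lambda>x. loglik_deriv p 2 x \<theta>0)"
    and fisher_pos: "fisher M p \<theta>0 > 0"
    and fisher_eq_var: "fisher M p \<theta>0 =
          prob_space.variance (model M p \<theta>0) (\<lambda>x. loglik_deriv p 1 x \<theta>0)"
    and prior_measurable: "w \<in> borel_measurable borel"
    and prior_nonneg: "0 \<le> w \<theta>"
    and prior_support: "\<theta> \<notin> \<Omega> \<Longrightarrow> w \<theta> = 0"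
    and prior_prob: "prob_space (density lborel (\<lambda>\<theta>. ennreal (w \<theta>)))"
    and prior_cont: "isCont w \<theta>0"
    and prior_pos: "w \<theta>0 > 0"

definition posterior ::
  "('a \<Rightarrow> real \<Rightarrow> real) \<Rightarrow> (real \<Rightarrow> real) \<Rightarrow> nat \<Rightarrow> (nat \<Rightarrow> 'a) \<Rightarrow> real measure" where
  "posterior p w n x = density lborel
     (\<lambda>\<theta>. ennreal (w \<theta> * likelihood p n x \<theta> / (\<integral>t. w t * likelihood p n x t \<partial>lborel)))"

definition post_mean ::
  "('a \<Rightarrow> real \<Rightarrow> real) \<Rightarrow> (real \<Rightarrow> real) \<Rightarrow> nat \<Rightarrow> (nat \<Rightarrow> 'a) \<Rightarrow> real" where
  "post_mean p w n x = (\<integral>\<theta>. \<theta> \<partial>posterior p w n x)"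

definition is_mle ::
  "'a measure \<Rightarrow> ('a \<Rightarrow> real \<Rightarrow> real) \<Rightarrow> real set \<Rightarrow> real \<Rightarrow> (nat \<Rightarrow> (nat \<Rightarrow> 'a) \<Rightarrow> real) \<Rightarrow> bool" where
  "is_mle M p \<Omega> \<theta>0 T \<longleftrightarrow>
     (\<forall>n. T n \<in> borel_measurable (sample M p \<theta>0 n) \<and>
       (AE x in sample M p \<theta>0 n. T n x \<in> \<Omega> \<and>
          (\<forall>t\<in>\<Omega>. likelihood p n x t \<le> likelihood p n x (T n x))))"

(* The expectation over \<psi> = sqrt (n I) (\<theta> - T n x) under W_o is the expectation over \<theta> under
   the posterior.  The coefficients lam j n x are bounded uniformly over data strings x of all
   lengths n. *)
definition good_sets ::
  "'a measure \<Rightarrow> ('a \<Rightarrow> real \<Rightarrow> real) \<Rightarrow> real \<Rightarrow> (real \<Rightarrow> real) \<Rightarrow> (nat \<Rightarrow> (nat \<Rightarrow> 'a) \<Rightarrow> real)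
     \<Rightarrow> nat \<Rightarrow> nat \<Rightarrow> (nat \<Rightarrow> (nat \<Rightarrow> 'a) set) \<Rightarrow> bool" where
  "good_sets M p \<theta>0 w T r J S \<longleftrightarrow>
     (\<forall>n. S n \<in> sets (sample M p \<theta>0 n)) \<and>
     (\<lambda>n. measure (sample M p \<theta>0 n) (space (sample M p \<theta>0 n) - S n)) \<in> o(\<lambda>_. 1) \<and>
     (\<forall>i\<in>{1..r}. \<exists>(lam :: nat \<Rightarrow> nat \<Rightarrow> (nat \<Rightarrow> 'a) \<Rightarrow> real) B C N.
        C > 0 \<and>
        (\<forall>j\<in>{i..J}. \<forall>n. \<forall>x\<in>space (sample M p \<theta>0 n). \<bar>lam j n x\<bar> \<le> B) \<and>
        (\<forall>n>N. \<forall>x\<in>S n.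
           \<bar>(\<integral>\<theta>. fisher M p \<theta>0 powr (real i / 2) * (\<theta> - T n x) ^ i \<partial>posterior p w n x)
             - (\<Sum>j=i..J. lam j n x * real n powr (- real j / 2))\<bar>
           \<le> C * real n powr (- real (J + 1) / 2)))"

(* The list l = [l_1, ..., l_q] runs over the compositions of k into q positive parts,
   and r_m = l_m + 2 (s is the current l_m). *)
definition edgeworth_poly :: "(nat \<Rightarrow> real) \<Rightarrow> nat \<Rightarrow> real \<Rightarrow> real" where
  "edgeworth_poly cum k v =
     (\<Sum>q=1..k. 1 / fact q *
        (\<Sum>l\<in>{l. length l = q \<and> 0 \<notin> set l \<and> sum_list l = k}.
           (\<Prod>s\<leftarrow>l. cum (s + 2) / fact (s + 2)) *
           (- 1) ^ (\<Sum>s\<leftarrow>l. s + 2) *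
           (deriv ^^ (\<Sum>s\<leftarrow>l. s + 2)) std_normal_density v))
     / std_normal_density v"

(* cum s stands for the s-th cumulant entering the polynomials.  Only its role as a fixed
   real coefficient matters, so it ranges over all real sequences, chosen separately for
   each estimator.  The relative error \<epsilon> is o(n powr (-K/2)) uniformly on each compact set.
   Note that normal_density takes the standard deviation. *)
definition edgeworth_expansion ::
  "(nat \<Rightarrow> 'b measure) \<Rightarrow> real \<Rightarrow> real \<Rightarrow> nat \<Rightarrow> (nat \<Rightarrow> 'b \<Rightarrow> real) \<Rightarrow> bool" where
  "edgeworth_expansion P \<theta>0 I K T \<longleftrightarrow>
     (\<exists>(f :: nat \<Rightarrow> real \<Rightarrow> real) (cum :: nat \<Rightarrow> real) (\<epsilon> :: nat \<Rightarrow> real \<Rightarrow> real).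
        (\<forall>\<^sub>F n in sequentially.
           (\<forall>\<theta>. 0 \<le> f n \<theta>) \<and>
           distributed (P n) lborel (T n) (\<lambda>\<theta>. ennreal (f n \<theta>)) \<and>
           (\<forall>\<theta>. f n \<theta> =
              normal_density \<theta>0 (1 / sqrt (real n * I)) \<theta>
              + (\<Sum>k=1..K. real n powr (- real k / 2)
                   * edgeworth_poly cum k (sqrt (real n * I) * (\<theta> - \<theta>0))
                   * normal_density \<theta>0 (1 / sqrt (real n * I)) \<theta>)
              + \<epsilon> n \<theta> * (sqrt (real n * I)
                   / (1 + \<bar>sqrt (real n * I) * (\<theta> - \<theta>0)\<bar> ^ (K + 2))))) \<and>
        (\<forall>C. compact C \<longrightarrow>
           uniform_limit C (\<lambda>n \<theta>. real n powr (real K / 2) * \<epsilon> n \<theta>) (\<lambda>_. 0) sequentially))"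

(* The leading coefficient of the r-th posterior moment is the r-th moment of N(0,1).
   The Gamma formula is that moment for even r.  For odd r it is the absolute moment, and
   the coefficient of the (signed) moment is 0: for instance the first posterior moment
   about the posterior mean is identically 0. *)
definition lambda_rr :: "nat \<Rightarrow> real" where
  "lambda_rr r =
     (if even r then 2 powr (real r / 2) * Gamma ((real r + 1) / 2) / Gamma (1 / 2) else 0)"

definition post_central_moment ::
  "('a \<Rightarrow> real \<Rightarrow> real) \<Rightarrow> (real \<Rightarrow> real) \<Rightarrow> nat \<Rightarrow> nat \<Rightarrow> (nat \<Rightarrow> 'a) \<Rightarrow> real" where
  "post_central_moment p w r n x = (\<integral>\<theta>. (\<theta> - post_mean p w n x) ^ r \<partial>posterior p w n x)"

definition bad_set_remainder ::
  "'a measure \<Rightarrow> ('a \<Rightarrow> real \<Rightarrow> real) \<Rightarrow> real \<Rightarrow> (real \<Rightarrow> real) \<Rightarrow> nat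
     \<Rightarrow> (nat \<Rightarrow> (nat \<Rightarrow> 'a) set) \<Rightarrow> nat \<Rightarrow> real" where
  "bad_set_remainder M p \<theta>0 w r S n =
     (\<integral>x. indicator (- S n) x * post_central_moment p w r n x \<partial>sample M p \<theta>0 n)"

end

(* By the good-set expansions the rescaled posterior moments about the MLE are bounded on S_n, so
   it is enough that (n I)^(i/2) times the i-th posterior moment about the MLE converges in
   probability to the i-th moment of N(0,1): the mean of a bounded sequence converging in
   probability converges, the first moment shows that posterior mean and MLE differ by
   o(n^(-1/2)), and a binomial expansion then moves the centre.  The leading coefficient in the
   good-set expansions is not given, so this convergence (Bernstein-von Mises with moments) is
   where the regularity conditions enter.  Wald's compactness argument makes the likelihood ratio
   exponentially small away from theta0, the law of large numbers for second and third
   log-likelihood derivatives makes it Gaussian near theta0, and Laplace's method does the rest. *)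
theory Submission
  imports Defs
begin

section \<open>Convergence in probability as convergence along a filter\<close>


text \<open>The powers (\<theta> - T)^i are unbounded and the prior has only an r-th moment, so weak
  convergence of the posterior says too little: the likelihood ratio must be controlled uniformly
  over the whole parameter set. It is taken relative to the MLE T, because centring at a maximiser
  removes the linear Taylor term. What remains is exp (-n I (\<theta> - T)^2 / 2), up to a factor 1
  +- epsilon in the exponent, on a neighbourhood whose size depends on epsilon but not on n. Outside
  it the ratio is below exp (- eta n), which absorbs the powers of n produced by rescaling. These
  bounds hold only on events of probability tending to 1, on sample spaces that change with n,
  whereas Laplace's method is dominated convergence along a sequence. The bridge is to fix countably
  many such events (epsilon = 1/(j+1)) and to prove the limit along every deterministic sequence of
  data strings that eventually enters each of them; probability enters only in showing that the
  events are likely.\<close>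

text \<open>
  The pair \<open>(n, x)\<close> is a sample \<open>x\<close> of size \<open>n\<close>; an event holds eventually iff its failure set
  has measure tending to 0.  Convergence in probability of \<open>f\<close> to \<open>c\<close> is \<open>(f \<longlongrightarrow> c) (whp P)\<close>, so
  the limit calculus of filters applies, across sample spaces that vary with \<open>n\<close>.
\<close>

definition whp :: "(nat \<Rightarrow> 'b measure) \<Rightarrow> (nat \<times> 'b) filter" where
  "whp P = Abs_filter (\<lambda>Q. \<exists>B. (\<forall>n. B n \<in> sets (P n)) \<and> (\<lambda>n. emeasure (P n) (B n)) \<longlonglongrightarrow> 0 \<and>
     (\<forall>n. \<forall>x\<in>space (P n) - B n. Q (n, x)))"

text \<open>Failure events are only covered by measurable sets \<open>B n\<close>, so
  \<open>Q\<close> itself may be non-measurable, for instance a bound for all \<theta> at once. The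
  filter property under conjunction is the union bound.\<close>

lemma eventually_whp:
  "eventually Q (whp P) \<longleftrightarrow> (\<exists>B. (\<forall>n. B n \<in> sets (P n)) \<and> (\<lambda>n. emeasure (P n) (B n)) \<longlonglongrightarrow> 0 \<and>
     (\<forall>n. \<forall>x\<in>space (P n) - B n. Q (n, x)))"
  unfolding whp_def
proof (rule eventually_Abs_filter, rule is_filter.intro)
  show "\<exists>B. (\<forall>n. B n \<in> sets (P n)) \<and> (\<lambda>n. emeasure (P n) (B n)) \<longlonglongrightarrow> 0 \<and>
     (\<forall>n. \<forall>x\<in>space (P n) - B n. True)"
    by (rule exI[of _ "\<lambda>_. {}"]) auto
next
  fix Q R
  assume "\<exists>B. (\<forall>n. B n \<in> sets (P n)) \<and> (\<lambda>n. emeasure (P n) (B n)) \<longlonglongrightarrow> 0 \<and>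
     (\<forall>n. \<forall>x\<in>space (P n) - B n. Q (n, x))"
  then obtain B where B: "\<And>n. B n \<in> sets (P n)" "(\<lambda>n. emeasure (P n) (B n)) \<longlonglongrightarrow> 0"
      "\<And>n x. x \<in> space (P n) - B n \<Longrightarrow> Q (n, x)" by blast
  assume "\<exists>B. (\<forall>n. B n \<in> sets (P n)) \<and> (\<lambda>n. emeasure (P n) (B n)) \<longlonglongrightarrow> 0 \<and>
     (\<forall>n. \<forall>x\<in>space (P n) - B n. R (n, x))"
  then obtain C where C: "\<And>n. C n \<in> sets (P n)" "(\<lambda>n. emeasure (P n) (C n)) \<longlonglongrightarrow> 0"
      "\<And>n x. x \<in> space (P n) - C n \<Longrightarrow> R (n, x)" by blast
  have "(\<lambda>n. emeasure (P n) (B n) + emeasure (P n) (C n)) \<longlonglongrightarrow> 0 + 0"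
    by (intro tendsto_add B C)
  then have sum: "(\<lambda>n. emeasure (P n) (B n) + emeasure (P n) (C n)) \<longlonglongrightarrow> 0" by simp
  have "(\<lambda>n. emeasure (P n) (B n \<union> C n)) \<longlonglongrightarrow> 0"
    by (rule tendsto_sandwich[OF _ _ tendsto_const sum])
       (simp_all add: emeasure_subadditive B C)
  then show "\<exists>B. (\<forall>n. B n \<in> sets (P n)) \<and> (\<lambda>n. emeasure (P n) (B n)) \<longlonglongrightarrow> 0 \<and>
     (\<forall>n. \<forall>x\<in>space (P n) - B n. Q (n, x) \<and> R (n, x))"
    using B C by (intro exI[of _ "\<lambda>n. B n \<union> C n"]) auto
next
  fix Q R :: "nat \<times> _ \<Rightarrow> bool"
  assume "\<forall>x. Q x \<longrightarrow> R x"
    and "\<exists>B. (\<forall>n. B n \<in> sets (P n)) \<and> (\<lambda>n. emeasure (P n) (B n)) \<longlonglongrightarrow> 0 \<and>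
     (\<forall>n. \<forall>x\<in>space (P n) - B n. Q (n, x))"
  then show "\<exists>B. (\<forall>n. B n \<in> sets (P n)) \<and> (\<lambda>n. emeasure (P n) (B n)) \<longlonglongrightarrow> 0 \<and>
     (\<forall>n. \<forall>x\<in>space (P n) - B n. R (n, x))"
    by blast
qed

lemma eventually_whp_AE:
  assumes "\<forall>\<^sub>F n in sequentially. AE x in P n. Q (n, x)"
  shows "eventually Q (whp P)"
proof -
  have "\<forall>n. \<exists>B. B \<in> sets (P n) \<and> (\<forall>x\<in>space (P n) - B. Q (n, x)) \<and>
    ((AE x in P n. Q (n, x)) \<longrightarrow> emeasure (P n) B = 0)"
  proof
    fix n
    show "\<exists>B. B \<in> sets (P n) \<and> (\<forall>x\<in>space (P n) - B. Q (n, x)) \<and>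
      ((AE x in P n. Q (n, x)) \<longrightarrow> emeasure (P n) B = 0)"
    proof (cases "AE x in P n. Q (n, x)")
      case True
      then obtain N where "{x \<in> space (P n). \<not> Q (n, x)} \<subseteq> N" "emeasure (P n) N = 0" "N \<in> sets (P n)"
        by (rule AE_E)
      then show ?thesis by (intro exI[of _ N]) auto
    next
      case False
      \<comment> \<open>By assumption this happens for finitely many sizes only, so the whole space
        may serve as failure set.\<close>
      then show ?thesis by (intro exI[of _ "space (P n)"]) auto
    qed
  qed
  then obtain B where B: "\<And>n. B n \<in> sets (P n)" "\<And>n x. x \<in> space (P n) - B n \<Longrightarrow> Q (n, x)"
    "\<And>n. (AE x in P n. Q (n, x)) \<Longrightarrow> emeasure (P n) (B n) = 0" by metis
  have "(\<lambda>n. emeasure (P n) (B n)) \<longlonglongrightarrow> 0"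
    by (rule tendsto_eventually) (use assms B(3) in \<open>auto elim: eventually_mono\<close>)
  with B show ?thesis unfolding eventually_whp by auto
qed

lemma eventually_whp_index:
  assumes "eventually Q sequentially"
  shows "\<forall>\<^sub>F (n, x) in whp P. Q n"
  by (rule eventually_whp_AE) (use assms in \<open>auto elim: eventually_mono\<close>)

text \<open>Bounded convergence for convergence in probability: off the failure set the integrand is
  close to \<open>c\<close>, and on it the uniform bound is multiplied by a vanishing
  probability.\<close>

lemma tendsto_whp_integral:
  fixes f :: "nat \<Rightarrow> 'b \<Rightarrow> real"
  assumes P: "\<And>n. prob_space (P n)"
    and lim: "((\<lambda>(n, x). f n x) \<longlongrightarrow> c) (whp P)"
    and meas: "\<forall>\<^sub>F n in sequentially. f n \<in> borel_measurable (P n)"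
    and bound: "\<forall>\<^sub>F n in sequentially. \<forall>x\<in>space (P n). \<bar>f n x\<bar> \<le> C"
  shows "(\<lambda>n. \<integral>x. f n x \<partial>P n) \<longlonglongrightarrow> c"
proof (rule LIMSEQ_I)
  fix e :: real assume e: "0 < e"
  \<comment> \<open>Bounds |f - c| everywhere; the added 1 makes it positive, so that e / (2 * D) is
    a legitimate target for the failure probability.\<close>
  define D where "D = \<bar>C\<bar> + \<bar>c\<bar> + 1"
  have D: "D > 0" by (simp add: D_def)
  have "\<forall>\<^sub>F z in whp P. dist (case z of (n, x) \<Rightarrow> f n x) c < e / 2"
    using lim e by (intro tendstoD) auto
  then obtain B where B: "\<And>n. B n \<in> sets (P n)" "(\<lambda>n. emeasure (P n) (B n)) \<longlonglongrightarrow> 0"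
      "\<And>n x. x \<in> space (P n) - B n \<Longrightarrow> \<bar>f n x - c\<bar> < e / 2"
    unfolding eventually_whp by (auto simp: dist_real_def)
  have "\<forall>\<^sub>F n in sequentially. emeasure (P n) (B n) < ennreal (e / (2 * D))"
    by (rule order_tendstoD(2)[OF B(2)]) (use e D in auto)
  then have "\<forall>\<^sub>F n in sequentially. norm ((\<integral>x. f n x \<partial>P n) - c) < e"
    using meas bound
  proof eventually_elim
    case (elim n)
    interpret prob_space "P n" by (rule P)
    have m: "measure (P n) (B n) < e / (2 * D)"
      using elim(1) e D by (simp add: emeasure_eq_measure ennreal_less_iff)
    note [measurable] = elim(2) B(1)[of n]
    have int: "integrable (P n) (f n)"
      by (rule integrable_const_bound[where B = C]) (use elim(3) in auto)
    have "\<bar>(\<integral>x. f n x \<partial>P n) - c\<bar> = \<bar>\<integral>x. f n x - c \<partial>P n\<bar>"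
      using int by (simp add: prob_space)
    also have "\<dots> \<le> (\<integral>x. \<bar>f n x - c\<bar> \<partial>P n)"
      by (rule integral_abs_bound)
    also have "\<dots> \<le> (\<integral>x. e / 2 + D * indicator (B n) x \<partial>P n)"
    proof (rule integral_mono)
      show "integrable (P n) (\<lambda>x. e / 2 + D * indicator (B n) x)"
        using elim(2) B(1)[of n] by (intro Bochner_Integration.integrable_add integrable_const integrable_mult_right integrable_real_indicator) (auto simp: less_top[symmetric])
      fix x assume x: "x \<in> space (P n)"
      show "\<bar>f n x - c\<bar> \<le> e / 2 + D * indicator (B n) x"
        using B(3)[of x n] elim(3)[rule_format, OF x] x e
        by (cases "x \<in> B n") (auto simp: D_def)
    qed (use int in auto)
    also have "\<dots> = e / 2 + D * measure (P n) (B n)"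
      by (subst Bochner_Integration.integral_add)
         (auto simp: prob_space less_top[symmetric] intro!: integrable_mult_right integrable_real_indicator)
    also have "\<dots> < e / 2 + D * (e / (2 * D))"
      by (intro add_strict_left_mono mult_strict_left_mono m D)
    also have "\<dots> = e" using D by simp
    finally show ?case by simp
  qed
  then show "\<exists>no. \<forall>n\<ge>no. norm ((\<integral>x. f n x \<partial>P n) - c) < e"
    by (simp add: eventually_sequentially)
qed

text \<open>
  Reduces convergence along a filter that need not be countably generated, such as \<^const>\<open>whp\<close>, to
  sequences, for which dominated convergence is available.
\<close>

lemma tendsto_if_sequences:
  fixes Q :: "nat \<Rightarrow> 'b \<Rightarrow> bool" and f :: "'b \<Rightarrow> 'c::topological_space"
  assumes Q: "\<And>j. eventually (Q j) F"
    and lim: "\<And>s. (\<And>j. \<forall>\<^sub>F k in sequentially. Q j (s k)) \<Longrightarrow> (\<lambda>k. f (s k)) \<longlonglongrightarrow> L"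
  shows "(f \<longlongrightarrow> L) F"
proof (rule topological_tendstoI, rule ccontr)
  fix S assume S: "open S" "L \<in> S" and neg: "\<not> (\<forall>\<^sub>F z in F. f z \<in> S)"
  \<comment> \<open>Diagonal choice: finitely many events hold jointly together with a violation of
    the limit, since the violations form a frequent event. The resulting points satisfy each
    \<open>Q j\<close> from index j on.\<close>
  have "\<exists>z. (\<forall>j\<le>k. Q j z) \<and> f z \<notin> S" for k :: nat
  proof (rule ccontr)
    assume *: "\<nexists>z. (\<forall>j\<le>k. Q j z) \<and> f z \<notin> S"
    have "\<forall>\<^sub>F z in F. \<forall>j\<in>{..k}. Q j z"
      by (rule eventually_ball_finite) (auto simp: Q)
    then have "\<forall>\<^sub>F z in F. f z \<in> S" by (rule eventually_mono) (use * in auto)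
    with neg show False by simp
  qed
  then obtain s where s: "\<And>k j. j \<le> k \<Longrightarrow> Q j (s k)" "\<And>k. f (s k) \<notin> S" by metis
  have "(\<lambda>k. f (s k)) \<longlonglongrightarrow> L"
    by (rule lim) (auto simp: eventually_sequentially intro: s(1))
  from topological_tendstoD[OF this S] s(2) show False by simp
qed

section \<open>Weak law of large numbers for integrable summands\<close>

text \<open>Independence and centring annihilate the n^2 - n cross terms of the square; each
  diagonal term is at most c^2.\<close>

lemma integral_sum_squared_PiM_le:
  fixes g :: "'a \<Rightarrow> real"
  assumes D: "prob_space D" and g: "g \<in> borel_measurable D" "\<And>x. x \<in> space D \<Longrightarrow> \<bar>g x\<bar> \<le> c"
    and mean: "(\<integral>x. g x \<partial>D) = 0"
  shows "integrable (Pi\<^sub>M {..<n} (\<lambda>_. D)) (\<lambda>x. (\<Sum>i<n. g (x i))\<^sup>2)"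
    and "(\<integral>x. (\<Sum>i<n. g (x i))\<^sup>2 \<partial>Pi\<^sub>M {..<n} (\<lambda>_. D)) \<le> real n * c\<^sup>2"
proof -
  interpret D: prob_space D by fact
  interpret P: product_prob_space "\<lambda>_::nat. D" "{..<n}" by standard
  interpret PP: prob_space "Pi\<^sub>M {..<n} (\<lambda>_::nat. D)" by (rule prob_space_PiM) (rule D)
  \<comment> \<open>Writes g (x i) * g (x j) as a product over all coordinates of one-coordinate
    functions, the form the product integral formula requires. On the diagonal both factors fall on
    one coordinate, hence the square.\<close>
  define f where "f i j = (\<lambda>k. if k = i \<or> k = j then (if i = j then \<lambda>x. (g x)\<^sup>2 else g) else (\<lambda>x. 1))" for i j :: nat
  have prod: "(\<Prod>k<n. f i j k (x k)) = g (x i) * g (x j)" if "i < n" "j < n" for i j and x :: "nat \<Rightarrow> 'a"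
  proof -
    have "(\<Prod>k<n. f i j k (x k)) = (\<Prod>k\<in>{i,j}. f i j k (x k))"
      by (rule prod.mono_neutral_right) (use that in \<open>auto simp: f_def\<close>)
    then show ?thesis by (auto simp: f_def power2_eq_square)
  qed
  have sq: "(g x)\<^sup>2 \<le> c\<^sup>2" if "x \<in> space D" for x
    using power_mono[OF g(2)[OF that] abs_ge_zero, of 2] by simp
  have gi: "integrable D g"
    by (rule D.integrable_const_bound[where B = c]) (use g in auto)
  have gi2: "integrable D (\<lambda>x. (g x)\<^sup>2)"
    by (rule D.integrable_const_bound[where B = "c\<^sup>2"]) (use g sq in auto)
  have fi: "integrable D (f i j k)" for i j k
    using gi gi2 by (auto simp: f_def)
  have int: "integrable (Pi\<^sub>M {..<n} (\<lambda>_. D)) (\<lambda>x. g (x i) * g (x j))" if "i < n" "j < n" for i j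
    using P.product_integrable_prod[of "{..<n}" "f i j"] fi that by (simp add: prod)
  have val: "(\<integral>x. g (x i) * g (x j) \<partial>Pi\<^sub>M {..<n} (\<lambda>_. D)) \<le> (if i = j then c\<^sup>2 else 0)"
    if ij: "i < n" "j < n" for i j
  proof -
    have eq: "(\<integral>x. g (x i) * g (x j) \<partial>Pi\<^sub>M {..<n} (\<lambda>_. D)) = (\<Prod>k<n. integral\<^sup>L D (f i j k))"
      using P.product_integral_prod[of "{..<n}" "f i j"] fi ij by (simp add: prod)
    show ?thesis
    proof (cases "i = j")
      case True
      have "(\<Prod>k<n. integral\<^sup>L D (f i j k)) = (\<Prod>k\<in>{i}. integral\<^sup>L D (f i j k))"
        by (rule prod.mono_neutral_right) (use ij True in \<open>auto simp: f_def D.prob_space\<close>)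
      also have "\<dots> = (\<integral>x. (g x)\<^sup>2 \<partial>D)" using True by (simp add: f_def)
      also have "\<dots> \<le> (\<integral>x. c\<^sup>2 \<partial>D)"
        by (rule integral_mono) (use gi2 sq in auto)
      also have "\<dots> = c\<^sup>2" by (simp add: D.prob_space)
      finally show ?thesis using eq True by simp
    next
      case False
      then have "integral\<^sup>L D (f i j i) = 0" by (simp add: f_def mean)
      then have "(\<Prod>k<n. integral\<^sup>L D (f i j k)) = 0" using ij by (intro prod_zero) auto
      with eq have "(\<integral>x. g (x i) * g (x j) \<partial>Pi\<^sub>M {..<n} (\<lambda>_. D)) = 0" by (rule trans)
      then show ?thesis using False by simp
    qed
  qed
  have exp: "(\<Sum>i<n. g (x i))\<^sup>2 = (\<Sum>i<n. \<Sum>j<n. g (x i) * g (x j))" for x :: "nat \<Rightarrow> 'a"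
    by (simp add: power2_eq_square sum_product)
  show "integrable (Pi\<^sub>M {..<n} (\<lambda>_. D)) (\<lambda>x. (\<Sum>i<n. g (x i))\<^sup>2)"
    unfolding exp by (intro Bochner_Integration.integrable_sum int) auto
  have "(\<integral>x. (\<Sum>i<n. g (x i))\<^sup>2 \<partial>Pi\<^sub>M {..<n} (\<lambda>_. D)) =
      (\<Sum>i<n. \<Sum>j<n. \<integral>x. g (x i) * g (x j) \<partial>Pi\<^sub>M {..<n} (\<lambda>_. D))"
    unfolding exp
    by (subst Bochner_Integration.integral_sum) (auto intro!: Bochner_Integration.integrable_sum int sum.cong Bochner_Integration.integral_sum)
  also have "\<dots> \<le> (\<Sum>i<n. \<Sum>j<n. if i = j then c\<^sup>2 else 0)"
    by (intro sum_mono val) auto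
  also have "\<dots> = real n * c\<^sup>2" by simp
  finally show "(\<integral>x. (\<Sum>i<n. g (x i))\<^sup>2 \<partial>Pi\<^sub>M {..<n} (\<lambda>_. D)) \<le> real n * c\<^sup>2" .
qed

lemma integral_PiM_component:
  fixes k :: "'a \<Rightarrow> real"
  assumes D: "prob_space D" and k: "integrable D k" and i: "i \<in> I"
  shows "integrable (Pi\<^sub>M I (\<lambda>_. D)) (\<lambda>x. k (x i))"
    and "(\<integral>x. k (x i) \<partial>Pi\<^sub>M I (\<lambda>_. D)) = (\<integral>x. k x \<partial>D)"
proof -
  have d: "distr (Pi\<^sub>M I (\<lambda>_. D)) D (\<lambda>\<omega>. \<omega> i) = D"
    using distr_PiM_component[of I "\<lambda>_. D" i] D i by auto
  have m: "(\<lambda>\<omega>. \<omega> i) \<in> measurable (Pi\<^sub>M I (\<lambda>_. D)) D" using i by simp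
  show "integrable (Pi\<^sub>M I (\<lambda>_. D)) (\<lambda>x. k (x i))"
    by (rule integrable_distr[OF m]) (simp add: d k)
  show "(\<integral>x. k (x i) \<partial>Pi\<^sub>M I (\<lambda>_. D)) = (\<integral>x. k x \<partial>D)"
    using integral_distr[OF m, of k] k by (simp add: d)
qed

lemma tail_truncation_small:
  fixes h :: "'a \<Rightarrow> real"
  assumes h: "integrable D h" and e: "0 < e"
  obtains c where "c > 0" "(\<integral>x. \<bar>h x - h x * indicator {x. \<bar>h x\<bar> \<le> c} x\<bar> \<partial>D) < e"
proof -
  note [measurable] = borel_measurable_integrable[OF h]
  have "(\<lambda>m. \<integral>x. \<bar>h x - h x * indicator {x. \<bar>h x\<bar> \<le> real (Suc m)} x\<bar> \<partial>D) \<longlonglongrightarrow> (\<integral>x. 0 \<partial>D)"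
  proof (rule integral_dominated_convergence[where w = "\<lambda>x. \<bar>h x\<bar>"])
    show "AE x in D. (\<lambda>m. \<bar>h x - h x * indicator {x. \<bar>h x\<bar> \<le> real (Suc m)} x\<bar>) \<longlonglongrightarrow> 0"
    proof (rule AE_I2, rule tendsto_eventually)
      fix x
      obtain N where "\<bar>h x\<bar> \<le> real N" using real_arch_simple by blast
      then show "\<forall>\<^sub>F m in sequentially. \<bar>h x - h x * indicator {x. \<bar>h x\<bar> \<le> real (Suc m)} x\<bar> = 0"
        by (intro eventually_sequentiallyI[of N]) auto
    qed
  qed (use h in \<open>auto simp: indicator_def\<close>)
  then have "\<forall>\<^sub>F m in sequentially. (\<integral>x. \<bar>h x - h x * indicator {x. \<bar>h x\<bar> \<le> real (Suc m)} x\<bar> \<partial>D) < e"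
    using e by (auto dest: order_tendstoD(2))
  then obtain m where "(\<integral>x. \<bar>h x - h x * indicator {x. \<bar>h x\<bar> \<le> real (Suc m)} x\<bar> \<partial>D) < e"
    by (auto simp: eventually_sequentially)
  then show ?thesis by (intro that[of "real (Suc m)"]) auto
qed

text \<open>It is applied to functions known only to be integrable (suprema of log ratios, second
  derivatives, the dominating function), so Chebyshev is applied to a truncated and centred version
  \<open>g\<close>, and Markov to the absolute value \<open>k\<close> of the rest.\<close>

theorem weak_law_of_large_numbers:
  fixes h :: "'a \<Rightarrow> real"
  assumes D: "prob_space D" and h: "integrable D h"
  shows "((\<lambda>(n, x). (\<Sum>i<n. h (x i)) / real n) \<longlongrightarrow> (\<integral>x. h x \<partial>D)) (whp (\<lambda>n. Pi\<^sub>M {..<n} (\<lambda>_. D)))"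
proof (rule tendstoI)
  fix e :: real assume e: "0 < e"
  interpret D: prob_space D by fact
  define P where "P n = Pi\<^sub>M {..<n} (\<lambda>_. D)" for n :: nat
  have prP: "prob_space (P n)" for n unfolding P_def by (rule prob_space_PiM) (rule D)
  note [measurable] = borel_measurable_integrable[OF h]
  define \<mu> where "\<mu> = (\<integral>x. h x \<partial>D)"
  define A where "A n = {x \<in> space (P n). e \<le> \<bar>(\<Sum>i<n. h (x i)) / real n - \<mu>\<bar>}" for n
  have mc[measurable]: "(\<lambda>x. h (x i)) \<in> borel_measurable (P n)" if "i < n" for i n
    using that unfolding P_def by simp
  have A: "A n \<in> sets (P n)" for n unfolding A_def by measurable
  have "(\<lambda>n. measure (P n) (A n)) \<longlonglongrightarrow> 0"
  proof (rule LIMSEQ_I)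
    fix \<tau> :: real assume \<tau>: "0 < \<tau>"
    \<comment> \<open>The discarded part and the shift of the mean it causes each contribute at most
      the tail, so \<open>k\<close> has mean at most e * \<tau> / 4, and Markov at height n * e / 2
      gives \<tau> / 2.\<close>
    obtain c where c: "c > 0"
      and tail: "(\<integral>x. \<bar>h x - h x * indicator {x. \<bar>h x\<bar> \<le> c} x\<bar> \<partial>D) < e * \<tau> / 8"
      using tail_truncation_small[OF h, of "e * \<tau> / 8"] e \<tau> by auto
    define h1 where "h1 x = h x * indicator {x. \<bar>h x\<bar> \<le> c} x" for x
    define g where "g x = h1 x - (\<integral>x. h1 x \<partial>D)" for x
    define k where "k x = \<bar>(h x - h1 x) - (\<mu> - (\<integral>x. h1 x \<partial>D))\<bar>" for x
    have h1m[measurable]: "h1 \<in> borel_measurable D" unfolding h1_def by measurable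
    have h1b: "\<bar>h1 x\<bar> \<le> c" for x using c by (auto simp: h1_def indicator_def)
    have h1i: "integrable D h1"
      by (rule D.integrable_const_bound[where B = c]) (use h1b in auto)
    have h1I: "\<bar>\<integral>x. h1 x \<partial>D\<bar> \<le> c"
    proof -
      have "\<bar>\<integral>x. h1 x \<partial>D\<bar> \<le> (\<integral>x. \<bar>h1 x\<bar> \<partial>D)" by (rule integral_abs_bound)
      also have "\<dots> \<le> (\<integral>x. c \<partial>D)" by (rule integral_mono) (use h1i h1b in auto)
      finally show ?thesis by (simp add: D.prob_space)
    qed
    have gm: "g \<in> borel_measurable D" unfolding g_def by measurable
    have gb: "\<bar>g x\<bar> \<le> 2 * c" for x using h1b[of x] h1I by (simp add: g_def abs_if split: if_splits)
    have g0: "(\<integral>x. g x \<partial>D) = 0" using h1i by (simp add: g_def D.prob_space)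
    have ki: "integrable D k" unfolding k_def using h h1i by auto
    have kI: "(\<integral>x. k x \<partial>D) \<le> e * \<tau> / 4"
    proof -
      have m1: "\<bar>\<mu> - (\<integral>x. h1 x \<partial>D)\<bar> \<le> (\<integral>x. \<bar>h x - h1 x\<bar> \<partial>D)"
        using integral_abs_bound[of D "\<lambda>x. h x - h1 x"] h h1i by (simp add: \<mu>_def)
      have "(\<integral>x. k x \<partial>D) \<le> (\<integral>x. \<bar>h x - h1 x\<bar> + \<bar>\<mu> - (\<integral>x. h1 x \<partial>D)\<bar> \<partial>D)"
        by (rule integral_mono) (use ki h h1i in \<open>auto simp: k_def\<close>)
      also have "\<dots> = (\<integral>x. \<bar>h x - h1 x\<bar> \<partial>D) + \<bar>\<mu> - (\<integral>x. h1 x \<partial>D)\<bar>"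
        using h h1i by (simp add: D.prob_space)
      also have "\<dots> \<le> e * \<tau> / 4" using m1 tail by (simp add: h1_def)
      finally show ?thesis .
    qed
    \<comment> \<open>Since |g| <= 2 * c, Chebyshev yields n * (2 * c)^2 / (n * e / 2)^2 = 16 * c^2
      / (e^2 * n); this N pushes it below \<tau> / 2.\<close>
    obtain N :: nat where N: "real N > 64 * c\<^sup>2 / (e\<^sup>2 * \<tau>)" using reals_Archimedean2 by blast
    show "\<exists>no. \<forall>n\<ge>no. norm (measure (P n) (A n) - 0) < \<tau>"
    proof (intro exI[of _ "Suc N"] allI impI)
      fix n assume n: "Suc N \<le> n"
      then have n0: "real n > 0" by simp
      have nN: "real n > 64 * c\<^sup>2 / (e\<^sup>2 * \<tau>)" using N n by simp
      interpret P: prob_space "P n" by (rule prP)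
      define B where "B = {x \<in> space (P n). (real n * e / 2)\<^sup>2 \<le> (\<Sum>i<n. g (x i))\<^sup>2}"
      define C where "C = {x \<in> space (P n). real n * e / 2 \<le> (\<Sum>i<n. k (x i))}"
      have comp: "(\<lambda>x. x i) \<in> measurable (P n) D" if "i < n" for i
        using that unfolding P_def by simp
      have mg: "(\<lambda>x. g (x i)) \<in> borel_measurable (P n)" if "i < n" for i
        by (rule measurable_compose[OF comp[OF that] gm])
      have mk: "(\<lambda>x. k (x i)) \<in> borel_measurable (P n)" if "i < n" for i
        by (rule measurable_compose[OF comp[OF that] borel_measurable_integrable[OF ki]])
      have sets_ge: "{x \<in> space (P n). c \<le> f x} \<in> sets (P n)"
        if "f \<in> borel_measurable (P n)" for f and c :: real
        using that by simp
      have [measurable]: "B \<in> sets (P n)"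
        unfolding B_def by (intro sets_ge borel_measurable_power borel_measurable_sum mg) simp
      have [measurable]: "C \<in> sets (P n)"
        unfolding C_def by (intro sets_ge borel_measurable_sum mk) simp
      have sub: "A n \<subseteq> B \<union> C"
      proof
        fix x assume x: "x \<in> A n"
        have gk: "(\<Sum>i<n. h (x i)) - real n * \<mu> = (\<Sum>i<n. g (x i)) + (\<Sum>i<n. (h (x i) - h1 (x i)) - (\<mu> - (\<integral>x. h1 x \<partial>D)))"
          by (simp add: g_def sum_subtractf sum.distrib algebra_simps)
        have kk: "\<bar>\<Sum>i<n. (h (x i) - h1 (x i)) - (\<mu> - (\<integral>x. h1 x \<partial>D))\<bar> \<le> (\<Sum>i<n. k (x i))"
          unfolding k_def by (rule sum_abs)
        have lin: "E / 2 \<le> \<bar>a\<bar> \<or> E / 2 \<le> c" if "X = a + b" "\<bar>b\<bar> \<le> c" "\<bar>X\<bar> = Y" "E \<le> Y"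
          for E X Y a b c :: real using that by linarith
        have "(\<Sum>i<n. h (x i)) - real n * \<mu> = real n * ((\<Sum>i<n. h (x i)) / real n - \<mu>)"
          using n0 by (simp add: field_simps)
        then have "\<bar>(\<Sum>i<n. h (x i)) - real n * \<mu>\<bar> = real n * \<bar>(\<Sum>i<n. h (x i)) / real n - \<mu>\<bar>"
          by (simp add: abs_mult)
        moreover have "real n * e \<le> real n * \<bar>(\<Sum>i<n. h (x i)) / real n - \<mu>\<bar>"
          using x n0 by (intro mult_left_mono) (auto simp: A_def)
        ultimately have "real n * e / 2 \<le> \<bar>\<Sum>i<n. g (x i)\<bar> \<or> real n * e / 2 \<le> (\<Sum>i<n. k (x i))"
          by (intro lin[OF gk kk])
        moreover have "(real n * e / 2)\<^sup>2 \<le> (\<Sum>i<n. g (x i))\<^sup>2" if "real n * e / 2 \<le> \<bar>\<Sum>i<n. g (x i)\<bar>"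
          using power_mono[OF that, of 2] n0 e by simp
        ultimately show "x \<in> B \<union> C" using x by (auto simp: A_def B_def C_def)
      qed
      have pos: "(real n * e / 2)\<^sup>2 > 0" using n0 e by (intro zero_less_power) simp
      have sqi: "integrable (P n) (\<lambda>x. (\<Sum>i<n. g (x i))\<^sup>2)"
        unfolding P_def by (rule integral_sum_squared_PiM_le(1)[OF D gm gb g0])
      have ski: "integrable (P n) (\<lambda>x. \<Sum>i<n. k (x i))"
        unfolding P_def by (intro Bochner_Integration.integrable_sum integral_PiM_component(1)[OF D ki]) simp
      have "measure (P n) B \<le> (\<integral>x. (\<Sum>i<n. g (x i))\<^sup>2 \<partial>P n) / (real n * e / 2)\<^sup>2"
        unfolding B_def
        by (rule integral_Markov_inequality_measure[OF sqi sets.empty_sets _ pos]) simp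
      also have "\<dots> \<le> (real n * (2 * c)\<^sup>2) / (real n * e / 2)\<^sup>2"
        by (intro divide_right_mono) (use integral_sum_squared_PiM_le(2)[OF D gm gb g0, of n] in \<open>auto simp: P_def\<close>)
      also have "\<dots> = 16 * c\<^sup>2 / (e\<^sup>2 * real n)"
        using n0 e by (simp add: power_mult_distrib power_divide) (simp add: power2_eq_square)
      also have "\<dots> < \<tau> / 2"
      proof -
        have "64 * c\<^sup>2 < real n * (e\<^sup>2 * \<tau>)"
          using nN e \<tau> by (simp add: pos_divide_less_eq)
        moreover have "0 \<le> c\<^sup>2" by simp
        moreover have "\<tau> / 2 * (e\<^sup>2 * real n) = real n * (e\<^sup>2 * \<tau>) / 2" by simp
        ultimately have "16 * c\<^sup>2 < \<tau> / 2 * (e\<^sup>2 * real n)" by linarith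
        then show ?thesis using n0 e by (simp add: pos_divide_less_eq)
      qed
      finally have PB: "measure (P n) B < \<tau> / 2" .
      have "measure (P n) C \<le> (\<integral>x. (\<Sum>i<n. k (x i)) \<partial>P n) / (real n * e / 2)"
        unfolding C_def
      proof (rule integral_Markov_inequality_measure[OF ski sets.empty_sets])
        show "AE x in P n. 0 \<le> (\<Sum>i<n. k (x i))"
          by (rule AE_I2) (simp add: k_def sum_nonneg)
      qed (use n0 e in simp)
      also have "(\<integral>x. (\<Sum>i<n. k (x i)) \<partial>P n) = real n * (\<integral>x. k x \<partial>D)"
      proof -
        have "(\<integral>x. (\<Sum>i<n. k (x i)) \<partial>P n) = (\<Sum>i<n. \<integral>x. k (x i) \<partial>P n)"
          unfolding P_def by (intro Bochner_Integration.integral_sum integral_PiM_component(1)[OF D ki])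
        also have "\<dots> = (\<Sum>i<n. \<integral>x. k x \<partial>D)"
          unfolding P_def by (intro sum.cong refl integral_PiM_component(2)[OF D ki])
        finally show ?thesis by simp
      qed
      also have "\<dots> / (real n * e / 2) \<le> real n * (e * \<tau> / 4) / (real n * e / 2)"
        using kI n0 e by (intro divide_right_mono mult_left_mono) auto
      also have "\<dots> = \<tau> / 2" using n0 e by simp
      finally have PC: "measure (P n) C \<le> \<tau> / 2" .
      have "measure (P n) (A n) \<le> measure (P n) (B \<union> C)"
        by (rule P.finite_measure_mono[OF sub]) simp
      also have "\<dots> \<le> measure (P n) B + measure (P n) C"
        by (rule measure_Un_le) simp_all
      finally show "norm (measure (P n) (A n) - 0) < \<tau>" using PB PC by simp
    qed
  qed
  then have "(\<lambda>n. ennreal (measure (P n) (A n))) \<longlonglongrightarrow> ennreal 0"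
    by (rule tendsto_ennrealI)
  moreover have "emeasure (P n) (A n) = ennreal (measure (P n) (A n))" for n
  proof -
    interpret P: prob_space "P n" by (rule prP)
    show ?thesis by (rule P.emeasure_eq_measure)
  qed
  ultimately have lim: "(\<lambda>n. emeasure (P n) (A n)) \<longlonglongrightarrow> 0" by simp
  show "\<forall>\<^sub>F z in whp (\<lambda>n. Pi\<^sub>M {..<n} (\<lambda>_. D)).
      dist (case z of (n, x) \<Rightarrow> (\<Sum>i<n. h (x i)) / real n) (\<integral>x. h x \<partial>D) < e"
    unfolding P_def[symmetric] \<mu>_def[symmetric] eventually_whp
  proof (intro exI[of _ A] conjI allI ballI)
    fix n x assume "x \<in> space (P n) - A n"
    then show "dist (case (n, x) of (n, x) \<Rightarrow> (\<Sum>i<n. h (x i)) / real n) \<mu> < e"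
      by (simp add: A_def dist_real_def not_le)
  qed (rule A lim)+
qed

section \<open>Laplace's method with moments\<close>


lemma power_add_le_double:
  fixes a b :: real
  assumes "0 \<le> a" "0 \<le> b"
  shows "(a + b) ^ i \<le> 2 ^ i * (a ^ i + b ^ i)"
proof -
  have "(a + b) ^ i \<le> (2 * max a b) ^ i"
    by (rule power_mono) (use assms in auto)
  also have "\<dots> = 2 ^ i * max a b ^ i" by (simp add: power_mult_distrib)
  also have "max a b ^ i \<le> a ^ i + b ^ i"
    using assms by (cases "a \<le> b") (auto simp: max_def)
  finally show ?thesis by simp
qed

lemma tendsto_power_mult_exp_neg_square:
  fixes s :: "nat \<Rightarrow> real"
  assumes s: "filterlim s at_top sequentially" and \<eta>: "0 < \<eta>"
  shows "(\<lambda>k. s k ^ m * exp (- \<eta> * (s k)\<^sup>2)) \<longlonglongrightarrow> 0"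
proof (rule tendsto_sandwich[of "\<lambda>_. 0" _ _ "\<lambda>k. ((\<eta> * s k) ^ m / exp (\<eta> * s k)) / \<eta> ^ m"])
  have "((\<lambda>x::real. x ^ m / exp x) \<longlongrightarrow> 0) at_top" by (rule tendsto_power_div_exp_0)
  moreover have "filterlim (\<lambda>k. \<eta> * s k) at_top sequentially"
    by (rule filterlim_tendsto_pos_mult_at_top[OF tendsto_const \<eta> s])
  ultimately have "(\<lambda>k. (\<eta> * s k) ^ m / exp (\<eta> * s k)) \<longlonglongrightarrow> 0"
    by (rule filterlim_compose)
  then show "(\<lambda>k. ((\<eta> * s k) ^ m / exp (\<eta> * s k)) / \<eta> ^ m) \<longlonglongrightarrow> 0"
    by (rule tendsto_divide_zero)
  have ge1: "\<forall>\<^sub>F k in sequentially. 1 \<le> s k"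
    using s by (simp add: filterlim_at_top)
  show "\<forall>\<^sub>F k in sequentially. 0 \<le> s k ^ m * exp (- \<eta> * (s k)\<^sup>2)"
    using ge1 by eventually_elim simp
  show "\<forall>\<^sub>F k in sequentially. s k ^ m * exp (- \<eta> * (s k)\<^sup>2)
      \<le> ((\<eta> * s k) ^ m / exp (\<eta> * s k)) / \<eta> ^ m"
    using ge1
  proof eventually_elim
    case (elim k)
    have "s k * 1 \<le> s k * s k" by (intro mult_left_mono) (use elim in auto)
    then have "\<eta> * s k \<le> \<eta> * (s k)\<^sup>2"
      using \<eta> by (simp add: power2_eq_square)
    then have "s k ^ m * exp (- \<eta> * (s k)\<^sup>2) \<le> s k ^ m * exp (- (\<eta> * s k))"
      using elim by (intro mult_left_mono) auto
    also have "\<dots> = ((\<eta> * s k) ^ m / exp (\<eta> * s k)) / \<eta> ^ m"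
      using \<eta> by (simp add: power_mult_distrib exp_minus field_simps)
    finally show ?case .
  qed
qed simp

text \<open>Each epsilon comes with its own threshold for k, so there is no single pair of sequences
  to squeeze between. For a given target level, continuity of the bounds at epsilon = 0 selects one
  epsilon that suffices.\<close>

lemma tendsto_between_exp:
  fixes R :: "nat \<Rightarrow> real"
  assumes "\<And>\<epsilon>. 0 < \<epsilon> \<Longrightarrow> \<forall>\<^sub>F k in sequentially. exp (- (1 + \<epsilon>) * q) \<le> R k \<and> R k \<le> exp (- (1 - \<epsilon>) * q)"
  shows "R \<longlonglongrightarrow> exp (- q)"
proof (rule order_tendstoI)
  have pos: "\<forall>\<^sub>F \<epsilon> in at_right (0::real). 0 < \<epsilon>" by (rule eventually_at_right_less)
  fix a assume a: "a < exp (- q)"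
  have "((\<lambda>\<epsilon>. exp (- (1 + \<epsilon>) * q)) \<longlongrightarrow> exp (- (1 + 0) * q)) (at_right 0)"
    by (intro tendsto_intros)
  then have "\<forall>\<^sub>F \<epsilon> in at_right 0. a < exp (- (1 + \<epsilon>) * q)"
    using a by (intro order_tendstoD(1)) auto
  with pos have "\<forall>\<^sub>F \<epsilon> in at_right 0. 0 < \<epsilon> \<and> a < exp (- (1 + \<epsilon>) * q)"
    by eventually_elim simp
  then obtain \<epsilon> where e: "0 < \<epsilon>" "a < exp (- (1 + \<epsilon>) * q)"
    using eventually_happens[of _ "at_right (0::real)"] trivial_limit_at_right_real[of "0::real"] by blast
  show "\<forall>\<^sub>F k in sequentially. a < R k"
    using assms[OF e(1)] by eventually_elim (use e(2) in linarith)
next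
  have pos: "\<forall>\<^sub>F \<epsilon> in at_right (0::real). 0 < \<epsilon>" by (rule eventually_at_right_less)
  fix a assume a: "exp (- q) < a"
  have "((\<lambda>\<epsilon>. exp (- (1 - \<epsilon>) * q)) \<longlongrightarrow> exp (- (1 - 0) * q)) (at_right 0)"
    by (intro tendsto_intros)
  then have "\<forall>\<^sub>F \<epsilon> in at_right 0. exp (- (1 - \<epsilon>) * q) < a"
    using a by (intro order_tendstoD(2)) auto
  with pos have "\<forall>\<^sub>F \<epsilon> in at_right 0. 0 < \<epsilon> \<and> exp (- (1 - \<epsilon>) * q) < a"
    by eventually_elim simp
  then obtain \<epsilon> where e: "0 < \<epsilon>" "exp (- (1 - \<epsilon>) * q) < a"
    using eventually_happens[of _ "at_right (0::real)"] trivial_limit_at_right_real[of "0::real"] by blast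
  show "\<forall>\<^sub>F k in sequentially. R k < a"
    using assms[OF e(1)] by eventually_elim (use e(2) in linarith)
qed

text \<open>Deterministic core: \<open>s\<close> stands for the square root of n I, \<open>T\<close>
  for the MLE and \<open>R\<close> for the likelihood ratio along one sequence of data strings. Near
  \<open>t0\<close> the substitution \<theta> = T + v / s turns the integral into a dominated limit;
  far away the exponential rate beats s^(i+1). The hypotheses on measurability and on the far region
  concern w * R, because the likelihood is arbitrary off the parameter set, where w
  vanishes.\<close>

lemma laplace_moment:
  fixes w :: "real \<Rightarrow> real" and R :: "nat \<Rightarrow> real \<Rightarrow> real" and s T :: "nat \<Rightarrow> real"
  assumes s: "filterlim s at_top sequentially"
    and T: "T \<longlonglongrightarrow> t0"
    and wm[measurable]: "w \<in> borel_measurable borel" and w0: "\<And>\<theta>. 0 \<le> w \<theta>" and wc: "isCont w t0"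
    and wi: "integrable lborel w" "integrable lborel (\<lambda>\<theta>. \<bar>\<theta>\<bar> ^ i * w \<theta>)"
    and m[measurable]: "\<And>k. (\<lambda>\<theta>. w \<theta> * R k \<theta>) \<in> borel_measurable borel"
    and near: "\<And>\<epsilon>. 0 < \<epsilon> \<Longrightarrow> \<exists>\<delta>>0. \<forall>\<^sub>F k in sequentially. \<forall>\<theta>. \<bar>\<theta> - t0\<bar> < \<delta> \<longrightarrow>
        exp (- (1 + \<epsilon>) * ((s k * (\<theta> - T k))\<^sup>2 / 2)) \<le> R k \<theta> \<and>
        R k \<theta> \<le> exp (- (1 - \<epsilon>) * ((s k * (\<theta> - T k))\<^sup>2 / 2))"
    and far: "\<And>\<delta>. 0 < \<delta> \<Longrightarrow> \<exists>\<eta>>0. \<forall>\<^sub>F k in sequentially. \<forall>\<theta>. \<delta> \<le> \<bar>\<theta> - t0\<bar> \<longrightarrow>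
        0 \<le> w \<theta> * R k \<theta> \<and> w \<theta> * R k \<theta> \<le> w \<theta> * exp (- \<eta> * (s k)\<^sup>2)"
  shows "(\<lambda>k. s k ^ (i + 1) * (\<integral>\<theta>. (\<theta> - T k) ^ i * (w \<theta> * R k \<theta>) \<partial>lborel))
    \<longlonglongrightarrow> w t0 * (sqrt (2 * pi) * (\<integral>v. std_normal_density v * v ^ i \<partial>lborel))"
proof -
  \<comment> \<open>The fixed choice epsilon = 1/2 provides the Gaussian majorant; smaller values
    are used later for the pointwise limit only.\<close>
  obtain d1 where d1: "0 < d1" "\<forall>\<^sub>F k in sequentially. \<forall>\<theta>. \<bar>\<theta> - t0\<bar> < d1 \<longrightarrow>
        exp (- (1 + 1/2) * ((s k * (\<theta> - T k))\<^sup>2 / 2)) \<le> R k \<theta> \<and>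
        R k \<theta> \<le> exp (- (1 - 1/2) * ((s k * (\<theta> - T k))\<^sup>2 / 2))"
    using near[of "1/2"] by auto
  obtain d2 where d2: "0 < d2" "\<And>\<theta>. \<bar>\<theta> - t0\<bar> < d2 \<Longrightarrow> \<bar>w \<theta> - w t0\<bar> < 1"
    using wc unfolding continuous_at_eps_delta dist_real_def by (metis zero_less_one)
  define d where "d = min d1 d2"
  have d: "0 < d" using d1 d2 by (simp add: d_def)
  define W where "W = w t0 + 1"
  have W: "w \<theta> \<le> W" if "\<bar>\<theta> - t0\<bar> < d" for \<theta> using d2(2)[of \<theta>] that by (simp add: W_def d_def)
  have nearR: "\<forall>\<^sub>F k in sequentially. \<forall>\<theta>. \<bar>\<theta> - t0\<bar> < d \<longrightarrow>
        0 \<le> R k \<theta> \<and> R k \<theta> \<le> exp (- (s k * (\<theta> - T k))\<^sup>2 / 4)"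
    using d1(2) by eventually_elim (auto simp: d_def intro: order_trans[OF exp_ge_zero])
  obtain \<eta> where \<eta>: "0 < \<eta>" and farR: "\<forall>\<^sub>F k in sequentially. \<forall>\<theta>. d \<le> \<bar>\<theta> - t0\<bar> \<longrightarrow>
        0 \<le> w \<theta> * R k \<theta> \<and> w \<theta> * R k \<theta> \<le> w \<theta> * exp (- \<eta> * (s k)\<^sup>2)"
    using far[OF d] by auto
  have spos: "\<forall>\<^sub>F k in sequentially. 0 < s k" using s by (simp add: filterlim_at_top_dense)
  define g where "g k \<theta> = (\<theta> - T k) ^ i * (w \<theta> * R k \<theta>)" for k \<theta>
  have [measurable]: "g k \<in> borel_measurable borel" for k unfolding g_def by measurable
  define N where "N = {\<theta>. \<bar>\<theta> - t0\<bar> < d}"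
  have [measurable]: "N \<in> sets borel" unfolding N_def by measurable
  \<comment> \<open>The near part after the substitution: of s^(i+1), one factor is consumed by the
    Jacobian 1 / s and i factors turn (v / s)^i into v^i.\<close>
  define F where "F k v = indicator N (T k + v / s k) * (v ^ i * (w (T k + v / s k) * R k (T k + v / s k)))" for k v
  have scale: "F k v = s k ^ i * (indicator N (T k + (1 / s k) * v) * g k (T k + (1 / s k) * v))"
    if "0 < s k" for k v
    using that by (simp add: F_def g_def power_divide)
  have Fm[measurable]: "F k \<in> borel_measurable borel" if "0 < s k" for k
  proof -
    have "F k = (\<lambda>v. s k ^ i * (indicator N (T k + (1 / s k) * v) * g k (T k + (1 / s k) * v)))"
      using scale[OF that] by (simp add: fun_eq_iff)
    then show ?thesis by simp
  qed
  \<comment> \<open>Up to a constant exp (- v^2 / 4) is the density of N(0, 2), so \<open>H\<close>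
    is integrable as one of its absolute moments.\<close>
  define H where "H v = W * (\<bar>v\<bar> ^ i * exp (- v\<^sup>2 / 4))" for v :: real
  have Hint: "integrable lborel H"
  proof -
    have "integrable lborel (\<lambda>x. normal_density 0 (sqrt 2) x * \<bar>x - 0\<bar> ^ i)"
      by (rule integrable_normal_moment_abs) simp
    then have "integrable lborel (\<lambda>x. (W * sqrt (2 * pi * 2)) * (normal_density 0 (sqrt 2) x * \<bar>x - 0\<bar> ^ i))"
      by (rule integrable_mult_right)
    then show ?thesis
      by (simp add: H_def[abs_def] normal_density_def mult_ac)
  qed
  have Fle: "\<forall>\<^sub>F k in sequentially. 0 < s k \<and> (\<forall>v. \<bar>F k v\<bar> \<le> H v)"
    using spos nearR
  proof eventually_elim
    case (elim k)
    have "\<bar>F k v\<bar> \<le> H v" for v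
    proof (cases "T k + v / s k \<in> N")
      case True
      then have *: "\<bar>T k + v / s k - t0\<bar> < d" by (simp add: N_def)
      have r: "0 \<le> R k (T k + v / s k)" "R k (T k + v / s k) \<le> exp (- v\<^sup>2 / 4)"
        using elim(2)[rule_format, OF *] elim(1) by auto
      have "w (T k + v / s k) * R k (T k + v / s k) \<le> W * exp (- v\<^sup>2 / 4)"
        using W[OF *] r w0[of "T k + v / s k"] by (intro mult_mono) (auto intro: order_trans)
      then have "\<bar>v\<bar> ^ i * (w (T k + v / s k) * R k (T k + v / s k)) \<le> \<bar>v\<bar> ^ i * (W * exp (- v\<^sup>2 / 4))"
        by (intro mult_left_mono) auto
      then show ?thesis
        using True r w0 by (simp add: F_def H_def abs_mult power_abs mult_ac)
    next
      case False
      then show ?thesis using w0[of t0] by (simp add: F_def H_def W_def)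
    qed
    with elim show ?case by simp
  qed
  have Tv: "(\<lambda>k. T k + v / s k) \<longlonglongrightarrow> t0" for v
  proof -
    have "(\<lambda>k. T k + v / s k) \<longlonglongrightarrow> t0 + 0"
      by (intro tendsto_add T tendsto_divide_0[OF tendsto_const] filterlim_at_top_imp_at_infinity s)
    then show ?thesis by simp
  qed
  have Tvd: "\<forall>\<^sub>F k in sequentially. \<bar>T k + v / s k - t0\<bar> < \<delta>" if "0 < \<delta>" for v \<delta>
    using tendstoD[OF Tv that] by (simp add: dist_real_def)
  have Flim: "(\<lambda>k. F k v) \<longlonglongrightarrow> 1 * (v ^ i * (w t0 * exp (- (v\<^sup>2 / 2))))" for v
    unfolding F_def
  proof (intro tendsto_mult tendsto_const)
    show "(\<lambda>k. indicat_real N (T k + v / s k)) \<longlonglongrightarrow> 1"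
      by (rule tendsto_eventually) (use Tvd[OF d, of v] in \<open>auto simp: N_def elim: eventually_mono\<close>)
    show "(\<lambda>k. w (T k + v / s k)) \<longlonglongrightarrow> w t0"
      by (rule isCont_tendsto_compose[OF wc Tv])
    show "(\<lambda>k. R k (T k + v / s k)) \<longlonglongrightarrow> exp (- (v\<^sup>2 / 2))"
    proof (rule tendsto_between_exp)
      fix \<epsilon> :: real assume "0 < \<epsilon>"
      then obtain \<delta> where \<delta>: "0 < \<delta>" and ev: "\<forall>\<^sub>F k in sequentially. \<forall>\<theta>. \<bar>\<theta> - t0\<bar> < \<delta> \<longrightarrow>
        exp (- (1 + \<epsilon>) * ((s k * (\<theta> - T k))\<^sup>2 / 2)) \<le> R k \<theta> \<and>
        R k \<theta> \<le> exp (- (1 - \<epsilon>) * ((s k * (\<theta> - T k))\<^sup>2 / 2))" using near by blast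
      show "\<forall>\<^sub>F k in sequentially. exp (- (1 + \<epsilon>) * (v\<^sup>2 / 2)) \<le> R k (T k + v / s k) \<and>
          R k (T k + v / s k) \<le> exp (- (1 - \<epsilon>) * (v\<^sup>2 / 2))"
        using ev Tvd[OF \<delta>, of v] spos
      proof eventually_elim
        case (elim k)
        have "s k * (T k + v / s k - T k) = v" using elim(3) by simp
        then show ?case using elim(1)[rule_format, OF elim(2)] by simp
      qed
    qed
  qed
  \<comment> \<open>The majorant is valid only from some index on, so dominated convergence is
    applied to the shifted sequence.\<close>
  obtain k0 where k0: "\<And>k. k0 \<le> k \<Longrightarrow> 0 < s k \<and> (\<forall>v. \<bar>F k v\<bar> \<le> H v)"
    using Fle by (auto simp: eventually_sequentially)
  have "(\<lambda>k. \<integral>v. F (k + k0) v \<partial>lborel) \<longlonglongrightarrow> (\<integral>v. 1 * (v ^ i * (w t0 * exp (- (v\<^sup>2 / 2)))) \<partial>lborel)"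
  proof (rule integral_dominated_convergence[where w = H])
    show "AE v in lborel. (\<lambda>k. F (k + k0) v) \<longlonglongrightarrow> 1 * (v ^ i * (w t0 * exp (- (v\<^sup>2 / 2))))"
      by (rule AE_I2) (rule LIMSEQ_ignore_initial_segment[OF Flim])
  qed (use k0 Hint Fm in auto)
  then have lim1: "(\<lambda>k. \<integral>v. F k v \<partial>lborel) \<longlonglongrightarrow> (\<integral>v. 1 * (v ^ i * (w t0 * exp (- (v\<^sup>2 / 2)))) \<partial>lborel)"
    by (rule LIMSEQ_offset)
  have eqlim: "(\<integral>v. 1 * (v ^ i * (w t0 * exp (- (v\<^sup>2 / 2)))) \<partial>lborel) =
      w t0 * (sqrt (2 * pi) * (\<integral>v. std_normal_density v * v ^ i \<partial>lborel))"
    by (subst integral_mult_right_zero[symmetric])+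
       (auto intro!: Bochner_Integration.integral_cong simp: std_normal_density_def field_simps)
  define t where "t = \<bar>t0\<bar> + 1"
  have Tt: "\<forall>\<^sub>F k in sequentially. \<bar>T k\<bar> \<le> t"
    using tendstoD[OF T zero_less_one] by eventually_elim (auto simp: dist_real_def t_def)
  \<comment> \<open>With \<open>t\<close> an eventual bound for |T k|, this dominates the i-th
    absolute prior moment about every T k, independently of k.\<close>
  define K where "K = (\<integral>\<theta>. 2 ^ i * (\<bar>\<theta>\<bar> ^ i * w \<theta> + t ^ i * w \<theta>) \<partial>lborel)"
  have Kint: "integrable lborel (\<lambda>\<theta>. 2 ^ i * (\<bar>\<theta>\<bar> ^ i * w \<theta> + t ^ i * w \<theta>))"
    using wi by auto
  have gfar: "\<forall>\<^sub>F k in sequentially. \<forall>\<theta>. \<bar>indicator (- N) \<theta> * g k \<theta>\<bar> \<le>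
      exp (- \<eta> * (s k)\<^sup>2) * (2 ^ i * (\<bar>\<theta>\<bar> ^ i * w \<theta> + t ^ i * w \<theta>))"
    using farR Tt
  proof eventually_elim
    case (elim k)
    show ?case
    proof
      fix \<theta>
      show "\<bar>indicator (- N) \<theta> * g k \<theta>\<bar> \<le> exp (- \<eta> * (s k)\<^sup>2) * (2 ^ i * (\<bar>\<theta>\<bar> ^ i * w \<theta> + t ^ i * w \<theta>))"
      proof (cases "\<theta> \<in> N")
        case True
        then show ?thesis using w0[of \<theta>] by (simp add: t_def)
      next
        case False
        then have *: "d \<le> \<bar>\<theta> - t0\<bar>" by (simp add: N_def)
        have r: "0 \<le> w \<theta> * R k \<theta>" "w \<theta> * R k \<theta> \<le> w \<theta> * exp (- \<eta> * (s k)\<^sup>2)"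
          using elim(1)[rule_format, OF *] by auto
        have "\<bar>\<theta> - T k\<bar> ^ i \<le> (\<bar>\<theta>\<bar> + t) ^ i"
          by (rule power_mono) (use elim(2) in auto)
        also have "\<dots> \<le> 2 ^ i * (\<bar>\<theta>\<bar> ^ i + t ^ i)"
          by (rule power_add_le_double) (auto simp: t_def)
        finally have "\<bar>\<theta> - T k\<bar> ^ i * (w \<theta> * R k \<theta>) \<le> 2 ^ i * (\<bar>\<theta>\<bar> ^ i + t ^ i) * (w \<theta> * exp (- \<eta> * (s k)\<^sup>2))"
          by (intro mult_mono r) (auto simp: t_def intro!: r(1) mult_nonneg_nonneg add_nonneg_nonneg)
        moreover have "\<bar>g k \<theta>\<bar> = \<bar>\<theta> - T k\<bar> ^ i * (w \<theta> * R k \<theta>)"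
          unfolding g_def by (subst abs_mult) (simp only: power_abs abs_of_nonneg[OF r(1)])
        ultimately show ?thesis
          using False by (simp add: algebra_simps)
      qed
    qed
  qed
  have far_lim: "(\<lambda>k. s k ^ (i + 1) * (\<integral>\<theta>. indicator (- N) \<theta> * g k \<theta> \<partial>lborel)) \<longlonglongrightarrow> 0"
  proof (rule Lim_null_comparison)
    show "(\<lambda>k. s k ^ (i + 1) * exp (- \<eta> * (s k)\<^sup>2) * K) \<longlonglongrightarrow> 0"
      by (rule tendsto_mult_left_zero[OF tendsto_power_mult_exp_neg_square[OF s \<eta>]])
    show "\<forall>\<^sub>F k in sequentially. norm (s k ^ (i + 1) * (\<integral>\<theta>. indicator (- N) \<theta> * g k \<theta> \<partial>lborel))
        \<le> s k ^ (i + 1) * exp (- \<eta> * (s k)\<^sup>2) * K"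
      using gfar spos
    proof eventually_elim
      case (elim k)
      have "\<bar>\<integral>\<theta>. indicator (- N) \<theta> * g k \<theta> \<partial>lborel\<bar> \<le>
          (\<integral>\<theta>. exp (- \<eta> * (s k)\<^sup>2) * (2 ^ i * (\<bar>\<theta>\<bar> ^ i * w \<theta> + t ^ i * w \<theta>)) \<partial>lborel)"
        by (rule order_trans[OF integral_abs_bound], rule integral_mono_AE')
           (use Kint elim(1) w0 in \<open>auto simp: t_def\<close>)
      also have "\<dots> = exp (- \<eta> * (s k)\<^sup>2) * K" unfolding K_def by simp
      finally have "\<bar>\<integral>\<theta>. indicator (- N) \<theta> * g k \<theta> \<partial>lborel\<bar> \<le> exp (- \<eta> * (s k)\<^sup>2) * K" .
      then have "s k ^ (i + 1) * \<bar>\<integral>\<theta>. indicator (- N) \<theta> * g k \<theta> \<partial>lborel\<bar> \<le> s k ^ (i + 1) * (exp (- \<eta> * (s k)\<^sup>2) * K)"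
        using elim(2) by (intro mult_left_mono) auto
      then show ?case using elim(2) by (simp add: abs_mult mult_ac)
    qed
  qed
  have "\<forall>\<^sub>F k in sequentially. (\<integral>v. F k v \<partial>lborel) + s k ^ (i + 1) * (\<integral>\<theta>. indicator (- N) \<theta> * g k \<theta> \<partial>lborel)
      = s k ^ (i + 1) * (\<integral>\<theta>. g k \<theta> \<partial>lborel)"
    using Fle gfar
  proof eventually_elim
    case (elim k)
    then have sk: "0 < s k" by simp
    have Fi: "integrable lborel (F k)"
      by (rule Bochner_Integration.integrable_bound[OF Hint]) (use Fm[OF sk] elim(1) in \<open>auto intro: order_trans[OF _ abs_ge_self]\<close>)
    have Fi': "integrable lborel (\<lambda>v. s k ^ i * (indicator N (T k + (1 / s k) * v) * g k (T k + (1 / s k) * v)))"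
      using Fi scale[OF sk] by (simp cong: Bochner_Integration.integrable_cong)
    then have "integrable lborel (\<lambda>v. indicator N (T k + (1 / s k) * v) * g k (T k + (1 / s k) * v))"
      using sk by simp
    then have i1: "integrable lborel (\<lambda>\<theta>. indicator N \<theta> * g k \<theta>)"
      using sk by (subst (asm) lborel_integrable_real_affine_iff[of "1 / s k" "\<lambda>\<theta>. indicator N \<theta> * g k \<theta>" "T k"]) auto
    have i2: "integrable lborel (\<lambda>\<theta>. indicator (- N) \<theta> * g k \<theta>)"
      by (rule Bochner_Integration.integrable_bound[OF integrable_mult_right[OF Kint, of "exp (- \<eta> * (s k)\<^sup>2)"]])
         (use elim(2) in \<open>auto intro: order_trans[OF _ abs_ge_self]\<close>)
    have "(\<integral>\<theta>. g k \<theta> \<partial>lborel) = (\<integral>\<theta>. indicator N \<theta> * g k \<theta> + indicator (- N) \<theta> * g k \<theta> \<partial>lborel)"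
      by (intro Bochner_Integration.integral_cong) (auto simp: indicator_def)
    also have "\<dots> = (\<integral>\<theta>. indicator N \<theta> * g k \<theta> \<partial>lborel) + (\<integral>\<theta>. indicator (- N) \<theta> * g k \<theta> \<partial>lborel)"
      by (rule Bochner_Integration.integral_add[OF i1 i2])
    finally have split: "(\<integral>\<theta>. g k \<theta> \<partial>lborel) =
      (\<integral>\<theta>. indicator N \<theta> * g k \<theta> \<partial>lborel) + (\<integral>\<theta>. indicator (- N) \<theta> * g k \<theta> \<partial>lborel)" .
    have "(\<integral>v. F k v \<partial>lborel) = s k ^ i * (\<integral>v. indicator N (T k + (1 / s k) * v) * g k (T k + (1 / s k) * v) \<partial>lborel)"
      using scale[OF sk] by (simp cong: Bochner_Integration.integral_cong)
    also have "\<dots> = s k ^ (i + 1) * (\<integral>\<theta>. indicator N \<theta> * g k \<theta> \<partial>lborel)"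
      using sk by (subst (2) lborel_integral_real_affine[of "1 / s k" _ "T k"]) auto
    finally show ?case using split by (simp add: algebra_simps)
  qed
  moreover have "(\<lambda>k. (\<integral>v. F k v \<partial>lborel) + s k ^ (i + 1) * (\<integral>\<theta>. indicator (- N) \<theta> * g k \<theta> \<partial>lborel))
    \<longlonglongrightarrow> w t0 * (sqrt (2 * pi) * (\<integral>v. std_normal_density v * v ^ i \<partial>lborel)) + 0"
    using tendsto_add[OF lim1 far_lim] unfolding eqlim .
  ultimately show ?thesis
    unfolding g_def by (simp add: tendsto_cong)
qed

section \<open>Gaussian moments and the Gamma formula\<close>

text \<open>Odd moments vanish by symmetry. The even ones are (2k)! / (2^k k!), and the Gamma
  quotient satisfies the same recursion in k: both gain the factor 2k + 1, by Gamma (z + 1) = z *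
  Gamma z at z = k + 1/2.\<close>

lemma std_normal_moment_eq_lambda_rr:
  "(\<integral>v. std_normal_density v * v ^ r \<partial>lborel) = lambda_rr r"
proof (cases "even r")
  case False
  then obtain k where "r = 2 * k + 1" by (auto elim: oddE)
  with False show ?thesis
    using integral_std_normal_moment_odd[of k] by (simp add: lambda_rr_def)
next
  case True
  then obtain k where r: "r = 2 * k" by (auto elim: evenE)
  have half: "(1/2::real) \<notin> \<int>\<^sub>\<le>\<^sub>0" by (auto elim!: nonpos_Ints_cases)
  have fs: "(2 * real m + 1) * (fact (2 * m) / (2 ^ m * fact m)) = (fact (2 * Suc m) / (2 ^ Suc m * fact (Suc m)) :: real)" for m
  proof -
    have "(fact (2 * Suc m) :: real) = 2 * (real m + 1) * ((2 * real m + 1) * fact (2 * m))"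
      by (simp add: algebra_simps)
    moreover have "(2 ^ Suc m * fact (Suc m) :: real) = 2 * (real m + 1) * (2 ^ m * fact m)"
      by (simp add: algebra_simps)
    ultimately have "(fact (2 * Suc m) / (2 ^ Suc m * fact (Suc m)) :: real) =
        (2 * (real m + 1) * ((2 * real m + 1) * fact (2 * m))) / (2 * (real m + 1) * (2 ^ m * fact m))"
      by (simp only:)
    also have "\<dots> = ((2 * real m + 1) * fact (2 * m)) / (2 ^ m * fact m)"
      by (rule mult_divide_mult_cancel_left) simp
    finally show ?thesis by simp
  qed
  have *: "2 ^ k * Gamma (real k + 1/2) / Gamma (1/2) = (fact (2 * k) / (2 ^ k * fact k) :: real)"
  proof (induction k)
    case (Suc k)
    have "real k + 1/2 \<notin> \<int>\<^sub>\<le>\<^sub>0" using of_nat_0_le_iff[of k, where 'a = real] by (auto elim!: nonpos_Ints_cases simp del: of_nat_0_le_iff)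
    then have "Gamma (real (Suc k) + 1/2) = (real k + 1/2) * Gamma (real k + 1/2)"
      using Gamma_plus1[of "real k + 1/2"] by (simp add: add_ac)
    then have "2 ^ Suc k * Gamma (real (Suc k) + 1/2) / Gamma (1/2) =
        (2 * real k + 1) * (2 ^ k * Gamma (real k + 1/2) / Gamma (1/2))"
      by (simp add: algebra_simps)
    also have "\<dots> = (2 * real k + 1) * (fact (2 * k) / (2 ^ k * fact k))" using Suc.IH by simp
    also have "\<dots> = fact (2 * Suc k) / (2 ^ Suc k * fact (Suc k))"
      by (rule fs)
    finally show ?case .
  qed (use Gamma_eq_zero_iff[of "1/2::real"] half in auto)
  have "lambda_rr r = 2 ^ k * Gamma (real k + 1/2) / Gamma (1/2)"
    using r by (simp add: lambda_rr_def powr_realpow add_divide_distrib)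
  then show ?thesis
    using integral_std_normal_moment_even[of k] r * by simp
qed

section \<open>Wald's consistency argument\<close>


text \<open>Makes suprema over uncountable parameter sets measurable in the observation: continuity
  replaces them by suprema over a countable dense subset.\<close>

lemma SUP_dense_eq:
  fixes f :: "'a::metric_space \<Rightarrow> ennreal"
  assumes f: "continuous_on B f" and D: "D \<subseteq> B" "B \<subseteq> closure D"
  shows "(SUP t\<in>B. f t) = (SUP t\<in>D. f t)"
proof (rule antisym)
  show "(SUP t\<in>B. f t) \<le> (SUP t\<in>D. f t)"
  proof (rule SUP_least)
    fix b assume b: "b \<in> B"
    then obtain s where s: "\<And>n. s n \<in> D" "s \<longlonglongrightarrow> b"
      using D(2) closure_sequential by blast
    have "(\<lambda>n. f (s n)) \<longlonglongrightarrow> f b"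
      by (rule continuous_on_tendsto_compose[OF f s(2) b], rule always_eventually) (use s(1) D(1) in auto)
    then show "f b \<le> (SUP t\<in>D. f t)"
      by (rule LIMSEQ_le_const2) (auto intro: SUP_upper s(1))
  qed
qed (rule SUP_subset_mono[OF D(1)], simp)

context regular_bayes_model
begin

abbreviation "P0 \<equiv> model M p \<theta>0"
abbreviation "Pn \<equiv> sample M p \<theta>0"

lemma true_param: "\<theta>0 \<in> \<Omega>"
  using true_interior interior_subset by blast

lemma space_model [simp]: "space (model M p \<theta>) = space M"
  and sets_model [measurable_cong, simp]: "sets (model M p \<theta>) = sets M"
  by (simp_all add: model_def)

lemma prob_P0: "prob_space P0"
  by (rule dens_prob[OF true_param])

lemma sample_eq: "Pn = (\<lambda>n. Pi\<^sub>M {..<n} (\<lambda>_. P0))"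
  by (simp add: sample_def fun_eq_iff)

lemma prob_Pn: "prob_space (Pn n)"
  unfolding sample_def by (rule prob_space_PiM) (rule prob_P0)

lemma AE_model_iff:
  assumes "\<theta> \<in> \<Omega>"
  shows "(AE x in model M p \<theta>. Q x) \<longleftrightarrow> (AE x in M. 0 < p x \<theta> \<longrightarrow> Q x)"
  unfolding model_def using dens_measurable[OF assms] by (subst AE_density) auto

lemma AE_true_dens_pos: "AE x in P0. 0 < p x \<theta>0"
  by (simp add: AE_model_iff[OF true_param])

lemma AE_sample:
  assumes "AE x in P0. Q x"
  shows "AE x in Pn n. \<forall>i<n. Q (x i)"
proof -
  have "AE x in Pn n. \<forall>i\<in>{..<n}. Q (x i)"
    unfolding sample_def using assms prob_P0
    by (intro AE_finite_allI AE_PiM_component) auto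
  then show ?thesis by (rule eventually_mono) auto
qed

lemma whp_AE:
  assumes "AE x in P0. Q x"
  shows "\<forall>\<^sub>F (n, x) in whp Pn. \<forall>i<n. Q (x i)"
  by (rule eventually_whp_AE) (use AE_sample[OF assms] in auto)

lemma lln:
  fixes h :: "'a \<Rightarrow> real"
  assumes "integrable P0 h"
  shows "((\<lambda>(n, x). (\<Sum>i<n. h (x i)) / real n) \<longlongrightarrow> (\<integral>x. h x \<partial>P0)) (whp Pn)"
  unfolding sample_eq by (rule weak_law_of_large_numbers[OF prob_P0 assms])

lemma likelihood_nonneg:
  assumes "\<forall>i<n. x i \<in> space M" "\<theta> \<in> \<Omega>"
  shows "0 \<le> likelihood p n x \<theta>"
  unfolding likelihood_def by (rule prod_nonneg) (use assms dens_nonneg in auto)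

lemma borel_measurable_SUP_cont:
  fixes f :: "'a \<Rightarrow> real \<Rightarrow> ennreal"
  assumes "\<And>x. x \<in> space M \<Longrightarrow> continuous_on B (f x)"
    and m: "\<And>\<theta>. \<theta> \<in> B \<Longrightarrow> (\<lambda>x. f x \<theta>) \<in> borel_measurable M"
  shows "(\<lambda>x. SUP \<theta>\<in>B. f x \<theta>) \<in> borel_measurable M"
proof -
  obtain D where D: "countable D" "D \<subseteq> B" "B \<subseteq> closure D" by (rule separable)
  have "(\<lambda>x. SUP \<theta>\<in>D. f x \<theta>) \<in> borel_measurable M"
    by (rule borel_measurable_SUP[OF D(1)]) (use m D(2) in auto)
  then show ?thesis
    by (subst measurable_cong[OF SUP_dense_eq[OF assms(1) D(2,3)]])
qed

text \<open>
  Truncating the likelihood ratio from below at \<open>a\<close> keeps its logarithm integrable even where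
  \<open>p x \<theta>\<close> vanishes; dividing by \<open>a\<close> makes the logarithm nonnegative, so that the supremum can be taken in
  the extended nonnegative reals and is 0 for empty \<open>B\<close>.
\<close>

definition sup_excess :: "real \<Rightarrow> real set \<Rightarrow> 'a \<Rightarrow> ennreal" where
  "sup_excess a B x = (SUP \<theta>\<in>B. ennreal (ln (max (p x \<theta> / p x \<theta>0) a / a)))"

lemma excess_continuous:
  assumes "x \<in> space M" "B \<subseteq> \<Omega>" "0 < a"
  shows "continuous_on B (\<lambda>\<theta>. ennreal (ln (max (p x \<theta> / p x \<theta>0) a / a)))"
proof -
  have c: "continuous_on B (p x)"
    using dens_cont[OF assms(1)] assms(2) by (rule continuous_on_subset)
  have "continuous_on B (\<lambda>\<theta>. ln (max (p x \<theta> * inverse (p x \<theta>0)) a * inverse a))"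
    by (intro continuous_intros c) (use assms(3) in auto)
  then show ?thesis by (auto simp: divide_inverse intro!: continuous_on_ennreal)
qed

lemma sup_excess_measurable [measurable]:
  assumes "B \<subseteq> \<Omega>" "0 < a"
  shows "sup_excess a B \<in> borel_measurable M"
  unfolding sup_excess_def[abs_def]
proof (rule borel_measurable_SUP_cont)
  fix \<theta> assume "\<theta> \<in> B"
  then have [measurable]: "(\<lambda>x. p x \<theta>) \<in> borel_measurable M" "(\<lambda>x. p x \<theta>0) \<in> borel_measurable M"
    using assms true_param dens_measurable by auto
  show "(\<lambda>x. ennreal (ln (max (p x \<theta> / p x \<theta>0) a / a))) \<in> borel_measurable M" by measurable
qed (use assms excess_continuous in auto)

text \<open>For nonempty \<open>B\<close>, adding ln a to both sides of \<open>small\<close> shows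
  that the supremum over \<open>B\<close> of the truncated log ratio has negative mean. By the law
  of large numbers the average log ratio is then below a negative constant for all \<theta> in
  \<open>B\<close> simultaneously.\<close>

lemma likelihood_decay_if_sup_excess:
  assumes B: "B \<subseteq> \<Omega>" and a: "0 < a" "a < 1"
    and small: "(\<integral>\<^sup>+x. sup_excess a B x \<partial>P0) < ennreal (- ln a)"
  shows "\<exists>\<eta>>0. \<forall>\<^sub>F (n, x) in whp Pn. \<forall>\<theta>\<in>B. likelihood p n x \<theta> \<le> exp (- \<eta> * real n) * likelihood p n x \<theta>0"
proof -
  have Hm[measurable]: "sup_excess a B \<in> borel_measurable P0"
    using sup_excess_measurable[OF B a(1)] by (simp add: model_def)
  \<comment> \<open>The excess has finite mean and is thus finite almost surely, so passing to the
    real-valued version loses nothing on the relevant samples.\<close>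
  define h where "h x = enn2real (sup_excess a B x)" for x
  have hm[measurable]: "h \<in> borel_measurable P0" unfolding h_def by measurable
  have le: "(\<integral>\<^sup>+x. ennreal (h x) \<partial>P0) \<le> (\<integral>\<^sup>+x. sup_excess a B x \<partial>P0)"
    by (rule nn_integral_mono) (auto simp: h_def ennreal_enn2real_if)
  have hi: "integrable P0 h"
    by (rule integrableI_nonneg) (use le small in \<open>auto simp: h_def intro: le_less_trans less_trans\<close>)
  have fin: "AE x in P0. sup_excess a B x \<noteq> \<infinity>"
    by (rule nn_integral_PInf_AE[OF Hm]) (use small in auto)
  define c where "c = (\<integral>x. h x \<partial>P0)"
  have "(\<integral>\<^sup>+x. ennreal (h x) \<partial>P0) = ennreal c"
    unfolding c_def by (rule nn_integral_eq_integral[OF hi]) (simp add: h_def)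
  then have "ennreal c < ennreal (- ln a)" using le small by simp
  then have c: "c < - ln a" using a by (simp add: ennreal_less_iff c_def h_def)
  \<comment> \<open>The midpoint between the mean c and - ln a; half of the gap absorbs the random
    fluctuation and the other half is the decay rate \<eta>.\<close>
  define c' where "c' = (c - ln a) / 2"
  define \<eta> where "\<eta> = - ln a - c'"
  have c': "c < c'" and \<eta>: "0 < \<eta>" using c by (simp_all add: c'_def \<eta>_def field_simps)
  have ev1: "\<forall>\<^sub>F z in whp Pn. (case z of (n, x) \<Rightarrow> (\<Sum>i<n. h (x i)) / real n) < c'"
    by (rule order_tendstoD(2)[OF lln[OF hi]]) (use c' in \<open>simp add: c_def\<close>)
  have ev2: "\<forall>\<^sub>F (n, x) in whp Pn. \<forall>i<n. sup_excess a B (x i) \<noteq> \<infinity> \<and> 0 < p (x i) \<theta>0 \<and> x i \<in> space M"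
    by (rule whp_AE) (use fin AE_true_dens_pos AE_space[of P0] in auto)
  have ev3: "\<forall>\<^sub>F (n, x) in whp Pn. (0::nat) < n"
    by (rule eventually_whp_index) (rule eventually_gt_at_top)
  have "\<forall>\<^sub>F (n, x) in whp Pn. \<forall>\<theta>\<in>B. likelihood p n x \<theta> \<le> exp (- \<eta> * real n) * likelihood p n x \<theta>0"
    using ev1 ev2 ev3
  proof eventually_elim
    case (elim z)
    obtain n x where z: "z = (n, x)" by force
    have n: "0 < n" and avg: "(\<Sum>i<n. h (x i)) / real n < c'"
      and fin: "\<And>i. i < n \<Longrightarrow> sup_excess a B (x i) \<noteq> \<infinity>"
      and pos: "\<And>i. i < n \<Longrightarrow> 0 < p (x i) \<theta>0" and sp: "\<And>i. i < n \<Longrightarrow> x i \<in> space M"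
      using elim z by auto
    have sumh: "(\<Sum>i<n. h (x i)) \<le> c' * real n" using avg n by (simp add: field_simps)
    have "likelihood p n x \<theta> \<le> exp (- \<eta> * real n) * likelihood p n x \<theta>0" if \<theta>: "\<theta> \<in> B" for \<theta>
    proof -
      have pi: "p (x i) \<theta> \<le> p (x i) \<theta>0 * (a * exp (h (x i)))" if i: "i < n" for i
      proof -
        define r where "r = p (x i) \<theta> / p (x i) \<theta>0"
        have "ennreal (ln (max r a / a)) \<le> sup_excess a B (x i)"
          unfolding sup_excess_def r_def by (rule SUP_upper[OF \<theta>])
        also have "\<dots> = ennreal (h (x i))"
          using fin[OF i] by (simp add: h_def ennreal_enn2real_if)
        finally have "ln (max r a / a) \<le> h (x i)" by (simp add: h_def)
        then have "exp (ln (max r a / a)) \<le> exp (h (x i))" by simp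
        then have "max r a / a \<le> exp (h (x i))" using a by simp
        then have "r \<le> a * exp (h (x i))" using a by (simp add: field_simps)
        then show ?thesis using pos[OF i] by (simp add: r_def field_simps)
      qed
      have "likelihood p n x \<theta> \<le> (\<Prod>i<n. p (x i) \<theta>0 * (a * exp (h (x i))))"
        unfolding likelihood_def
        by (rule prod_mono) (use pi dens_nonneg sp \<theta> B in auto)
      also have "\<dots> = likelihood p n x \<theta>0 * (a ^ n * exp (\<Sum>i<n. h (x i)))"
        by (simp add: likelihood_def prod.distrib exp_sum)
      also have "\<dots> \<le> likelihood p n x \<theta>0 * exp (- \<eta> * real n)"
      proof (rule mult_left_mono)
        have "a ^ n = exp (ln a * real n)" using a by (simp add: exp_of_nat2_mult)
        then have "a ^ n * exp (\<Sum>i<n. h (x i)) = exp (ln a * real n + (\<Sum>i<n. h (x i)))"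
          by (simp add: exp_add)
        also have "\<dots> \<le> exp (- \<eta> * real n)" using sumh by (simp add: \<eta>_def algebra_simps)
        finally show "a ^ n * exp (\<Sum>i<n. h (x i)) \<le> exp (- \<eta> * real n)" .
      qed (use likelihood_nonneg sp true_param in auto)
      finally show ?thesis by (simp add: mult.commute)
    qed
    then show ?case using z by simp
  qed
  then show ?thesis using \<eta> by blast
qed

text \<open>Envelope for dominated convergence over shrinking sets \<open>B\<close>: the first term
  is integrable by the expected local sup condition on \<open>C\<close>, the second by integrability
  of the log density at \<open>\<theta>0\<close>.\<close>

lemma sup_excess_le:
  assumes x: "x \<in> space M" "0 < p x \<theta>0" and B: "B \<subseteq> C" "C \<subseteq> \<Omega>" and a: "0 < a" "a < 1"
  shows "sup_excess a B x \<le> (SUP \<theta>\<in>C. ennreal (max 0 (ln (p x \<theta>)))) + ennreal (\<bar>ln (p x \<theta>0)\<bar> + - ln a)"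
  unfolding sup_excess_def
proof (rule SUP_least)
  fix \<theta> assume \<theta>: "\<theta> \<in> B"
  have la: "0 \<le> - ln a" using a by simp
  have "ln (max (p x \<theta> / p x \<theta>0) a / a) \<le> max 0 (ln (p x \<theta>)) + (\<bar>ln (p x \<theta>0)\<bar> + - ln a)"
  proof (cases "p x \<theta> / p x \<theta>0 \<le> a")
    case True
    then have "ln (max (p x \<theta> / p x \<theta>0) a / a) = 0" using a by (simp add: max_def)
    then show ?thesis using la by linarith
  next
    case False
    then have "0 < p x \<theta> / p x \<theta>0" using a by linarith
    then have "0 < p x \<theta>" using x by (simp add: zero_less_divide_iff)
    then have "ln (max (p x \<theta> / p x \<theta>0) a / a) = ln (p x \<theta>) - (ln (p x \<theta>0) + ln a)"
      using False x a by (simp add: max_def ln_div ln_mult)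
    then show ?thesis by linarith
  qed
  then have "ennreal (ln (max (p x \<theta> / p x \<theta>0) a / a)) \<le> ennreal (max 0 (ln (p x \<theta>)) + (\<bar>ln (p x \<theta>0)\<bar> + - ln a))"
    by (rule ennreal_leI)
  also have "\<dots> = ennreal (max 0 (ln (p x \<theta>))) + ennreal (\<bar>ln (p x \<theta>0)\<bar> + - ln a)"
    using la by (intro ennreal_plus) auto
  also have "\<dots> \<le> (SUP \<theta>\<in>C. ennreal (max 0 (ln (p x \<theta>)))) + ennreal (\<bar>ln (p x \<theta>0)\<bar> + - ln a)"
    by (intro add_right_mono SUP_upper) (use \<theta> B in auto)
  finally show "ennreal (ln (max (p x \<theta> / p x \<theta>0) a / a))
     \<le> (SUP \<theta>\<in>C. ennreal (max 0 (ln (p x \<theta>)))) + ennreal (\<bar>ln (p x \<theta>0)\<bar> + - ln a)" .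
qed

text \<open>The integrand equals ln (max 1 y) at y = p x \<theta> >= 0, including y = 0 because
  \<open>ln 0 = 0\<close>. In that form it is visibly continuous in y.\<close>

lemma sup_log_measurable:
  assumes "C \<subseteq> \<Omega>"
  shows "(\<lambda>x. SUP \<theta>\<in>C. ennreal (max 0 (ln (p x \<theta>)))) \<in> borel_measurable M"
proof (rule borel_measurable_SUP_cont)
  fix x assume x: "x \<in> space M"
  have c: "continuous_on C (p x)"
    using dens_cont[OF x] assms by (rule continuous_on_subset)
  have "continuous_on C (\<lambda>\<theta>. ennreal (ln (max 1 (p x \<theta>))))"
    by (intro continuous_on_ennreal continuous_intros c) auto
  moreover have "ln (max 1 (p x \<theta>)) = max 0 (ln (p x \<theta>))" if "\<theta> \<in> C" for \<theta>
  proof -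
    have "0 \<le> p x \<theta>" using dens_nonneg[OF x] that assms by auto
    then consider "p x \<theta> = 0" | "0 < p x \<theta>" "p x \<theta> \<le> 1" | "1 < p x \<theta>" by linarith
    then show ?thesis by cases (auto simp: max_def)
  qed
  ultimately show "continuous_on C (\<lambda>\<theta>. ennreal (max 0 (ln (p x \<theta>))))"
    by (simp cong: continuous_on_cong)
next
  fix \<theta> assume "\<theta> \<in> C"
  then have [measurable]: "(\<lambda>x. p x \<theta>) \<in> borel_measurable M"
    using assms dens_measurable by auto
  show "(\<lambda>x. ennreal (max 0 (ln (p x \<theta>)))) \<in> borel_measurable M" by measurable
qed

text \<open>Common end of the local and the tail case: the sets \<open>B k\<close> shrink, the
  excess converges to \<open>u\<close>, and a strict bound on the mean of \<open>u\<close> passes to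
  some finite k.\<close>

lemma sup_excess_limit:
  assumes B: "\<And>k. B k \<subseteq> C" and C: "C \<subseteq> \<Omega>" and a: "0 < a" "a < 1"
    and fin: "(\<integral>\<^sup>+x. (SUP \<theta>\<in>C. ennreal (max 0 (ln (p x \<theta>)))) \<partial>P0) < \<infinity>"
    and u: "u \<in> borel_measurable M"
    and lim: "\<And>x. x \<in> space M \<Longrightarrow> 0 < p x \<theta>0 \<Longrightarrow> (\<lambda>k. sup_excess a (B k) x) \<longlonglongrightarrow> u x"
    and small: "(\<integral>\<^sup>+x. u x \<partial>P0) < ennreal (- ln a)"
  shows "\<exists>k::nat. (\<integral>\<^sup>+x. sup_excess a (B k) x \<partial>P0) < ennreal (- ln a)"
proof -
  interpret P0: prob_space P0 by (rule prob_P0)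
  note [measurable] = sup_log_measurable[OF C] dens_measurable[OF true_param] u
  have mm: "f \<in> borel_measurable P0" if "f \<in> borel_measurable M" for f :: "'a \<Rightarrow> ennreal"
    using that by (simp add: model_def)
  have "(\<lambda>k. \<integral>\<^sup>+x. sup_excess a (B k) x \<partial>P0) \<longlonglongrightarrow> (\<integral>\<^sup>+x. u x \<partial>P0)"
  proof (rule nn_integral_dominated_convergence)
    show "sup_excess a (B k) \<in> borel_measurable P0" for k
      by (rule mm, rule sup_excess_measurable) (use B C a in auto)
    show "u \<in> borel_measurable P0" by (rule mm[OF u])
    show "(\<lambda>x. (SUP \<theta>\<in>C. ennreal (max 0 (ln (p x \<theta>)))) + ennreal (\<bar>ln (p x \<theta>0)\<bar> + - ln a)) \<in> borel_measurable P0"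
      by (rule mm) measurable
    show "AE x in P0. sup_excess a (B k) x \<le> (SUP \<theta>\<in>C. ennreal (max 0 (ln (p x \<theta>)))) + ennreal (\<bar>ln (p x \<theta>0)\<bar> + - ln a)" for k
      using AE_true_dens_pos AE_space[of P0]
      by eventually_elim (rule sup_excess_le, use B C a in auto)
    have "integrable P0 (\<lambda>x. \<bar>ln (p x \<theta>0)\<bar> + - ln a)"
      using log_integrable by (intro Bochner_Integration.integrable_add) auto
    then have fin2: "(\<integral>\<^sup>+x. ennreal (\<bar>ln (p x \<theta>0)\<bar> + - ln a) \<partial>P0) < \<infinity>"
    proof (subst nn_integral_eq_integral)
      have "0 \<le> - ln a" using a by simp
      then show "AE x in P0. 0 \<le> \<bar>ln (p x \<theta>0)\<bar> + - ln a" by (intro AE_I2 add_nonneg_nonneg) auto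
    qed auto
    have m1: "(\<lambda>x. SUP \<theta>\<in>C. ennreal (max 0 (ln (p x \<theta>)))) \<in> borel_measurable P0"
      by (rule mm[OF sup_log_measurable[OF C]])
    have m2: "(\<lambda>x. ennreal (\<bar>ln (p x \<theta>0)\<bar> + - ln a)) \<in> borel_measurable P0"
      by (rule mm) measurable
    show "(\<integral>\<^sup>+x. (SUP \<theta>\<in>C. ennreal (max 0 (ln (p x \<theta>)))) + ennreal (\<bar>ln (p x \<theta>0)\<bar> + - ln a) \<partial>P0) < \<infinity>"
      unfolding nn_integral_add[OF m1 m2] using fin fin2 by (simp add: less_top)
    show "AE x in P0. (\<lambda>k. sup_excess a (B k) x) \<longlonglongrightarrow> u x"
      using AE_true_dens_pos AE_space[of P0] by eventually_elim (rule lim, auto)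
  qed
  then have "\<forall>\<^sub>F k in sequentially. (\<integral>\<^sup>+x. sup_excess a (B k) x \<partial>P0) < ennreal (- ln a)"
    by (rule order_tendstoD(2)) (rule small)
  then show ?thesis by (auto simp: eventually_sequentially)
qed

text \<open>Integrability comes from sqrt y <= (1 + y) / 2. If the affinity were at least 1, the
  mean of (sqrt Y - 1)^2 would be at most 0, so the density ratio \<open>Y\<close> would be 1 almost
  surely and the two laws would coincide, against identifiability.\<close>

lemma hellinger_affinity_less_1:
  assumes \<theta>: "\<theta> \<in> \<Omega>" "\<theta> \<noteq> \<theta>0"
  shows "integrable P0 (\<lambda>x. sqrt (p x \<theta> / p x \<theta>0))"
    and "(\<integral>x. sqrt (p x \<theta> / p x \<theta>0) \<partial>P0) < 1"
proof -
  interpret P0: prob_space P0 by (rule prob_P0)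
  note [measurable] = dens_measurable[OF true_param] dens_measurable[OF \<theta>(1)]
  define Y where "Y x = p x \<theta> / p x \<theta>0" for x
  have [measurable]: "Y \<in> borel_measurable M" unfolding Y_def by measurable
  have [measurable]: "Y \<in> borel_measurable P0" by (simp add: model_def)
  have nn: "0 \<le> p x \<theta>" "0 \<le> p x \<theta>0" "0 \<le> Y x" if "x \<in> space M" for x
    using dens_nonneg that \<theta> true_param by (auto simp: Y_def)
  have mass: "(\<integral>\<^sup>+x. ennreal (p x t) \<partial>M) = 1" if t: "t \<in> \<Omega>" for t
    using prob_space.emeasure_space_1[OF dens_prob[OF t]] dens_measurable[OF t]
    by (simp add: model_def emeasure_density cong: nn_integral_cong)
  have "(\<integral>\<^sup>+x. ennreal (Y x) \<partial>P0) = (\<integral>\<^sup>+x. ennreal (p x \<theta>0) * ennreal (Y x) \<partial>M)"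
    unfolding model_def by (rule nn_integral_density) measurable
  \<comment> \<open>Only an inequality: where p x \<theta>0 = 0 the left integrand is 0, while p x
    \<theta> may be positive.\<close>
  also have "\<dots> \<le> (\<integral>\<^sup>+x. ennreal (p x \<theta>) \<partial>M)"
  proof (rule nn_integral_mono)
    fix x assume x: "x \<in> space M"
    have "p x \<theta>0 * Y x \<le> p x \<theta>" using nn[OF x] by (simp add: Y_def)
    then show "ennreal (p x \<theta>0) * ennreal (Y x) \<le> ennreal (p x \<theta>)"
      using nn[OF x] by (simp add: ennreal_mult[symmetric] ennreal_leI)
  qed
  finally have Yle: "(\<integral>\<^sup>+x. ennreal (Y x) \<partial>P0) \<le> 1" using mass[OF \<theta>(1)] by simp
  have Yi: "integrable P0 Y"
    by (rule integrableI_nonneg) (use Yle nn in \<open>auto intro: le_less_trans\<close>)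
  have EY: "(\<integral>x. Y x \<partial>P0) \<le> 1"
  proof -
    have "ennreal (\<integral>x. Y x \<partial>P0) \<le> ennreal 1"
      using Yle by (subst nn_integral_eq_integral[OF Yi, symmetric]) (use nn in auto)
    then show ?thesis by simp
  qed
  have sq: "sqrt y \<le> (1 + y) / 2" if "0 \<le> y" for y :: real
    using arith_geo_mean_sqrt[of 1 y] that by simp
  show si: "integrable P0 (\<lambda>x. sqrt (p x \<theta> / p x \<theta>0))"
    unfolding Y_def[symmetric]
    by (rule Bochner_Integration.integrable_bound[of _ "\<lambda>x. (1 + Y x) / 2"])
       (use Yi nn sq in \<open>auto simp: abs_of_nonneg\<close>)
  show "(\<integral>x. sqrt (p x \<theta> / p x \<theta>0) \<partial>P0) < 1"
  proof (rule ccontr)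
    assume "\<not> ?thesis"
    then have ge: "1 \<le> (\<integral>x. sqrt (Y x) \<partial>P0)" by (simp add: Y_def)
    have si': "integrable P0 (\<lambda>x. sqrt (Y x))" using si by (simp add: Y_def)
    have eq: "(sqrt (Y x) - 1)\<^sup>2 = Y x - 2 * sqrt (Y x) + 1" if "x \<in> space P0" for x
      using nn[of x] that by (simp add: power2_diff)
    have i2: "integrable P0 (\<lambda>x. (sqrt (Y x) - 1)\<^sup>2)"
      by (subst Bochner_Integration.integrable_cong[OF refl eq]) (use Yi si' in auto)
    have "(\<integral>x. (sqrt (Y x) - 1)\<^sup>2 \<partial>P0) = (\<integral>x. Y x - 2 * sqrt (Y x) + 1 \<partial>P0)"
      by (rule Bochner_Integration.integral_cong[OF refl eq])
    also have "\<dots> = (\<integral>x. Y x \<partial>P0) - 2 * (\<integral>x. sqrt (Y x) \<partial>P0) + 1"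
      using Yi si' by (simp add: P0.prob_space[unfolded space_model])
    also have "\<dots> \<le> 0" using ge EY by simp
    finally have "(\<integral>x. (sqrt (Y x) - 1)\<^sup>2 \<partial>P0) = 0"
      by (intro antisym Bochner_Integration.integral_nonneg) auto
    then have "AE x in P0. (sqrt (Y x) - 1)\<^sup>2 = 0"
      using integral_nonneg_eq_0_iff_AE[OF i2] by auto
    then have "AE x in P0. Y x = 1" by eventually_elim auto
    then have "AE x in M. 0 < p x \<theta>0 \<longrightarrow> Y x = 1"
      by (simp add: AE_model_iff[OF true_param])
    \<comment> \<open>On the null set of p x \<theta>0 nothing is known about p x \<theta> beyond
      its sign. The difference is therefore shown to be nonnegative, and equality of the total
      masses forces it to vanish.\<close>
    then have AEle: "AE x in M. 0 \<le> p x \<theta> - p x \<theta>0"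
      using AE_space[of M]
    proof eventually_elim
      case (elim x)
      then show ?case using nn[of x] by (cases "p x \<theta>0 = 0") (auto simp: Y_def field_simps)
    qed
    have int: "integrable M (\<lambda>x. p x t)" "(\<integral>x. p x t \<partial>M) = 1" if t: "t \<in> \<Omega>" for t
    proof -
      have nnt: "AE x in M. 0 \<le> p x t" by (rule AE_I2) (use dens_nonneg t in auto)
      show i: "integrable M (\<lambda>x. p x t)"
        by (rule integrableI_nonneg[OF dens_measurable[OF t] nnt]) (simp add: mass[OF t])
      show "(\<integral>x. p x t \<partial>M) = 1"
        using nn_integral_eq_integral[OF i nnt] mass[OF t] integral_nonneg_AE[OF nnt]
        by (simp add: ennreal_1[symmetric] del: ennreal_1)
    qed
    have "integrable M (\<lambda>x. p x \<theta> - p x \<theta>0)" using int \<theta> true_param by auto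
    moreover have "(\<integral>x. p x \<theta> - p x \<theta>0 \<partial>M) = 0" using int \<theta> true_param by simp
    ultimately have "AE x in M. p x \<theta> - p x \<theta>0 = 0"
      using integral_nonneg_eq_0_iff_AE[of M "\<lambda>x. p x \<theta> - p x \<theta>0"] AEle by blast
    then have "AE x in M. ennreal (p x \<theta>) = ennreal (p x \<theta>0)" by eventually_elim simp
    then have "model M p \<theta> = model M p \<theta>0"
      unfolding model_def by (intro density_cong) measurable
    then show False using identifiable \<theta> true_param by (auto dest: inj_onD)
  qed
qed

text \<open>As the balls shrink to \<theta>', continuity of the density turns the supremum into the
  value \<open>u\<close> at \<theta>'. The truncation level has to be chosen beforehand, small
  enough for the mean of \<open>u\<close> to stay below - ln a.\<close>

lemma sup_excess_local:
  assumes \<theta>: "\<theta>' \<in> \<Omega>" "\<theta>' \<noteq> \<theta>0"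
  shows "\<exists>a \<rho>. 0 < a \<and> a < 1 \<and> 0 < \<rho> \<and>
    (\<integral>\<^sup>+x. sup_excess a {\<theta>\<in>\<Omega>. \<bar>\<theta> - \<theta>'\<bar> < \<rho>} x \<partial>P0) < ennreal (- ln a)"
proof -
  interpret P0: prob_space P0 by (rule prob_P0)
  note [measurable] = dens_measurable[OF true_param] dens_measurable[OF \<theta>(1)]
  define Y where "Y x = p x \<theta>' / p x \<theta>0" for x
  have [measurable]: "Y \<in> borel_measurable M" unfolding Y_def by measurable
  have Y0: "0 \<le> Y x" if "x \<in> space M" for x
    using dens_nonneg that \<theta> true_param by (auto simp: Y_def)
  define A where "A = (\<integral>x. sqrt (Y x) \<partial>P0)"
  have si: "integrable P0 (\<lambda>x. sqrt (Y x))" and A1: "A < 1"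
    using hellinger_affinity_less_1[OF \<theta>] by (simp_all add: Y_def A_def)
  have A0: "0 \<le> A" unfolding A_def by (rule integral_nonneg_AE, rule AE_I2) (use Y0 in auto)
  \<comment> \<open>Truncation costs at most sqrt a on top of the affinity \<open>A\<close>.
    Spending half of the deficit 1 - A on it leaves 2 * (A + sqrt a - 1) = A - 1 < 0.\<close>
  define a where "a = ((1 - A) / 2)\<^sup>2"
  have sa: "sqrt a = (1 - A) / 2" using A1 by (simp add: a_def)
  have a0: "0 < a" using A1 by (simp add: a_def)
  have a1: "a < 1"
    unfolding a_def using A0 A1 by (simp add: abs_square_less_1)
  obtain \<rho> where \<rho>: "0 < \<rho>"
    and fin: "(\<integral>\<^sup>+x. (SUP \<theta>\<in>{\<theta>\<in>\<Omega>. \<bar>\<theta> - \<theta>'\<bar> < \<rho>}. ennreal (max 0 (ln (p x \<theta>)))) \<partial>P0) < \<infinity>"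
    using log_sup_local[OF \<theta>(1)] by blast
  define B where "B k = {\<theta>\<in>\<Omega>. \<bar>\<theta> - \<theta>'\<bar> < \<rho> / real (Suc k)}" for k
  define u where "u x = ennreal (ln (max (Y x) a / a))" for x
  have "\<exists>k. (\<integral>\<^sup>+x. sup_excess a (B k) x \<partial>P0) < ennreal (- ln a)"
  proof (rule sup_excess_limit[OF _ _ a0 a1 fin])
    show "B k \<subseteq> {\<theta>\<in>\<Omega>. \<bar>\<theta> - \<theta>'\<bar> < \<rho>}" for k
    proof -
      have "\<rho> / real (Suc k) \<le> \<rho> / 1" using \<rho> by (intro divide_left_mono) auto
      then show ?thesis by (auto simp: B_def)
    qed
    show "u \<in> borel_measurable M" unfolding u_def by measurable
    fix x assume x: "x \<in> space M" "0 < p x \<theta>0"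
    define f where "f \<theta> = ennreal (ln (max (p x \<theta> / p x \<theta>0) a / a))" for \<theta>
    have cf: "continuous_on \<Omega> f" unfolding f_def by (rule excess_continuous) (use x a0 in auto)
    have fu: "f \<theta>' = u x" by (simp add: f_def u_def Y_def)
    show "(\<lambda>k. sup_excess a (B k) x) \<longlonglongrightarrow> u x"
    proof (rule order_tendstoI)
      fix c assume "c < u x"
      moreover have "u x \<le> sup_excess a (B k) x" for k
        unfolding fu[symmetric] sup_excess_def f_def by (rule SUP_upper) (use \<theta> \<rho> in \<open>simp add: B_def\<close>)
      ultimately show "\<forall>\<^sub>F k in sequentially. c < sup_excess a (B k) x"
        by (intro always_eventually allI) (rule less_le_trans)
    next
      fix c assume "u x < c"
      then obtain d where d: "u x < d" "d < c" using dense by blast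
      have "(f \<longlongrightarrow> f \<theta>') (at \<theta>' within \<Omega>)" using cf \<theta>(1) by (simp add: continuous_on_def)
      then have "\<forall>\<^sub>F \<theta> in at \<theta>' within \<Omega>. f \<theta> < d"
        using d fu by (intro order_tendstoD(2)) auto
      then obtain \<delta> where \<delta>: "0 < \<delta>" "\<And>\<theta>. \<theta> \<in> \<Omega> \<Longrightarrow> \<theta> \<noteq> \<theta>' \<Longrightarrow> dist \<theta> \<theta>' < \<delta> \<Longrightarrow> f \<theta> < d"
        unfolding eventually_at by blast
      have "(\<lambda>k. \<rho> / real (Suc k)) \<longlonglongrightarrow> 0" by (rule LIMSEQ_Suc[OF lim_const_over_n])
      then have "\<forall>\<^sub>F k in sequentially. \<rho> / real (Suc k) < \<delta>"
        using \<delta>(1) by (rule order_tendstoD(2))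
      then show "\<forall>\<^sub>F k in sequentially. sup_excess a (B k) x < c"
      proof eventually_elim
        case (elim k)
        have "f \<theta> \<le> d" if "\<theta> \<in> B k" for \<theta>
        proof (cases "\<theta> = \<theta>'")
          case True
          then show ?thesis using d fu by simp
        next
          case False
          then show ?thesis using \<delta>(2)[of \<theta>] that elim by (auto simp: B_def dist_real_def intro: less_imp_le)
        qed
        then have "sup_excess a (B k) x \<le> d"
          unfolding sup_excess_def f_def[symmetric] by (rule SUP_least)
        then show ?case using d(2) by (rule le_less_trans)
      qed
    qed
  next
    \<comment> \<open>From \<open>ln m = 2 ln (sqrt m) \<le> 2 (sqrt m - 1)\<close>: the mean of the truncated log ratio is bounded
      by the Hellinger affinity \<open>A < 1\<close>, with no integrability of \<open>ln (p x \<theta>')\<close> required.\<close>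
    define g where "g x = 2 * (sqrt (Y x) + sqrt a - 1) + - ln a" for x
    have gi: "integrable P0 g" unfolding g_def using si by (intro Bochner_Integration.integrable_add integrable_mult_right Bochner_Integration.integrable_diff) auto
    have le: "ln (max (Y x) a / a) \<le> g x" if x: "x \<in> space M" for x
    proof -
      define m where "m = max (Y x) a"
      have m: "0 < m" using a0 by (simp add: m_def)
      have "ln m = 2 * ln (sqrt m)" using m by (simp add: ln_sqrt)
      also have "\<dots> \<le> 2 * (sqrt m - 1)" using ln_le_minus_one[of "sqrt m"] m by simp
      also have "sqrt m \<le> sqrt (Y x) + sqrt a" using Y0[OF x] a0 by (auto simp: m_def max_def)
      finally show ?thesis using m a0 by (simp add: g_def m_def[symmetric] ln_div)
    qed
    have g0: "0 \<le> g x" if "x \<in> space M" for x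
      using le[OF that] a0 by (intro order_trans[OF _ le[OF that]]) (simp add: ln_div max_def)
    have "(\<integral>\<^sup>+x. u x \<partial>P0) \<le> (\<integral>\<^sup>+x. ennreal (g x) \<partial>P0)"
      by (rule nn_integral_mono) (auto simp: u_def intro!: ennreal_leI le)
    also have "\<dots> = ennreal (\<integral>x. g x \<partial>P0)"
      by (rule nn_integral_eq_integral[OF gi]) (use g0 in auto)
    also have "(\<integral>x. g x \<partial>P0) = 2 * (A + sqrt a - 1) + - ln a"
      using si by (simp add: g_def A_def P0.prob_space[unfolded space_model])
    also have "ennreal \<dots> < ennreal (- ln a)"
      using A1 sa a1 a0 by (intro ennreal_lessI) auto
    finally show "(\<integral>\<^sup>+x. u x \<partial>P0) < ennreal (- ln a)" .
  qed auto
  then obtain k where "(\<integral>\<^sup>+x. sup_excess a (B k) x \<partial>P0) < ennreal (- ln a)" ..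
  then show ?thesis
    using a0 a1 \<rho> unfolding B_def by (intro exI[of _ a] exI[of _ "\<rho> / real (Suc k)"]) auto
qed

text \<open>For a fixed observation the density vanishes at infinity, so beyond some radius every
  ratio is below \<open>a\<close> and the truncated excess is exactly 0; the limit function is
  0.\<close>

lemma sup_excess_tail:
  "\<exists>a R. 0 < a \<and> a < 1 \<and> 0 < R \<and>
    (\<integral>\<^sup>+x. sup_excess a {\<theta>\<in>\<Omega>. \<bar>\<theta>\<bar> > R} x \<partial>P0) < ennreal (- ln a)"
proof -
  \<comment> \<open>Any level strictly between 0 and 1 serves here; this one makes - ln a =
    1.\<close>
  define a :: real where "a = exp (- 1)"
  have a: "0 < a" "a < 1" "ln a = - 1" by (simp_all add: a_def)
  obtain R where R: "0 < R"
    and fin: "(\<integral>\<^sup>+x. (SUP \<theta>\<in>{\<theta>\<in>\<Omega>. \<bar>\<theta>\<bar> > R}. ennreal (max 0 (ln (p x \<theta>)))) \<partial>P0) < \<infinity>"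
    using log_sup_tail by blast
  define B where "B k = {\<theta>\<in>\<Omega>. \<bar>\<theta>\<bar> > R + real k}" for k
  have "\<exists>k. (\<integral>\<^sup>+x. sup_excess a (B k) x \<partial>P0) < ennreal (- ln a)"
  proof (rule sup_excess_limit[OF _ _ a(1,2) fin])
    fix x assume x: "x \<in> space M" "0 < p x \<theta>0"
    have "\<forall>\<^sub>F \<theta> in inf at_infinity (principal \<Omega>). p x \<theta> < a * p x \<theta>0"
      by (rule order_tendstoD(2)[OF dens_vanishes[OF x(1)]]) (use x a in simp)
    then obtain b where b: "\<And>\<theta>. b \<le> \<bar>\<theta>\<bar> \<Longrightarrow> \<theta> \<in> \<Omega> \<Longrightarrow> p x \<theta> < a * p x \<theta>0"
      unfolding eventually_inf_principal eventually_at_infinity by auto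
    obtain N :: nat where N: "b \<le> real N" using real_arch_simple by blast
    have "sup_excess a (B k) x = 0" if k: "N \<le> k" for k
    proof -
      have "ennreal (ln (max (p x \<theta> / p x \<theta>0) a / a)) \<le> 0" if "\<theta> \<in> B k" for \<theta>
      proof -
        have "p x \<theta> < a * p x \<theta>0" by (rule b) (use that k N R in \<open>auto simp: B_def\<close>)
        then have "p x \<theta> / p x \<theta>0 < a" using x by (simp add: pos_divide_less_eq)
        then show ?thesis using a by (simp add: max_def)
      qed
      then have "sup_excess a (B k) x \<le> 0" unfolding sup_excess_def by (rule SUP_least)
      then show ?thesis by simp
    qed
    then show "(\<lambda>k. sup_excess a (B k) x) \<longlonglongrightarrow> (\<lambda>_. 0) x"
      by (intro tendsto_eventually eventually_sequentiallyI[of N]) simp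
  qed (use a in \<open>auto simp: B_def\<close>)
  then obtain k where "(\<integral>\<^sup>+x. sup_excess a (B k) x \<partial>P0) < ennreal (- ln a)" ..
  then show ?thesis
    using a R unfolding B_def by (intro exI[of _ a] exI[of _ "R + real k"]) auto
qed

section \<open>From local decay to uniform separation\<close>

text \<open>Comparing with the likelihood at the fixed point \<open>\<theta>0\<close> makes the
  property stable under finite unions, with the minimum of the rates.\<close>

definition decays :: "real set \<Rightarrow> bool" where
  "decays B \<longleftrightarrow> (\<exists>\<eta>>0. \<forall>\<^sub>F (n, x) in whp Pn. \<forall>\<theta>\<in>B. likelihood p n x \<theta> \<le> exp (- \<eta> * real n) * likelihood p n x \<theta>0)"

lemma whp_space: "\<forall>\<^sub>F (n, x) in whp Pn. \<forall>i<n. x i \<in> space M"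
  by (rule whp_AE) (use AE_space[of P0] in simp)

lemma decays_Un:
  assumes "decays A" "decays B"
  shows "decays (A \<union> B)"
proof -
  obtain \<eta>1 \<eta>2 where \<eta>: "0 < \<eta>1" "0 < \<eta>2"
    and ev: "\<forall>\<^sub>F (n, x) in whp Pn. \<forall>\<theta>\<in>A. likelihood p n x \<theta> \<le> exp (- \<eta>1 * real n) * likelihood p n x \<theta>0"
      "\<forall>\<^sub>F (n, x) in whp Pn. \<forall>\<theta>\<in>B. likelihood p n x \<theta> \<le> exp (- \<eta>2 * real n) * likelihood p n x \<theta>0"
    using assms unfolding decays_def by blast
  have "\<forall>\<^sub>F (n, x) in whp Pn. \<forall>\<theta>\<in>A \<union> B. likelihood p n x \<theta> \<le> exp (- min \<eta>1 \<eta>2 * real n) * likelihood p n x \<theta>0"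
    using ev whp_space
  proof eventually_elim
    case (elim z)
    obtain n x where z: "z = (n, x)" by force
    have l0: "0 \<le> likelihood p n x \<theta>0"
      using likelihood_nonneg[of n x \<theta>0] elim true_param z by auto
    have "exp (- \<eta>1 * real n) * likelihood p n x \<theta>0 \<le> exp (- min \<eta>1 \<eta>2 * real n) * likelihood p n x \<theta>0"
      "exp (- \<eta>2 * real n) * likelihood p n x \<theta>0 \<le> exp (- min \<eta>1 \<eta>2 * real n) * likelihood p n x \<theta>0"
      using l0 by (auto intro!: mult_right_mono)
    then show ?case using elim z by (auto intro: order_trans)
  qed
  then show ?thesis unfolding decays_def using \<eta> by (intro exI[of _ "min \<eta>1 \<eta>2"]) auto
qed

lemma decays_UN: "finite I \<Longrightarrow> (\<And>i. i \<in> I \<Longrightarrow> decays (A i)) \<Longrightarrow> decays (\<Union>i\<in>I. A i)"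
proof (induction I rule: finite_induct)
  case empty
  have "decays {}" unfolding decays_def by (auto intro!: exI[of _ 1] simp: case_prod_unfold)
  then show ?case by simp
next
  case (insert i I)
  then show ?case using decays_Un[of "A i" "\<Union>i\<in>I. A i"] by auto
qed

lemma decays_subset: "decays B \<Longrightarrow> A \<subseteq> B \<Longrightarrow> decays A"
  unfolding decays_def by (elim exE conjE, intro exI conjI, assumption, erule eventually_mono) auto

text \<open>The tail set disposes of large \<theta>; the rest is compact because
  \<open>\<Omega>\<close> is closed. Only finitely many neighbourhoods are needed, so both the rates
  and the failure probabilities can be combined.\<close>

theorem wald_separation:
  assumes \<delta>: "0 < \<delta>"
  shows "decays {\<theta>\<in>\<Omega>. \<delta> \<le> \<bar>\<theta> - \<theta>0\<bar>}"
proof -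
  obtain R where R: "decays {\<theta>\<in>\<Omega>. \<bar>\<theta>\<bar> > R}"
  proof -
    obtain a R where "0 < a" "a < 1"
      "(\<integral>\<^sup>+x. sup_excess a {\<theta>\<in>\<Omega>. \<bar>\<theta>\<bar> > R} x \<partial>P0) < ennreal (- ln a)"
      using sup_excess_tail by blast
    then show ?thesis
      using likelihood_decay_if_sup_excess[of "{\<theta>\<in>\<Omega>. \<bar>\<theta>\<bar> > R}" a]
      by (intro that[of R]) (auto simp: decays_def)
  qed
  define K where "K = \<Omega> \<inter> {\<theta>. \<delta> \<le> \<bar>\<theta> - \<theta>0\<bar>} \<inter> {\<theta>. \<bar>\<theta>\<bar> \<le> R}"
  have "closed {\<theta>. \<delta> \<le> \<bar>\<theta> - \<theta>0\<bar>}" by (intro closed_Collect_le continuous_intros)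
  moreover have "compact {\<theta>. \<bar>\<theta>\<bar> \<le> R}"
  proof -
    have "{\<theta>. \<bar>\<theta>\<bar> \<le> R} = {-R..R}" by auto
    then show ?thesis by simp
  qed
  ultimately have K: "compact K"
    unfolding K_def using closed_param by (intro closed_Int_compact closed_Int)
  have "\<exists>\<rho>>0. decays {\<theta>\<in>\<Omega>. \<bar>\<theta> - \<theta>'\<bar> < \<rho>}" if "\<theta>' \<in> K" for \<theta>'
  proof -
    have "\<theta>' \<in> \<Omega>" "\<theta>' \<noteq> \<theta>0" using that \<delta> by (auto simp: K_def)
    from sup_excess_local[OF this] obtain a \<rho> where "0 < a" "a < 1" "0 < \<rho>"
      "(\<integral>\<^sup>+x. sup_excess a {\<theta>\<in>\<Omega>. \<bar>\<theta> - \<theta>'\<bar> < \<rho>} x \<partial>P0) < ennreal (- ln a)" by blast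
    then show ?thesis
      using likelihood_decay_if_sup_excess[of "{\<theta>\<in>\<Omega>. \<bar>\<theta> - \<theta>'\<bar> < \<rho>}" a]
      unfolding decays_def by auto
  qed
  then obtain \<rho> where \<rho>: "\<And>\<theta>'. \<theta>' \<in> K \<Longrightarrow> 0 < \<rho> \<theta>'" "\<And>\<theta>'. \<theta>' \<in> K \<Longrightarrow> decays {\<theta>\<in>\<Omega>. \<bar>\<theta> - \<theta>'\<bar> < \<rho> \<theta>'}"
    by metis
  have "K \<subseteq> (\<Union>\<theta>'\<in>K. ball \<theta>' (\<rho> \<theta>'))" using \<rho>(1) by auto
  then obtain F where F: "F \<subseteq> K" "finite F" "K \<subseteq> (\<Union>\<theta>'\<in>F. ball \<theta>' (\<rho> \<theta>'))"
    by (rule compactE_image[OF K, rotated]) auto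
  have "decays (\<Union>\<theta>'\<in>F. {\<theta>\<in>\<Omega>. \<bar>\<theta> - \<theta>'\<bar> < \<rho> \<theta>'})"
    by (rule decays_UN[OF F(2)]) (use F(1) \<rho>(2) in auto)
  from decays_Un[OF this R] show ?thesis
  proof (rule decays_subset)
    show "{\<theta>\<in>\<Omega>. \<delta> \<le> \<bar>\<theta> - \<theta>0\<bar>} \<subseteq> (\<Union>\<theta>'\<in>F. {\<theta>\<in>\<Omega>. \<bar>\<theta> - \<theta>'\<bar> < \<rho> \<theta>'}) \<union> {\<theta>\<in>\<Omega>. \<bar>\<theta>\<bar> > R}"
    proof
      fix \<theta> assume \<theta>: "\<theta> \<in> {\<theta>\<in>\<Omega>. \<delta> \<le> \<bar>\<theta> - \<theta>0\<bar>}"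
      show "\<theta> \<in> (\<Union>\<theta>'\<in>F. {\<theta>\<in>\<Omega>. \<bar>\<theta> - \<theta>'\<bar> < \<rho> \<theta>'}) \<union> {\<theta>\<in>\<Omega>. \<bar>\<theta>\<bar> > R}"
      proof (cases "\<bar>\<theta>\<bar> \<le> R")
        case True
        then have "\<theta> \<in> K" using \<theta> by (simp add: K_def)
        then obtain \<theta>' where "\<theta>' \<in> F" "\<bar>\<theta> - \<theta>'\<bar> < \<rho> \<theta>'"
          using F(3) by (force simp: dist_real_def)
        then show ?thesis using \<theta> by auto
      next
        case False
        then show ?thesis using \<theta> by auto
      qed
    qed
  qed
qed

end

section \<open>Quadratic approximation of the log-likelihood\<close>


text \<open>At the interior maximiser \<open>T\<close> the first derivative vanishes, so the
  Lagrange form of the second-order expansion consists of the curvature term alone.\<close>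

lemma taylor_bounds_at_max:
  fixes L L1 L2 :: "real \<Rightarrow> real"
  assumes D1: "\<And>t. \<bar>t - c\<bar> < d \<Longrightarrow> (L has_real_derivative L1 t) (at t)"
    and D2: "\<And>t. \<bar>t - c\<bar> < d \<Longrightarrow> (L1 has_real_derivative L2 t) (at t)"
    and T: "\<bar>T - c\<bar> < d" and max: "\<And>t. \<bar>t - c\<bar> < d \<Longrightarrow> L t \<le> L T"
    and lo: "\<And>t. \<bar>t - c\<bar> < d \<Longrightarrow> lo \<le> - L2 t" and hi: "\<And>t. \<bar>t - c\<bar> < d \<Longrightarrow> - L2 t \<le> hi"
    and \<theta>: "\<bar>\<theta> - c\<bar> < d"
  shows "- hi * ((\<theta> - T)\<^sup>2 / 2) \<le> L \<theta> - L T" "L \<theta> - L T \<le> - lo * ((\<theta> - T)\<^sup>2 / 2)"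
proof -
  \<comment> \<open>The maximality is known on the ball about c, hence on the ball of radius d - |T
    - c| about \<open>T\<close>.\<close>
  have "L1 T = 0"
    by (rule DERIV_local_max[OF D1[OF T], of "d - \<bar>T - c\<bar>"]) (use T in \<open>auto intro!: max\<close>)
  have "\<exists>t. \<bar>t - c\<bar> < d \<and> L \<theta> - L T = L2 t * ((\<theta> - T)\<^sup>2 / 2)"
  proof (cases "\<theta> = T")
    case True
    then show ?thesis using T by auto
  next
    case False
    define a where "a = min \<theta> T"
    define b where "b = max \<theta> T"
    have in_ab: "\<bar>t - c\<bar> < d" if "a \<le> t" "t \<le> b" for t
      using that \<theta> T by (auto simp: a_def b_def min_def max_def abs_less_iff split: if_splits)
    \<comment> \<open>Derivative family for Taylor's theorem; at order 2 the derivative condition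
      refers only to indices 0 and 1 and their successors.\<close>
    define diff where "diff m = (if m = 0 then L else if m = 1 then L1 else L2)" for m :: nat
    have "\<exists>t. (if \<theta> < T then \<theta> < t \<and> t < T else T < t \<and> t < \<theta>) \<and>
        L \<theta> = (\<Sum>m<2. diff m T / fact m * (\<theta> - T) ^ m) + diff 2 t / fact 2 * (\<theta> - T) ^ 2"
    proof (rule Taylor[where a = a and b = b])
      show "\<forall>m t. m < 2 \<and> a \<le> t \<and> t \<le> b \<longrightarrow> (diff m has_real_derivative diff (Suc m) t) (at t)"
        using D1 D2 in_ab by (auto simp: diff_def less_2_cases_iff)
    qed (use False in \<open>auto simp: diff_def a_def b_def\<close>)
    then obtain t where t: "if \<theta> < T then \<theta> < t \<and> t < T else T < t \<and> t < \<theta>"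
      and eq: "L \<theta> = (\<Sum>m<2. diff m T / fact m * (\<theta> - T) ^ m) + diff 2 t / fact 2 * (\<theta> - T) ^ 2"
      by blast
    have "\<bar>t - c\<bar> < d" by (rule in_ab) (use t in \<open>auto simp: a_def b_def split: if_splits\<close>)
    moreover have "L \<theta> - L T = L2 t * ((\<theta> - T)\<^sup>2 / 2)"
      using eq \<open>L1 T = 0\<close> by (simp add: diff_def numeral_2_eq_2)
    ultimately show ?thesis by blast
  qed
  then obtain t where t: "\<bar>t - c\<bar> < d" and eq: "L \<theta> - L T = L2 t * ((\<theta> - T)\<^sup>2 / 2)" by blast
  have "lo * ((\<theta> - T)\<^sup>2 / 2) \<le> - L2 t * ((\<theta> - T)\<^sup>2 / 2)" "- L2 t * ((\<theta> - T)\<^sup>2 / 2) \<le> hi * ((\<theta> - T)\<^sup>2 / 2)"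
    by (intro mult_right_mono lo hi t; simp)+
  then show "- hi * ((\<theta> - T)\<^sup>2 / 2) \<le> L \<theta> - L T" "L \<theta> - L T \<le> - lo * ((\<theta> - T)\<^sup>2 / 2)"
    unfolding eq by linarith+
qed

context regular_bayes_model
begin

text \<open>Extracts what the quadratic approximation uses: genuine derivatives on a ball about
  \<open>\<theta>0\<close> and an integrable bound for the third one.\<close>

lemma smooth_model:
  assumes "loglik_smooth M p \<Omega> \<theta>0 m" "3 \<le> m"
  shows "\<exists>d G. 0 < d \<and> (\<forall>t. \<bar>t - \<theta>0\<bar> < d \<longrightarrow> t \<in> \<Omega>) \<and> integrable P0 G \<and>
    (AE x in P0. \<forall>t. \<bar>t - \<theta>0\<bar> < d \<longrightarrow> 0 < p x t \<and> \<bar>loglik_deriv p 3 x t\<bar> \<le> G x \<and>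
      (\<forall>k<3. (loglik_deriv p k x has_real_derivative loglik_deriv p (Suc k) x t) (at t)))"
proof -
  obtain U G where U: "open U" "\<theta>0 \<in> U" "U \<subseteq> \<Omega>" and G: "integrable P0 G"
    and ae: "AE x in P0. (\<forall>\<theta>\<in>U. p x \<theta> > 0) \<and> Ck_on m (\<lambda>\<theta>. ln (p x \<theta>)) U \<and>
           (\<forall>k\<in>{1..m}. \<forall>\<theta>\<in>U. \<bar>loglik_deriv p k x \<theta>\<bar> \<le> G x)"
    using assms(1) unfolding loglik_smooth_def by blast
  obtain d where d: "0 < d" "ball \<theta>0 d \<subseteq> U" using U by (auto simp: open_contains_ball)
  have inU: "t \<in> U" if "\<bar>t - \<theta>0\<bar> < d" for t
    using d(2) that by (auto simp: dist_real_def abs_minus_commute)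
  show ?thesis
  proof (intro exI conjI)
    show "0 < d" "\<forall>t. \<bar>t - \<theta>0\<bar> < d \<longrightarrow> t \<in> \<Omega>" "integrable P0 G"
      using d(1) inU U G by auto
    show "AE x in P0. \<forall>t. \<bar>t - \<theta>0\<bar> < d \<longrightarrow> 0 < p x t \<and> \<bar>loglik_deriv p 3 x t\<bar> \<le> G x \<and>
      (\<forall>k<3. (loglik_deriv p k x has_real_derivative loglik_deriv p (Suc k) x t) (at t))"
      using ae
    proof eventually_elim
      case (elim x)
      have "(loglik_deriv p k x has_real_derivative loglik_deriv p (Suc k) x t) (at t)"
        if "k < 3" "\<bar>t - \<theta>0\<bar> < d" for k t
      proof -
        have "(deriv ^^ k) (\<lambda>\<theta>. ln (p x \<theta>)) field_differentiable at t"
          using elim that inU assms(2) by (auto simp: Ck_on_def)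
        then show ?thesis
          by (simp add: loglik_deriv_def[abs_def] DERIV_deriv_iff_field_differentiable)
      qed
      then show ?case using elim inU assms(2) by auto
    qed
  qed
qed

text \<open>The third derivative bound makes the summed second derivative Lipschitz with constant
  the sum of G (x i). Two instances of the law of large numbers, for \<open>G\<close> and for the
  second derivative at \<open>\<theta>0\<close>, thus give a bound for all t in a fixed ball on one
  event.\<close>

lemma curvature:
  assumes sm: "loglik_smooth M p \<Omega> \<theta>0 m" "3 \<le> m" and e: "0 < e"
  shows "\<exists>d>0. (\<forall>t. \<bar>t - \<theta>0\<bar> < d \<longrightarrow> t \<in> \<Omega>) \<and>
    (\<forall>\<^sub>F (n, x) in whp Pn. \<forall>t. \<bar>t - \<theta>0\<bar> < d \<longrightarrow>
       (\<forall>i<n. 0 < p (x i) t \<and> (\<forall>k<2. (loglik_deriv p k (x i) has_real_derivative loglik_deriv p (Suc k) (x i) t) (at t))) \<and>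
       \<bar>(\<Sum>i<n. loglik_deriv p 2 (x i) t) + real n * fisher M p \<theta>0\<bar> \<le> e * real n)"
proof -
  obtain d0 G where d0: "0 < d0" "\<And>t. \<bar>t - \<theta>0\<bar> < d0 \<Longrightarrow> t \<in> \<Omega>" and G: "integrable P0 G"
    and ae: "AE x in P0. \<forall>t. \<bar>t - \<theta>0\<bar> < d0 \<longrightarrow> 0 < p x t \<and> \<bar>loglik_deriv p 3 x t\<bar> \<le> G x \<and>
      (\<forall>k<3. (loglik_deriv p k x has_real_derivative loglik_deriv p (Suc k) x t) (at t))"
    using smooth_model[OF sm] by blast
  \<comment> \<open>A number exceeding the mean of \<open>G\<close>, hence a likely bound for its
    average; radius e / (2 * g) then limits the variation of the average curvature to e / 2.\<close>
  define g where "g = \<bar>\<integral>x. G x \<partial>P0\<bar> + 1"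
  have g: "0 < g" by (simp add: g_def)
  define d where "d = min d0 (e / (2 * g))"
  have d: "0 < d" using d0 g e by (simp add: d_def)
  have evG: "\<forall>\<^sub>F z in whp Pn. (case z of (n, x) \<Rightarrow> (\<Sum>i<n. G (x i)) / real n) < g"
    by (rule order_tendstoD(2)[OF lln[OF G]]) (auto simp: g_def)
  have evI: "\<forall>\<^sub>F z in whp Pn. dist (case z of (n, x) \<Rightarrow> (\<Sum>i<n. loglik_deriv p 2 (x i) \<theta>0) / real n) (- fisher M p \<theta>0) < e / 2"
    using tendstoD[OF lln[OF fisher_finite], of "e / 2"] e by (simp add: fisher_def)
  have evn: "\<forall>\<^sub>F (n, x) in whp Pn. (0::nat) < n"
    by (rule eventually_whp_index) (rule eventually_gt_at_top)
  have "\<forall>\<^sub>F (n, x) in whp Pn. \<forall>t. \<bar>t - \<theta>0\<bar> < d \<longrightarrow>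
       (\<forall>i<n. 0 < p (x i) t \<and> (\<forall>k<2. (loglik_deriv p k (x i) has_real_derivative loglik_deriv p (Suc k) (x i) t) (at t))) \<and>
       \<bar>(\<Sum>i<n. loglik_deriv p 2 (x i) t) + real n * fisher M p \<theta>0\<bar> \<le> e * real n"
    using evG evI evn whp_AE[OF ae]
  proof eventually_elim
    case (elim z)
    obtain n x where z: "z = (n, x)" by force
    have n: "0 < real n" and Gs: "(\<Sum>i<n. G (x i)) \<le> g * real n"
      and Is: "\<bar>(\<Sum>i<n. loglik_deriv p 2 (x i) \<theta>0) / real n + fisher M p \<theta>0\<bar> < e / 2"
      using elim z by (auto simp: dist_real_def field_simps)
    have reg: "0 < p (x i) t" "\<bar>loglik_deriv p 3 (x i) t\<bar> \<le> G (x i)"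
        "k < 3 \<Longrightarrow> (loglik_deriv p k (x i) has_real_derivative loglik_deriv p (Suc k) (x i) t) (at t)"
      if "i < n" "\<bar>t - \<theta>0\<bar> < d0" for i t k
      using elim(4) that unfolding z by auto
    have "\<bar>(\<Sum>i<n. loglik_deriv p 2 (x i) t) + real n * fisher M p \<theta>0\<bar> \<le> e * real n" if t: "\<bar>t - \<theta>0\<bar> < d" for t
    proof -
      have t0: "\<bar>t - \<theta>0\<bar> < d0" using t by (simp add: d_def)
      have "\<bar>loglik_deriv p 2 (x i) t - loglik_deriv p 2 (x i) \<theta>0\<bar> \<le> G (x i) * \<bar>t - \<theta>0\<bar>" if i: "i < n" for i
      proof -
        have "norm (loglik_deriv p 2 (x i) t - loglik_deriv p 2 (x i) \<theta>0) \<le> G (x i) * norm (t - \<theta>0)"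
        proof (rule field_differentiable_bound[where S = "ball \<theta>0 d0" and f' = "loglik_deriv p 3 (x i)"])
          fix y assume "y \<in> ball \<theta>0 d0"
          then have y: "\<bar>y - \<theta>0\<bar> < d0" by (simp add: dist_real_def abs_minus_commute)
          show "(loglik_deriv p 2 (x i) has_real_derivative loglik_deriv p 3 (x i) y) (at y within ball \<theta>0 d0)"
          proof (rule has_field_derivative_at_within)
            have "Suc 2 = 3" "(2::nat) < 3" by simp_all
            with reg(3)[OF i y, of 2]
            show "(loglik_deriv p 2 (x i) has_real_derivative loglik_deriv p 3 (x i) y) (at y)" by metis
          qed
          show "norm (loglik_deriv p 3 (x i) y) \<le> G (x i)" using reg(2)[OF i y] by simp
        qed (use t0 d0 in \<open>auto simp: dist_real_def abs_minus_commute\<close>)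
        then show ?thesis by simp
      qed
      then have "(\<Sum>i<n. \<bar>loglik_deriv p 2 (x i) t - loglik_deriv p 2 (x i) \<theta>0\<bar>) \<le> (\<Sum>i<n. G (x i) * \<bar>t - \<theta>0\<bar>)"
        by (intro sum_mono) auto
      also have "\<dots> = (\<Sum>i<n. G (x i)) * \<bar>t - \<theta>0\<bar>" by (simp add: sum_distrib_right)
      also have "\<dots> \<le> (g * real n) * (e / (2 * g))"
        using Gs t n g by (intro mult_mono) (auto simp: d_def)
      also have "\<dots> = e / 2 * real n" using g by simp
      finally have 1: "\<bar>\<Sum>i<n. loglik_deriv p 2 (x i) t - loglik_deriv p 2 (x i) \<theta>0\<bar> \<le> e / 2 * real n"
        by (rule order_trans[OF sum_abs])
      have "\<bar>(\<Sum>i<n. loglik_deriv p 2 (x i) \<theta>0) / real n + fisher M p \<theta>0\<bar> * real n \<le> e / 2 * real n"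
        using Is n by (intro mult_right_mono) auto
      moreover have "\<bar>(\<Sum>i<n. loglik_deriv p 2 (x i) \<theta>0) / real n + fisher M p \<theta>0\<bar> * real n =
          \<bar>((\<Sum>i<n. loglik_deriv p 2 (x i) \<theta>0) / real n + fisher M p \<theta>0) * real n\<bar>"
        using n by (simp add: abs_mult)
      moreover have "((\<Sum>i<n. loglik_deriv p 2 (x i) \<theta>0) / real n + fisher M p \<theta>0) * real n =
          (\<Sum>i<n. loglik_deriv p 2 (x i) \<theta>0) + real n * fisher M p \<theta>0"
        using n by (simp add: field_simps)
      ultimately have 2: "\<bar>(\<Sum>i<n. loglik_deriv p 2 (x i) \<theta>0) + real n * fisher M p \<theta>0\<bar> \<le> e / 2 * real n"
        by simp
      have "(\<Sum>i<n. loglik_deriv p 2 (x i) t) = (\<Sum>i<n. loglik_deriv p 2 (x i) t - loglik_deriv p 2 (x i) \<theta>0) + (\<Sum>i<n. loglik_deriv p 2 (x i) \<theta>0)"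
        by (simp add: sum_subtractf)
      then show ?thesis using 1 2 by linarith
    qed
    then show ?case unfolding z using reg(1,3) by (auto simp: d_def)
  qed
  then show ?thesis using d d0 by (intro exI[of _ d]) (auto simp: d_def)
qed

section \<open>The likelihood ratio relative to the MLE\<close>

text \<open>Positivity at \<open>\<theta>0\<close> is recorded because it makes the maximal
  likelihood positive, so that dividing by it is meaningful.\<close>

definition mle_regular :: "(nat \<Rightarrow> (nat \<Rightarrow> 'a) \<Rightarrow> real) \<Rightarrow> nat \<Rightarrow> (nat \<Rightarrow> 'a) \<Rightarrow> bool" where
  "mle_regular T n x \<longleftrightarrow> 0 < n \<and> (\<forall>i<n. x i \<in> space M) \<and> T n x \<in> \<Omega> \<and>
     0 < likelihood p n x \<theta>0 \<and> (\<forall>t\<in>\<Omega>. likelihood p n x t \<le> likelihood p n x (T n x))"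

lemma whp_mle_regular:
  assumes "is_mle M p \<Omega> \<theta>0 T"
  shows "\<forall>\<^sub>F (n, x) in whp Pn. mle_regular T n x"
proof -
  have "\<forall>\<^sub>F (n, x) in whp Pn. T n x \<in> \<Omega> \<and> (\<forall>t\<in>\<Omega>. likelihood p n x t \<le> likelihood p n x (T n x))"
    by (rule eventually_whp_AE) (use assms in \<open>auto simp: is_mle_def\<close>)
  moreover have "\<forall>\<^sub>F (n, x) in whp Pn. \<forall>i<n. 0 < p (x i) \<theta>0" by (rule whp_AE[OF AE_true_dens_pos])
  moreover have "\<forall>\<^sub>F (n, x) in whp Pn. (0::nat) < n"
    by (rule eventually_whp_index) (rule eventually_gt_at_top)
  ultimately show ?thesis using whp_space
    by eventually_elim (auto simp: mle_regular_def likelihood_def intro!: prod_pos)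
qed

text \<open>A maximiser at distance d or more from \<open>\<theta>0\<close> would have a likelihood
  smaller than that of \<open>\<theta>0\<close> by the factor exp (- \<eta> n) < 1.\<close>

lemma mle_consistent:
  assumes "is_mle M p \<Omega> \<theta>0 T" and d: "0 < d"
  shows "\<forall>\<^sub>F (n, x) in whp Pn. \<bar>T n x - \<theta>0\<bar> < d"
proof -
  obtain \<eta> where \<eta>: "0 < \<eta>" and ev: "\<forall>\<^sub>F (n, x) in whp Pn. \<forall>t\<in>{t\<in>\<Omega>. d \<le> \<bar>t - \<theta>0\<bar>}.
      likelihood p n x t \<le> exp (- \<eta> * real n) * likelihood p n x \<theta>0"
    using wald_separation[OF d] unfolding decays_def by blast
  show ?thesis
    using ev whp_mle_regular[OF assms(1)]
  proof eventually_elim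
    case (elim z)
    obtain n x where z: "z = (n, x)" by force
    have reg: "0 < n" "T n x \<in> \<Omega>" "0 < likelihood p n x \<theta>0" "likelihood p n x \<theta>0 \<le> likelihood p n x (T n x)"
      using elim(2) true_param unfolding z by (auto simp: mle_regular_def)
    have "\<bar>T n x - \<theta>0\<bar> < d"
    proof (rule ccontr)
      assume "\<not> ?thesis"
      then have "likelihood p n x (T n x) \<le> exp (- \<eta> * real n) * likelihood p n x \<theta>0"
        using elim(1) reg unfolding z by auto
      also have "\<dots> < 1 * likelihood p n x \<theta>0"
        using \<eta> reg by (intro mult_strict_right_mono) auto
      finally show False using reg by simp
    qed
    then show ?case by (simp add: z)
  qed
qed

lemma likelihood_ratio_near:
  assumes sm: "loglik_smooth M p \<Omega> \<theta>0 m" "3 \<le> m" and mle: "is_mle M p \<Omega> \<theta>0 T" and e: "0 < e"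
  shows "\<exists>d>0. \<forall>\<^sub>F (n, x) in whp Pn. \<forall>\<theta>. \<bar>\<theta> - \<theta>0\<bar> < d \<longrightarrow>
      exp (- (1 + e) * ((sqrt (real n * fisher M p \<theta>0) * (\<theta> - T n x))\<^sup>2 / 2))
        \<le> likelihood p n x \<theta> / likelihood p n x (T n x) \<and>
      likelihood p n x \<theta> / likelihood p n x (T n x)
        \<le> exp (- (1 - e) * ((sqrt (real n * fisher M p \<theta>0) * (\<theta> - T n x))\<^sup>2 / 2))"
proof -
  define I where "I = fisher M p \<theta>0"
  have I: "0 < I" using fisher_pos by (simp add: I_def)
  obtain d where d: "0 < d" "\<And>t. \<bar>t - \<theta>0\<bar> < d \<Longrightarrow> t \<in> \<Omega>"
    and ev: "\<forall>\<^sub>F (n, x) in whp Pn. \<forall>t. \<bar>t - \<theta>0\<bar> < d \<longrightarrow>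
       (\<forall>i<n. 0 < p (x i) t \<and> (\<forall>k<2. (loglik_deriv p k (x i) has_real_derivative loglik_deriv p (Suc k) (x i) t) (at t))) \<and>
       \<bar>(\<Sum>i<n. loglik_deriv p 2 (x i) t) + real n * fisher M p \<theta>0\<bar> \<le> (e * I) * real n"
    using curvature[OF sm, of "e * I"] e I by auto
  have "\<forall>\<^sub>F (n, x) in whp Pn. \<forall>\<theta>. \<bar>\<theta> - \<theta>0\<bar> < d \<longrightarrow>
      exp (- (1 + e) * ((sqrt (real n * I) * (\<theta> - T n x))\<^sup>2 / 2))
        \<le> likelihood p n x \<theta> / likelihood p n x (T n x) \<and>
      likelihood p n x \<theta> / likelihood p n x (T n x)
        \<le> exp (- (1 - e) * ((sqrt (real n * I) * (\<theta> - T n x))\<^sup>2 / 2))"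
    using ev whp_mle_regular[OF mle] mle_consistent[OF mle d(1)]
  proof eventually_elim
    case (elim z)
    obtain n x where z: "z = (n, x)" by force
    define t where "t = T n x"
    have t: "\<bar>t - \<theta>0\<bar> < d" using elim(3) by (simp add: z t_def)
    define L where "L k \<theta> = (\<Sum>i<n. loglik_deriv p k (x i) \<theta>)" for k \<theta>
    have pos: "0 < p (x i) \<theta>" if "\<bar>\<theta> - \<theta>0\<bar> < d" "i < n" for \<theta> i
      using elim(1) that unfolding z by auto
    have der: "(L k has_real_derivative L (Suc k) \<theta>) (at \<theta>)" if "\<bar>\<theta> - \<theta>0\<bar> < d" "k < 2" for \<theta> k
      unfolding L_def[abs_def] by (rule DERIV_sum) (use elim(1) that in \<open>auto simp: z\<close>)
    have cur: "\<bar>L 2 \<theta> + real n * I\<bar> \<le> e * I * real n" if "\<bar>\<theta> - \<theta>0\<bar> < d" for \<theta>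
      using elim(1) that unfolding z L_def I_def by auto
    have lik: "likelihood p n x \<theta> = exp (L 0 \<theta>)" if "\<bar>\<theta> - \<theta>0\<bar> < d" for \<theta>
      unfolding likelihood_def L_def loglik_deriv_def
      by (simp add: exp_sum) (intro prod.cong refl, use pos[OF that] in simp)
    have max: "L 0 \<theta> \<le> L 0 t" if "\<bar>\<theta> - \<theta>0\<bar> < d" for \<theta>
    proof -
      have "likelihood p n x \<theta> \<le> likelihood p n x t"
        using elim(2) d(2)[OF that] unfolding z t_def by (auto simp: mle_regular_def)
      then show ?thesis using lik[OF that] lik[OF t] by simp
    qed
    have "exp (- (1 + e) * ((sqrt (real n * I) * (\<theta> - t))\<^sup>2 / 2)) \<le> likelihood p n x \<theta> / likelihood p n x t \<and>
      likelihood p n x \<theta> / likelihood p n x t \<le> exp (- (1 - e) * ((sqrt (real n * I) * (\<theta> - t))\<^sup>2 / 2))"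
      if \<theta>: "\<bar>\<theta> - \<theta>0\<bar> < d" for \<theta>
    proof -
      have lo: "(1 - e) * (real n * I) \<le> - L 2 y" and hi: "- L 2 y \<le> (1 + e) * (real n * I)" if "\<bar>y - \<theta>0\<bar> < d" for y
        using cur[OF that] by (auto simp: abs_le_iff algebra_simps)
      have der0: "(L 0 has_real_derivative L 1 y) (at y)" and der1: "(L 1 has_real_derivative L 2 y) (at y)"
        if "\<bar>y - \<theta>0\<bar> < d" for y
        using der[OF that, of 0] der[OF that, of 1] by (simp_all add: numeral_2_eq_2)
      note tb = taylor_bounds_at_max[where L = "L 0" and ?L1.0 = "L 1" and ?L2.0 = "L 2" and c = \<theta>0 and d = d and T = t,
        OF der0 der1 t max lo hi \<theta>]
      have "- ((1 + e) * (real n * I)) * ((\<theta> - t)\<^sup>2 / 2) \<le> L 0 \<theta> - L 0 t"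
        by (rule tb(1))
      moreover have "L 0 \<theta> - L 0 t \<le> - ((1 - e) * (real n * I)) * ((\<theta> - t)\<^sup>2 / 2)"
        by (rule tb(2))
      moreover have "- c * ((sqrt (real n * I) * (\<theta> - t))\<^sup>2 / 2) = - (c * (real n * I)) * ((\<theta> - t)\<^sup>2 / 2)" for c
        using I by (simp add: power_mult_distrib)
      moreover have "likelihood p n x \<theta> / likelihood p n x t = exp (L 0 \<theta> - L 0 t)"
        using lik[OF \<theta>] lik[OF t] by (simp add: exp_diff)
      ultimately show ?thesis by (simp only: exp_le_cancel_iff)
    qed
    then show ?case by (simp add: z t_def)
  qed
  then show ?thesis using d(1) unfolding I_def by blast
qed

text \<open>The separation bound is relative to \<open>\<theta>0\<close>; the likelihood at the MLE
  is at least as large, so the ratio can only get smaller.\<close>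

lemma likelihood_ratio_far:
  assumes mle: "is_mle M p \<Omega> \<theta>0 T" and d: "0 < d"
  shows "\<exists>\<eta>>0. \<forall>\<^sub>F (n, x) in whp Pn. \<forall>\<theta>\<in>\<Omega>. d \<le> \<bar>\<theta> - \<theta>0\<bar> \<longrightarrow>
      likelihood p n x \<theta> / likelihood p n x (T n x) \<le> exp (- \<eta> * real n)"
proof -
  obtain \<eta> where \<eta>: "0 < \<eta>" and ev: "\<forall>\<^sub>F (n, x) in whp Pn. \<forall>t\<in>{t\<in>\<Omega>. d \<le> \<bar>t - \<theta>0\<bar>}.
      likelihood p n x t \<le> exp (- \<eta> * real n) * likelihood p n x \<theta>0"
    using wald_separation[OF d] unfolding decays_def by blast
  have "\<forall>\<^sub>F (n, x) in whp Pn. \<forall>\<theta>\<in>\<Omega>. d \<le> \<bar>\<theta> - \<theta>0\<bar> \<longrightarrow>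
      likelihood p n x \<theta> / likelihood p n x (T n x) \<le> exp (- \<eta> * real n)"
    using ev whp_mle_regular[OF mle]
  proof eventually_elim
    case (elim z)
    obtain n x where z: "z = (n, x)" by force
    have reg: "0 < likelihood p n x \<theta>0" "likelihood p n x \<theta>0 \<le> likelihood p n x (T n x)"
      using elim(2) true_param unfolding z by (auto simp: mle_regular_def)
    have "likelihood p n x \<theta> / likelihood p n x (T n x) \<le> exp (- \<eta> * real n)"
      if "\<theta> \<in> \<Omega>" "d \<le> \<bar>\<theta> - \<theta>0\<bar>" for \<theta>
    proof -
      have "likelihood p n x \<theta> \<le> exp (- \<eta> * real n) * likelihood p n x \<theta>0"
        using elim(1) that unfolding z by auto
      also have "\<dots> \<le> exp (- \<eta> * real n) * likelihood p n x (T n x)"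
        using reg by (intro mult_left_mono) auto
      finally show ?thesis using reg by (simp add: pos_divide_le_eq)
    qed
    then show ?case by (simp add: z)
  qed
  then show ?thesis using \<eta> by blast
qed

end

section \<open>Posterior moments\<close>


lemma integrable_abs_power_le:
  fixes w :: "real \<Rightarrow> real"
  assumes w: "integrable lborel w" "\<And>\<theta>. 0 \<le> w \<theta>" and r: "integrable lborel (\<lambda>\<theta>. \<bar>\<theta>\<bar> ^ r * w \<theta>)" and i: "i \<le> r"
  shows "integrable lborel (\<lambda>\<theta>. \<bar>\<theta>\<bar> ^ i * w \<theta>)"
proof (rule Bochner_Integration.integrable_bound)
  show "integrable lborel (\<lambda>\<theta>. w \<theta> + \<bar>\<theta>\<bar> ^ r * w \<theta>)" using w r by auto
  note [measurable] = borel_measurable_integrable[OF w(1)]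
  show "(\<lambda>\<theta>. \<bar>\<theta>\<bar> ^ i * w \<theta>) \<in> borel_measurable lborel" by measurable
  have "\<bar>\<theta>\<bar> ^ i \<le> 1 + \<bar>\<theta>\<bar> ^ r" for \<theta> :: real
  proof (cases "\<bar>\<theta>\<bar> \<le> 1")
    case True
    then have "\<bar>\<theta>\<bar> ^ i \<le> 1" by (intro power_le_one) auto
    then show ?thesis by (simp add: add_increasing2)
  next
    case False
    then have "\<bar>\<theta>\<bar> ^ i \<le> \<bar>\<theta>\<bar> ^ r" by (intro power_increasing i) auto
    then show ?thesis by simp
  qed
  then have "\<bar>\<theta>\<bar> ^ i * w \<theta> \<le> (1 + \<bar>\<theta>\<bar> ^ r) * w \<theta>" for \<theta>
    by (intro mult_right_mono w)
  then show "AE \<theta> in lborel. norm (\<bar>\<theta>\<bar> ^ i * w \<theta>) \<le> norm (w \<theta> + \<bar>\<theta>\<bar> ^ r * w \<theta>)"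
    using w(2) by (intro AE_I2) (simp add: abs_mult algebra_simps)
qed

context regular_bayes_model
begin

lemma prior_integrable: "integrable lborel w"
proof (rule integrableI_nonneg)
  show "w \<in> borel_measurable lborel" using prior_measurable by simp
  have "emeasure (density lborel (\<lambda>\<theta>. ennreal (w \<theta>))) UNIV = 1"
    using prob_space.emeasure_space_1[OF prior_prob] by simp
  then show "(\<integral>\<^sup>+\<theta>. ennreal (w \<theta>) \<partial>lborel) < \<infinity>"
    using prior_measurable by (simp add: emeasure_density)
qed (use prior_nonneg in auto)

definition joint :: "nat \<Rightarrow> (nat \<Rightarrow> 'a) \<Rightarrow> real \<Rightarrow> real" where
  "joint n x \<theta> = w \<theta> * likelihood p n x \<theta>"

definition evidence :: "nat \<Rightarrow> (nat \<Rightarrow> 'a) \<Rightarrow> real" where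
  "evidence n x = (\<integral>\<theta>. joint n x \<theta> \<partial>lborel)"

definition post_moment :: "nat \<Rightarrow> (nat \<Rightarrow> 'a) \<Rightarrow> real \<Rightarrow> nat \<Rightarrow> real" where
  "post_moment n x c i = (\<integral>\<theta>. (\<theta> - c) ^ i \<partial>posterior p w n x)"

lemma space_sampleD: "x \<in> space (Pn n) \<Longrightarrow> \<forall>i<n. x i \<in> space M"
  by (auto simp: sample_def space_PiM)

text \<open>Below 1 in absolute value outside a compact set by the limit at infinity, bounded on it
  by continuity. For every data string the likelihood is thus bounded on \<open>\<Omega>\<close>,
  and finite prior moments give integrable posterior moments.\<close>

lemma density_bounded:
  assumes x: "x \<in> space M"
  shows "\<exists>b. \<forall>\<theta>\<in>\<Omega>. \<bar>p x \<theta>\<bar> \<le> b"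
proof -
  have "\<forall>\<^sub>F \<theta> in inf at_infinity (principal \<Omega>). dist (p x \<theta>) 0 < 1"
    by (rule tendstoD[OF dens_vanishes[OF x]]) simp
  then obtain R where R: "\<And>\<theta>. R \<le> \<bar>\<theta>\<bar> \<Longrightarrow> \<theta> \<in> \<Omega> \<Longrightarrow> \<bar>p x \<theta>\<bar> < 1"
    unfolding eventually_inf_principal eventually_at_infinity by auto
  have "compact (p x ` (\<Omega> \<inter> cball 0 R))"
    by (intro compact_continuous_image continuous_on_subset[OF dens_cont[OF x]] closed_Int_compact closed_param) auto
  then have "bounded (p x ` (\<Omega> \<inter> cball 0 R))" by (rule compact_imp_bounded)
  then obtain b where "\<forall>y\<in>p x ` (\<Omega> \<inter> cball 0 R). norm y \<le> b"
    by (auto simp: bounded_iff)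
  then have b: "\<bar>p x \<theta>\<bar> \<le> b" if "\<theta> \<in> \<Omega>" "\<bar>\<theta>\<bar> \<le> R" for \<theta>
    using that by auto
  show ?thesis
  proof (intro exI[of _ "max b 1"] ballI)
    fix \<theta> assume "\<theta> \<in> \<Omega>"
    then show "\<bar>p x \<theta>\<bar> \<le> max b 1"
      using R[of \<theta>] b[of \<theta>] by (cases "\<bar>\<theta>\<bar> \<le> R") auto
  qed
qed

lemma likelihood_bounded:
  assumes "\<forall>i<n. x i \<in> space M"
  shows "\<exists>b. \<forall>\<theta>\<in>\<Omega>. \<bar>likelihood p n x \<theta>\<bar> \<le> b"
proof -
  have "\<forall>i. \<exists>b. i < n \<longrightarrow> (\<forall>\<theta>\<in>\<Omega>. \<bar>p (x i) \<theta>\<bar> \<le> b)"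
    using density_bounded assms by blast
  then obtain b where "\<forall>i. i < n \<longrightarrow> (\<forall>\<theta>\<in>\<Omega>. \<bar>p (x i) \<theta>\<bar> \<le> b i)"
    by (rule choice[THEN exE])
  then have b: "\<And>i \<theta>. i < n \<Longrightarrow> \<theta> \<in> \<Omega> \<Longrightarrow> \<bar>p (x i) \<theta>\<bar> \<le> b i" by blast
  then have "\<bar>likelihood p n x \<theta>\<bar> \<le> (\<Prod>i<n. b i)" if "\<theta> \<in> \<Omega>" for \<theta>
    unfolding likelihood_def abs_prod using that by (intro prod_mono) auto
  then show ?thesis by blast
qed

lemma joint_nonneg: "\<forall>i<n. x i \<in> space M \<Longrightarrow> 0 \<le> joint n x \<theta>"
  unfolding joint_def using likelihood_nonneg[of n x \<theta>] prior_nonneg[of \<theta>] prior_support[of \<theta>]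
  by (cases "\<theta> \<in> \<Omega>") auto

text \<open>The likelihood is continuous on \<open>\<Omega>\<close> only and arbitrary elsewhere;
  since w vanishes off \<open>\<Omega>\<close>, it may be multiplied by the indicator of
  \<open>\<Omega>\<close>.\<close>

lemma joint_measurable_param [measurable]:
  assumes "\<forall>i<n. x i \<in> space M"
  shows "joint n x \<in> borel_measurable borel"
proof -
  have "continuous_on \<Omega> (likelihood p n x)"
    unfolding likelihood_def[abs_def] by (intro continuous_on_prod dens_cont) (use assms in auto)
  then have "(\<lambda>\<theta>. indicator \<Omega> \<theta> *\<^sub>R likelihood p n x \<theta>) \<in> borel_measurable borel"
    by (intro borel_measurable_continuous_on_indicator) (use closed_param in auto)
  then have "(\<lambda>\<theta>. w \<theta> * (indicator \<Omega> \<theta> *\<^sub>R likelihood p n x \<theta>)) \<in> borel_measurable borel"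
    using prior_measurable by measurable
  moreover have "joint n x = (\<lambda>\<theta>. w \<theta> * (indicator \<Omega> \<theta> *\<^sub>R likelihood p n x \<theta>))"
    by (rule ext) (use prior_support in \<open>auto simp: joint_def indicator_def\<close>)
  ultimately show ?thesis by simp
qed

lemma joint_moment_integrable:
  assumes x: "\<forall>i<n. x i \<in> space M" and i: "integrable lborel (\<lambda>\<theta>. \<bar>\<theta>\<bar> ^ i * w \<theta>)"
  shows "integrable lborel (\<lambda>\<theta>. (\<theta> - c) ^ i * joint n x \<theta>)"
proof -
  obtain b where b: "\<And>\<theta>. \<theta> \<in> \<Omega> \<Longrightarrow> \<bar>likelihood p n x \<theta>\<bar> \<le> b" using likelihood_bounded[OF x] by blast
  note [measurable] = joint_measurable_param[OF x]
  show ?thesis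
  proof (rule Bochner_Integration.integrable_bound)
    show "integrable lborel (\<lambda>\<theta>. (2 ^ i * b) * (\<bar>\<theta>\<bar> ^ i * w \<theta> + \<bar>c\<bar> ^ i * w \<theta>))"
      using i prior_integrable by auto
    show "(\<lambda>\<theta>. (\<theta> - c) ^ i * joint n x \<theta>) \<in> borel_measurable lborel" by measurable
    have "\<bar>(\<theta> - c) ^ i * joint n x \<theta>\<bar> \<le> (2 ^ i * b) * (\<bar>\<theta>\<bar> ^ i * w \<theta> + \<bar>c\<bar> ^ i * w \<theta>)" for \<theta>
    proof (cases "\<theta> \<in> \<Omega>")
      case True
      have "\<bar>\<theta> - c\<bar> ^ i \<le> (\<bar>\<theta>\<bar> + \<bar>c\<bar>) ^ i" by (rule power_mono) auto
      also have "\<dots> \<le> 2 ^ i * (\<bar>\<theta>\<bar> ^ i + \<bar>c\<bar> ^ i)" by (rule power_add_le_double) auto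
      finally have 1: "\<bar>\<theta> - c\<bar> ^ i \<le> 2 ^ i * (\<bar>\<theta>\<bar> ^ i + \<bar>c\<bar> ^ i)" .
      have "\<bar>joint n x \<theta>\<bar> \<le> w \<theta> * b"
        unfolding joint_def abs_mult using b[OF True] prior_nonneg by (simp add: mult_left_mono)
      then have "\<bar>\<theta> - c\<bar> ^ i * \<bar>joint n x \<theta>\<bar> \<le> 2 ^ i * (\<bar>\<theta>\<bar> ^ i + \<bar>c\<bar> ^ i) * (w \<theta> * b)"
        by (intro mult_mono 1) auto
      also have "\<dots> = (2 ^ i * b) * (\<bar>\<theta>\<bar> ^ i * w \<theta> + \<bar>c\<bar> ^ i * w \<theta>)"
        by (simp add: algebra_simps)
      finally show ?thesis by (simp add: abs_mult power_abs)
    next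
      case False
      then show ?thesis using prior_support[OF False] by (simp add: joint_def)
    qed
    then show "AE \<theta> in lborel. norm ((\<theta> - c) ^ i * joint n x \<theta>) \<le> norm ((2 ^ i * b) * (\<bar>\<theta>\<bar> ^ i * w \<theta> + \<bar>c\<bar> ^ i * w \<theta>))"
      by (intro AE_I2) (simp del: abs_mult add: order_trans[OF _ abs_ge_self])
  qed
qed

lemma evidence_nonneg: "\<forall>i<n. x i \<in> space M \<Longrightarrow> 0 \<le> evidence n x"
  unfolding evidence_def by (rule Bochner_Integration.integral_nonneg) (rule joint_nonneg)

text \<open>Covers zero evidence as well: division by 0 then makes the density, and so both sides,
  equal to 0.\<close>

lemma integral_posterior:
  fixes h :: "real \<Rightarrow> real"
  assumes x: "\<forall>i<n. x i \<in> space M" and h: "h \<in> borel_measurable borel"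
  shows "(\<integral>\<theta>. h \<theta> \<partial>posterior p w n x) = (\<integral>\<theta>. h \<theta> * joint n x \<theta> \<partial>lborel) / evidence n x"
proof -
  note [measurable] = joint_measurable_param[OF x] h
  have post: "posterior p w n x = density lborel (\<lambda>\<theta>. ennreal (joint n x \<theta> / evidence n x))"
    by (simp add: posterior_def joint_def evidence_def)
  have "(\<integral>\<theta>. h \<theta> \<partial>posterior p w n x) = (\<integral>\<theta>. (joint n x \<theta> / evidence n x) *\<^sub>R h \<theta> \<partial>lborel)"
    unfolding post
    by (rule integral_density) (use joint_nonneg[OF x] evidence_nonneg[OF x] in auto)
  also have "\<dots> = (\<integral>\<theta>. h \<theta> * joint n x \<theta> / evidence n x \<partial>lborel)"
    by (rule Bochner_Integration.integral_cong) (auto simp: mult_ac)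
  finally show ?thesis by simp
qed

lemma post_moment_eq:
  assumes "\<forall>i<n. x i \<in> space M"
  shows "post_moment n x c i = (\<integral>\<theta>. (\<theta> - c) ^ i * joint n x \<theta> \<partial>lborel) / evidence n x"
  unfolding post_moment_def by (rule integral_posterior[OF assms]) measurable

lemma post_moment_0:
  assumes "\<forall>i<n. x i \<in> space M"
  shows "post_moment n x c 0 = (if evidence n x = 0 then 0 else 1)"
  unfolding post_moment_eq[OF assms] by (simp add: evidence_def)

lemma post_central_moment_eq:
  "post_central_moment p w r n x = post_moment n x (post_mean p w n x) r"
  by (simp add: post_central_moment_def post_moment_def)

lemma post_moment_shift:
  assumes x: "\<forall>i<n. x i \<in> space M" and r: "integrable lborel (\<lambda>\<theta>. \<bar>\<theta>\<bar> ^ r * w \<theta>)"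
  shows "post_moment n x m r = (\<Sum>i\<le>r. real (r choose i) * post_moment n x c i * (c - m) ^ (r - i))"
proof -
  have int: "integrable lborel (\<lambda>\<theta>. (\<theta> - c) ^ i * joint n x \<theta>)" if "i \<le> r" for i
    by (rule joint_moment_integrable[OF x])
       (rule integrable_abs_power_le[OF prior_integrable prior_nonneg r that])
  have "(\<integral>\<theta>. (\<theta> - m) ^ r * joint n x \<theta> \<partial>lborel) =
      (\<integral>\<theta>. (\<Sum>i\<le>r. (real (r choose i) * (c - m) ^ (r - i)) * ((\<theta> - c) ^ i * joint n x \<theta>)) \<partial>lborel)"
  proof (rule Bochner_Integration.integral_cong[OF refl])
    fix \<theta> :: real
    have "(\<theta> - m) ^ r = ((\<theta> - c) + (c - m)) ^ r" by simp
    also have "\<dots> = (\<Sum>i\<le>r. real (r choose i) * (\<theta> - c) ^ i * (c - m) ^ (r - i))"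
      by (rule binomial_ring)
    finally show "(\<theta> - m) ^ r * joint n x \<theta> =
        (\<Sum>i\<le>r. (real (r choose i) * (c - m) ^ (r - i)) * ((\<theta> - c) ^ i * joint n x \<theta>))"
      by (simp add: sum_distrib_right sum_distrib_left mult_ac)
  qed
  also have "\<dots> = (\<Sum>i\<le>r. (real (r choose i) * (c - m) ^ (r - i)) * (\<integral>\<theta>. (\<theta> - c) ^ i * joint n x \<theta> \<partial>lborel))"
    by (subst Bochner_Integration.integral_sum) (use int in auto)
  finally show ?thesis
    unfolding post_moment_eq[OF x] by (simp add: sum_divide_distrib mult_ac)
qed

text \<open>The shift from c to the posterior mean is itself a moment about c, so the recentring is
  governed by the same asymptotics. Nonzero evidence ensures that the posterior has mass 1.\<close>

lemma post_mean_diff: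
  assumes x: "\<forall>i<n. x i \<in> space M" and r: "integrable lborel (\<lambda>\<theta>. \<bar>\<theta>\<bar> ^ r * w \<theta>)" "1 \<le> r"
    and Z: "evidence n x \<noteq> 0"
  shows "c - post_mean p w n x = - post_moment n x c 1"
proof -
  have 1: "integrable lborel (\<lambda>\<theta>. \<bar>\<theta>\<bar> ^ 1 * w \<theta>)"
    by (rule integrable_abs_power_le[OF prior_integrable prior_nonneg r])
  have "post_mean p w n x = post_moment n x 0 1"
    by (simp add: post_mean_def post_moment_def)
  also have "\<dots> = c * post_moment n x c 0 + post_moment n x c 1"
    using post_moment_shift[OF x 1, of 0 c] by simp
  finally show ?thesis using Z by (simp add: post_moment_0[OF x])
qed

text \<open>If the evidence is 0, division by zero turns the posterior into the null measure.\<close>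

lemma post_moment_if_evidence_0:
  assumes "\<forall>i<n. x i \<in> space M" "evidence n x = 0"
  shows "post_moment n x c i = 0"
  using assms by (simp add: post_moment_eq)

section \<open>Convergence of the rescaled moments about the MLE\<close>

text \<open>A posterior moment is a quotient of two Laplace integrals, of orders i and 0. The values
  w \<theta>0, the Gaussian constant and the likelihood at the MLE all cancel, and one factor s of
  each rescaling cancels too, leaving s^i.\<close>

lemma post_moment_tendsto:
  assumes sm: "loglik_smooth M p \<Omega> \<theta>0 m" "3 \<le> m" and mle: "is_mle M p \<Omega> \<theta>0 T"
    and wi: "integrable lborel (\<lambda>\<theta>. \<bar>\<theta>\<bar> ^ i * w \<theta>)"
  shows "((\<lambda>(n, x). sqrt (real n * fisher M p \<theta>0) ^ i * post_moment n x (T n x) i) \<longlongrightarrow> lambda_rr i) (whp Pn)"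
proof -
  define I where "I = fisher M p \<theta>0"
  have I: "0 < I" using fisher_pos by (simp add: I_def)
  define q where "q n x \<theta> = (sqrt (real n * I) * (\<theta> - T n x))\<^sup>2 / 2" for n x \<theta>
  define ratio where "ratio n x \<theta> = likelihood p n x \<theta> / likelihood p n x (T n x)" for n x \<theta>
  \<comment> \<open>A countable grid of tolerances, because the reduction to sequences admits only
    countably many events.\<close>
  define e where "e j = 1 / real (Suc j)" for j
  have e: "0 < e j" for j by (simp add: e_def)
  have e_small: "\<exists>j. e j < \<epsilon>" if "0 < \<epsilon>" for \<epsilon>
    using reals_Archimedean[OF that] by (auto simp: e_def inverse_eq_divide)
  define N where "N j d \<longleftrightarrow> 0 < d \<and> (\<forall>\<^sub>F (n, x) in whp Pn. \<forall>\<theta>. \<bar>\<theta> - \<theta>0\<bar> < d \<longrightarrow>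
      exp (- (1 + e j) * q n x \<theta>) \<le> ratio n x \<theta> \<and> ratio n x \<theta> \<le> exp (- (1 - e j) * q n x \<theta>))" for j d
  have "\<exists>d. N j d" for j
    unfolding N_def q_def ratio_def I_def by (rule likelihood_ratio_near[OF sm mle e])
  then obtain d where N: "\<And>j. N j (d j)" by metis
  have d: "\<And>j. 0 < d j" and near: "\<And>j. \<forall>\<^sub>F (n, x) in whp Pn. \<forall>\<theta>. \<bar>\<theta> - \<theta>0\<bar> < d j \<longrightarrow>
      exp (- (1 + e j) * q n x \<theta>) \<le> ratio n x \<theta> \<and> ratio n x \<theta> \<le> exp (- (1 - e j) * q n x \<theta>)"
    using N unfolding N_def by blast+
  define F where "F j \<eta> \<longleftrightarrow> 0 < \<eta> \<and> (\<forall>\<^sub>F (n, x) in whp Pn. \<forall>\<theta>\<in>\<Omega>. e j \<le> \<bar>\<theta> - \<theta>0\<bar> \<longrightarrow>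
      ratio n x \<theta> \<le> exp (- \<eta> * real n))" for j \<eta>
  have "\<exists>\<eta>. F j \<eta>" for j
    unfolding F_def ratio_def by (rule likelihood_ratio_far[OF mle e])
  then obtain \<eta> where F: "\<And>j. F j (\<eta> j)" by metis
  have \<eta>: "\<And>j. 0 < \<eta> j" and far: "\<And>j. \<forall>\<^sub>F (n, x) in whp Pn. \<forall>\<theta>\<in>\<Omega>. e j \<le> \<bar>\<theta> - \<theta>0\<bar> \<longrightarrow> ratio n x \<theta> \<le> exp (- \<eta> j * real n)"
    using F unfolding F_def by blast+
  \<comment> \<open>Here e j serves both as error in the exponent and as radius, for the MLE and for
    the far region; j <= n forces the sample sizes to infinity along the sequence.\<close>
  define Q where "Q j z \<longleftrightarrow> (case z of (n, x) \<Rightarrow> j \<le> n \<and> mle_regular T n x \<and> \<bar>T n x - \<theta>0\<bar> < e j \<and>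
      (\<forall>\<theta>. \<bar>\<theta> - \<theta>0\<bar> < d j \<longrightarrow>
        exp (- (1 + e j) * q n x \<theta>) \<le> ratio n x \<theta> \<and> ratio n x \<theta> \<le> exp (- (1 - e j) * q n x \<theta>)) \<and>
      (\<forall>\<theta>\<in>\<Omega>. e j \<le> \<bar>\<theta> - \<theta>0\<bar> \<longrightarrow> ratio n x \<theta> \<le> exp (- \<eta> j * real n)))" for j z
  have Q: "eventually (Q j) (whp Pn)" for j
    using near[of j] far[of j] mle_consistent[OF mle e[of j]] whp_mle_regular[OF mle]
      eventually_whp_index[OF eventually_ge_at_top[of j], of Pn]
    by eventually_elim (auto simp: Q_def)
  show ?thesis
    unfolding I_def[symmetric]
  proof (rule tendsto_if_sequences[OF Q])
    fix z :: "nat \<Rightarrow> nat \<times> (nat \<Rightarrow> 'a)"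
    assume ev: "\<And>j. \<forall>\<^sub>F k in sequentially. Q j (z k)"
    define n where "n k = fst (z k)" for k
    define x where "x k = snd (z k)" for k
    have z: "z k = (n k, x k)" for k by (simp add: n_def x_def)
    define s where "s k = sqrt (real (n k) * I)" for k
    define t where "t k = T (n k) (x k)" for k
    \<comment> \<open>Laplace's method asks for measurability at every index, so the sequence starts
      where the data strings are regular.\<close>
    obtain k0 where k0: "\<And>k. k0 \<le> k \<Longrightarrow> mle_regular T (n k) (x k)"
      using ev[of 0] by (auto simp: Q_def z eventually_sequentially)
    define R where "R k \<theta> = ratio (n (k + k0)) (x (k + k0)) \<theta>" for k \<theta>
    have reg: "mle_regular T (n (k + k0)) (x (k + k0))" for k by (rule k0) simp
    have sp: "\<forall>i<n (k + k0). x (k + k0) i \<in> space M" for k using reg[of k] by (simp add: mle_regular_def)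
    have lpos: "0 < likelihood p (n (k + k0)) (x (k + k0)) (t (k + k0))" for k
      using reg[of k] true_param by (auto simp: mle_regular_def t_def intro: less_le_trans)
    have ev': "\<forall>\<^sub>F k in sequentially. Q j (z (k + k0))" for j
      using ev[of j] by (subst eventually_sequentially_seg)
    have wR: "w \<theta> * R k \<theta> = joint (n (k + k0)) (x (k + k0)) \<theta> / likelihood p (n (k + k0)) (x (k + k0)) (t (k + k0))" for k \<theta>
      by (simp add: R_def ratio_def joint_def t_def)
    have nlim: "filterlim n at_top sequentially"
      unfolding filterlim_at_top
    proof
      fix Z
      from ev[of Z] show "\<forall>\<^sub>F k in sequentially. Z \<le> n k"
        by eventually_elim (simp add: Q_def z)
    qed
    have slim: "filterlim (\<lambda>k. s (k + k0)) at_top sequentially"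
    proof -
      have "filterlim (\<lambda>k. real (n k) * I) at_top sequentially"
        by (rule filterlim_at_top_mult_tendsto_pos[OF tendsto_const I])
           (rule filterlim_compose[OF filterlim_real_sequentially nlim])
      then have "filterlim s at_top sequentially"
        unfolding s_def by (rule filterlim_compose[OF sqrt_at_top])
      then show ?thesis by (rule filterlim_compose) (rule filterlim_add_const_nat_at_top)
    qed
    have tlim: "(\<lambda>k. t (k + k0)) \<longlonglongrightarrow> \<theta>0"
    proof (rule tendstoI)
      fix \<epsilon> :: real assume "0 < \<epsilon>"
      then obtain j where "e j < \<epsilon>" using e_small by blast
      then show "\<forall>\<^sub>F k in sequentially. dist (t (k + k0)) \<theta>0 < \<epsilon>"
        using ev'[of j] by (auto simp: Q_def z t_def dist_real_def elim!: eventually_mono)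
    qed
    have lap: "(\<lambda>k. s (k + k0) ^ (i + 1) * (\<integral>\<theta>. (\<theta> - t (k + k0)) ^ i * (w \<theta> * R k \<theta>) \<partial>lborel))
      \<longlonglongrightarrow> w \<theta>0 * (sqrt (2 * pi) * (\<integral>v. std_normal_density v * v ^ i \<partial>lborel))"
      if wi: "integrable lborel (\<lambda>\<theta>. \<bar>\<theta>\<bar> ^ i * w \<theta>)" for i
    proof (rule laplace_moment[OF slim tlim prior_measurable prior_nonneg prior_cont prior_integrable wi])
      show "(\<lambda>\<theta>. w \<theta> * R k \<theta>) \<in> borel_measurable borel" for k
        unfolding wR using joint_measurable_param[OF sp[of k]] by measurable
    next
      fix \<epsilon> :: real assume "0 < \<epsilon>"
      then obtain j where j: "e j < \<epsilon>" using e_small by blast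
      show "\<exists>\<delta>>0. \<forall>\<^sub>F k in sequentially. \<forall>\<theta>. \<bar>\<theta> - \<theta>0\<bar> < \<delta> \<longrightarrow>
        exp (- (1 + \<epsilon>) * ((s (k + k0) * (\<theta> - t (k + k0)))\<^sup>2 / 2)) \<le> R k \<theta> \<and>
        R k \<theta> \<le> exp (- (1 - \<epsilon>) * ((s (k + k0) * (\<theta> - t (k + k0)))\<^sup>2 / 2))"
      proof (intro exI[of _ "d j"] conjI d)
        show "\<forall>\<^sub>F k in sequentially. \<forall>\<theta>. \<bar>\<theta> - \<theta>0\<bar> < d j \<longrightarrow>
          exp (- (1 + \<epsilon>) * ((s (k + k0) * (\<theta> - t (k + k0)))\<^sup>2 / 2)) \<le> R k \<theta> \<and>
          R k \<theta> \<le> exp (- (1 - \<epsilon>) * ((s (k + k0) * (\<theta> - t (k + k0)))\<^sup>2 / 2))"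
          using ev'[of j]
        proof eventually_elim
          case (elim k)
          show ?case
          proof (intro allI impI)
            fix \<theta> assume \<theta>: "\<bar>\<theta> - \<theta>0\<bar> < d j"
            define u where "u = (s (k + k0) * (\<theta> - t (k + k0)))\<^sup>2 / 2"
            have u: "0 \<le> u" by (simp add: u_def)
            have "exp (- (1 + e j) * u) \<le> R k \<theta> \<and> R k \<theta> \<le> exp (- (1 - e j) * u)"
              using elim \<theta> by (simp add: Q_def z u_def q_def R_def s_def t_def)
            moreover have "- (1 + \<epsilon>) * u \<le> - (1 + e j) * u" "- (1 - e j) * u \<le> - (1 - \<epsilon>) * u"
              using j by (auto intro!: mult_right_mono u)
            ultimately show "exp (- (1 + \<epsilon>) * u) \<le> R k \<theta> \<and> R k \<theta> \<le> exp (- (1 - \<epsilon>) * u)"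
              by (meson exp_le_cancel_iff order_trans)
          qed
        qed
      qed
    next
      fix \<delta> :: real assume "0 < \<delta>"
      then obtain j where j: "e j < \<delta>" using e_small by blast
      show "\<exists>\<eta>>0. \<forall>\<^sub>F k in sequentially. \<forall>\<theta>. \<delta> \<le> \<bar>\<theta> - \<theta>0\<bar> \<longrightarrow>
        0 \<le> w \<theta> * R k \<theta> \<and> w \<theta> * R k \<theta> \<le> w \<theta> * exp (- \<eta> * (s (k + k0))\<^sup>2)"
      \<comment> \<open>The rate is expressed in s^2 = n * I instead of n, hence the division by
        \<open>I\<close>.\<close>
      proof (intro exI[of _ "\<eta> j / I"] conjI)
        show "0 < \<eta> j / I" using \<eta> I by simp
        show "\<forall>\<^sub>F k in sequentially. \<forall>\<theta>. \<delta> \<le> \<bar>\<theta> - \<theta>0\<bar> \<longrightarrow>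
          0 \<le> w \<theta> * R k \<theta> \<and> w \<theta> * R k \<theta> \<le> w \<theta> * exp (- (\<eta> j / I) * (s (k + k0))\<^sup>2)"
          using ev'[of j]
        proof eventually_elim
          case (elim k)
          show ?case
          proof (intro allI impI)
            fix \<theta> assume \<theta>: "\<delta> \<le> \<bar>\<theta> - \<theta>0\<bar>"
            have s2: "- (\<eta> j / I) * (s (k + k0))\<^sup>2 = - \<eta> j * real (n (k + k0))"
              using I by (simp add: s_def)
            show "0 \<le> w \<theta> * R k \<theta> \<and> w \<theta> * R k \<theta> \<le> w \<theta> * exp (- (\<eta> j / I) * (s (k + k0))\<^sup>2)"
            proof (cases "\<theta> \<in> \<Omega>")
              case True
              have "R k \<theta> \<le> exp (- \<eta> j * real (n (k + k0)))"
                using elim True \<theta> j by (auto simp: Q_def z R_def)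
              moreover have "0 \<le> w \<theta> * R k \<theta>"
                unfolding wR using joint_nonneg[OF sp] lpos[of k] by (simp add: less_imp_le)
              ultimately show ?thesis
                unfolding s2 using prior_nonneg by (simp add: mult_left_mono)
            qed (simp add: prior_support)
          qed
        qed
      qed
    qed
    have lam0: "(\<integral>v. std_normal_density v * v ^ 0 \<partial>lborel) = 1"
      using integral_std_normal_moment_even[of 0] by simp
    have w0: "integrable lborel (\<lambda>\<theta>. \<bar>\<theta>\<bar> ^ 0 * w \<theta>)" using prior_integrable by simp
    have den: "(\<lambda>k. s (k + k0) ^ (0 + 1) * (\<integral>\<theta>. (\<theta> - t (k + k0)) ^ 0 * (w \<theta> * R k \<theta>) \<partial>lborel))
      \<longlonglongrightarrow> w \<theta>0 * sqrt (2 * pi)"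
      using lap[OF w0] unfolding lam0 by simp
    have "(\<lambda>k. (s (k + k0) ^ (i + 1) * (\<integral>\<theta>. (\<theta> - t (k + k0)) ^ i * (w \<theta> * R k \<theta>) \<partial>lborel)) /
        (s (k + k0) ^ (0 + 1) * (\<integral>\<theta>. (\<theta> - t (k + k0)) ^ 0 * (w \<theta> * R k \<theta>) \<partial>lborel)))
      \<longlonglongrightarrow> (w \<theta>0 * (sqrt (2 * pi) * lambda_rr i)) / (w \<theta>0 * sqrt (2 * pi))"
      by (rule tendsto_divide[OF lap[OF wi, unfolded std_normal_moment_eq_lambda_rr] den]) (use prior_pos in simp)
    moreover have "(w \<theta>0 * (sqrt (2 * pi) * lambda_rr i)) / (w \<theta>0 * sqrt (2 * pi)) = lambda_rr i"
      using prior_pos by simp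
    moreover have "(s (k + k0) ^ (i + 1) * (\<integral>\<theta>. (\<theta> - t (k + k0)) ^ i * (w \<theta> * R k \<theta>) \<partial>lborel)) /
        (s (k + k0) ^ (0 + 1) * (\<integral>\<theta>. (\<theta> - t (k + k0)) ^ 0 * (w \<theta> * R k \<theta>) \<partial>lborel)) =
        s (k + k0) ^ i * post_moment (n (k + k0)) (x (k + k0)) (t (k + k0)) i" for k
    proof -
      have s0: "s (k + k0) \<noteq> 0" using reg[of k] I by (simp add: s_def mle_regular_def)
      show ?thesis
        unfolding wR post_moment_eq[OF sp] evidence_def using s0 lpos[of k] by simp
    qed
    ultimately have "(\<lambda>k. s (k + k0) ^ i * post_moment (n (k + k0)) (x (k + k0)) (t (k + k0)) i) \<longlonglongrightarrow> lambda_rr i"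
      by simp
    then have "(\<lambda>k. s k ^ i * post_moment (n k) (x k) (t k) i) \<longlonglongrightarrow> lambda_rr i"
      by (rule LIMSEQ_offset)
    then show "(\<lambda>k. case z k of (n, x) \<Rightarrow> sqrt (real n * I) ^ i * post_moment n x (T n x) i) \<longlonglongrightarrow> lambda_rr i"
      by (simp add: z s_def t_def)
  qed
qed

end


section \<open>Joint measurability in data and parameter\<close>

text \<open>Caratheodory functions are jointly measurable: replace t by a nearby point of a
  countable dense subset of \<open>S\<close>, which is measurable on the product, and pass to the
  limit by continuity in t. This makes posterior integrals measurable in the sample.\<close>

lemma measurable_pair_continuous_on_closed:
  fixes f :: "'a \<Rightarrow> real \<Rightarrow> real"
  assumes S: "closed S" and cont: "\<And>x. x \<in> space M \<Longrightarrow> continuous_on S (f x)"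
    and meas: "\<And>t. t \<in> S \<Longrightarrow> (\<lambda>x. f x t) \<in> borel_measurable M"
  shows "(\<lambda>z::'a \<times> real. indicator S (snd z) * f (fst z) (snd z)) \<in> borel_measurable (M \<Otimes>\<^sub>M borel)"
proof (cases "S = {}")
  case False
  obtain D where D: "countable D" "D \<subseteq> S" "S \<subseteq> closure D" by (rule separable)
  have "D \<noteq> {}" using D(3) False by auto
  define d where "d = from_nat_into D"
  have range_d: "range d = D" unfolding d_def using D(1) \<open>D \<noteq> {}\<close> by (rule range_from_nat_into[rotated])
  then have dS: "d j \<in> S" for j using D(2) by auto
  \<comment> \<open>Taking the least admissible index makes the choice measurable in t. Off
    \<open>S\<close> there may be no such index, but there the indicator kills the term.\<close>
  define idx where "idx k t = (LEAST j. \<bar>d j - t\<bar> < 1 / real (Suc k))" for k :: nat and t :: real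
  have idx: "\<bar>d (idx k t) - t\<bar> < 1 / real (Suc k)" if "t \<in> S" for k t
  proof -
    have "t \<in> closure D" using that D(3) by auto
    then obtain y where "y \<in> D" "dist y t < 1 / real (Suc k)"
      by (auto simp: closure_approachable dest!: spec[of _ "1 / real (Suc k)"])
    then have "\<exists>j. \<bar>d j - t\<bar> < 1 / real (Suc k)" using range_d by (auto simp: dist_real_def)
    then show ?thesis unfolding idx_def by (rule LeastI_ex)
  qed
  have [measurable]: "idx k \<in> measurable borel (count_space UNIV)" for k
    unfolding idx_def[abs_def] by measurable
  have [measurable]: "S \<in> sets borel" using S by auto
  show ?thesis
  proof (rule borel_measurable_LIMSEQ_real)
    fix z :: "'a \<times> real" assume z: "z \<in> space (M \<Otimes>\<^sub>M borel)"
    show "(\<lambda>k. indicator S (snd z) * f (fst z) (d (idx k (snd z)))) \<longlonglongrightarrow> indicator S (snd z) * f (fst z) (snd z)"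
    proof (cases "snd z \<in> S")
      case True
      have "(\<lambda>k. d (idx k (snd z)) - snd z) \<longlonglongrightarrow> 0"
      proof (rule Lim_null_comparison)
        show "\<forall>\<^sub>F k in sequentially. norm (d (idx k (snd z)) - snd z) \<le> 1 / real (Suc k)"
          using idx[OF True] by (auto intro!: always_eventually less_imp_le)
        show "(\<lambda>k. 1 / real (Suc k)) \<longlonglongrightarrow> 0" by (rule LIMSEQ_Suc[OF lim_const_over_n])
      qed
      then have lim: "(\<lambda>k. d (idx k (snd z))) \<longlonglongrightarrow> snd z" by (rule LIM_zero_cancel)
      have c: "continuous_on S (f (fst z))"
        by (rule cont) (use z in \<open>auto simp: space_pair_measure\<close>)
      have "(\<lambda>k. f (fst z) (d (idx k (snd z)))) \<longlonglongrightarrow> f (fst z) (snd z)"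
        by (rule continuous_on_tendsto_compose[OF c lim True]) (simp add: dS)
      then show ?thesis by (intro tendsto_intros)
    qed simp
  next
    fix k
    have "(\<lambda>z::'a \<times> real. f (fst z) (d (idx k (snd z)))) \<in> borel_measurable (M \<Otimes>\<^sub>M borel)"
    proof (rule measurable_compose_countable[where g = "\<lambda>z::'a \<times> real. idx k (snd z)" and f = "\<lambda>j z. f (fst z) (d j)"])
      show "(\<lambda>z::'a \<times> real. f (fst z) (d j)) \<in> borel_measurable (M \<Otimes>\<^sub>M borel)" for j
        by (rule measurable_compose[OF measurable_fst meas[OF dS]])
      show "(\<lambda>z::'a \<times> real. idx k (snd z)) \<in> measurable (M \<Otimes>\<^sub>M borel) (count_space UNIV)" by measurable
    qed
    then show "(\<lambda>z::'a \<times> real. indicator S (snd z) * f (fst z) (d (idx k (snd z)))) \<in> borel_measurable (M \<Otimes>\<^sub>M borel)"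
      by measurable
  qed
qed simp

context regular_bayes_model
begin

lemma joint_measurable_pair:
  "(\<lambda>z. joint n (fst z) (snd z)) \<in> borel_measurable (Pn n \<Otimes>\<^sub>M lborel)"
proof -
  have base: "(\<lambda>z. indicator \<Omega> (snd z) * p (fst z) (snd z)) \<in> borel_measurable (M \<Otimes>\<^sub>M borel)"
    by (rule measurable_pair_continuous_on_closed[OF closed_param dens_cont dens_measurable])
  have comp: "(\<lambda>z. indicator \<Omega> (snd z) * p (fst z i) (snd z)) \<in> borel_measurable (Pn n \<Otimes>\<^sub>M lborel)" if i: "i < n" for i
  proof -
    have c: "(\<lambda>x. x i) \<in> measurable (Pn n) M"
      unfolding sample_def using measurable_component_singleton[of i "{..<n}" "\<lambda>_. P0"] i
      by (simp add: measurable_cong_sets[OF refl sets_model])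
    have "(\<lambda>z. (fst z i, snd z)) \<in> measurable (Pn n \<Otimes>\<^sub>M lborel) (M \<Otimes>\<^sub>M borel)"
      by (intro measurable_Pair measurable_compose[OF measurable_fst c]) simp
    from measurable_compose[OF this base] show ?thesis by simp
  qed
  have "(\<lambda>z. w (snd z) * (\<Prod>i<n. indicator \<Omega> (snd z) * p (fst z i) (snd z))) \<in> borel_measurable (Pn n \<Otimes>\<^sub>M lborel)"
  proof (rule borel_measurable_times)
    show "(\<lambda>z. w (snd z)) \<in> borel_measurable (Pn n \<Otimes>\<^sub>M lborel)"
      using prior_measurable by measurable
    show "(\<lambda>z. \<Prod>i<n. indicator \<Omega> (snd z) * p (fst z i) (snd z)) \<in> borel_measurable (Pn n \<Otimes>\<^sub>M lborel)"
      by (rule borel_measurable_prod) (use comp in auto)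
  qed
  moreover have "joint n x \<theta> = w \<theta> * (\<Prod>i<n. indicator \<Omega> \<theta> * p (x i) \<theta>)" for x \<theta>
    by (cases "\<theta> \<in> \<Omega>") (auto simp: joint_def likelihood_def prior_support)
  ultimately show ?thesis by simp
qed

lemma evidence_measurable [measurable]: "evidence n \<in> borel_measurable (Pn n)"
  unfolding evidence_def[abs_def]
  by (rule lborel.borel_measurable_lebesgue_integral)
     (use joint_measurable_pair[of n] in \<open>simp add: case_prod_unfold\<close>)

lemma post_moment_measurable:
  assumes m: "m \<in> borel_measurable (Pn n)"
  shows "(\<lambda>x. post_moment n x (m x) i) \<in> borel_measurable (Pn n)"
proof -
  note [measurable] = joint_measurable_pair[of n] m
  have "(\<lambda>z. (snd z - m (fst z)) ^ i * joint n (fst z) (snd z)) \<in> borel_measurable (Pn n \<Otimes>\<^sub>M lborel)"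
    by measurable
  then have "(\<lambda>x. \<integral>\<theta>. (\<theta> - m x) ^ i * joint n x \<theta> \<partial>lborel) \<in> borel_measurable (Pn n)"
    by (intro lborel.borel_measurable_lebesgue_integral) (simp add: case_prod_unfold)
  then have "(\<lambda>x. (\<integral>\<theta>. (\<theta> - m x) ^ i * joint n x \<theta> \<partial>lborel) / evidence n x) \<in> borel_measurable (Pn n)"
    by measurable
  then show ?thesis
    by (rule measurable_cong[THEN iffD1, rotated]) (simp add: post_moment_eq[OF space_sampleD])
qed

lemma post_central_moment_measurable: "post_central_moment p w r n \<in> borel_measurable (Pn n)"
proof -
  have "post_mean p w n \<in> borel_measurable (Pn n)"
    using post_moment_measurable[of "\<lambda>_. 0" n 1] by (simp add: post_mean_def[abs_def] post_moment_def)
  then show ?thesis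
    unfolding post_central_moment_eq[abs_def] by (rule post_moment_measurable)
qed

section \<open>Recentring at the posterior mean\<close>

text \<open>The power s^r is distributed as s^i * s^(r - i), so that only rescaled moments about c
  occur. Used twice: for the limit in probability and for the bound on the good sets.\<close>

lemma post_central_moment_expansion:
  assumes x: "\<forall>i<n. x i \<in> space M" and r: "integrable lborel (\<lambda>\<theta>. \<bar>\<theta>\<bar> ^ r * w \<theta>)" "1 \<le> r"
    and Z: "evidence n x \<noteq> 0"
  shows "s ^ r * post_central_moment p w r n x =
    (\<Sum>i\<le>r. real (r choose i) * (s ^ i * post_moment n x c i) * (- (s ^ 1 * post_moment n x c 1)) ^ (r - i))"
proof -
  have "s ^ r * post_central_moment p w r n x =
      (\<Sum>i\<le>r. s ^ r * (real (r choose i) * post_moment n x c i * (- post_moment n x c 1) ^ (r - i)))"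
    unfolding post_central_moment_eq post_moment_shift[OF x r(1), of _ c] post_mean_diff[OF x r Z]
    by (rule sum_distrib_left)
  also have "\<dots> = (\<Sum>i\<le>r. real (r choose i) * (s ^ i * post_moment n x c i) * (- (s ^ 1 * post_moment n x c 1)) ^ (r - i))"
  proof (rule sum.cong[OF refl])
    fix i assume "i \<in> {..r}"
    then have "s ^ r = s ^ i * s ^ (r - i)" by (simp add: power_add[symmetric])
    moreover have "(- (s ^ 1 * post_moment n x c 1)) ^ (r - i) = s ^ (r - i) * (- post_moment n x c 1) ^ (r - i)"
      by (simp add: power_mult_distrib[symmetric])
    ultimately show "s ^ r * (real (r choose i) * post_moment n x c i * (- post_moment n x c 1) ^ (r - i)) =
        real (r choose i) * (s ^ i * post_moment n x c i) * (- (s ^ 1 * post_moment n x c 1)) ^ (r - i)"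
      by (simp add: mult_ac)
  qed
  finally show ?thesis .
qed

lemma post_central_moment_tendsto:
  assumes sm: "loglik_smooth M p \<Omega> \<theta>0 m" "3 \<le> m" and mle: "is_mle M p \<Omega> \<theta>0 T"
    and r: "integrable lborel (\<lambda>\<theta>. \<bar>\<theta>\<bar> ^ r * w \<theta>)" "1 \<le> r"
  shows "((\<lambda>(n, x). sqrt (real n * fisher M p \<theta>0) ^ r * post_central_moment p w r n x) \<longlongrightarrow> lambda_rr r) (whp Pn)"
proof -
  define a where "a i z = (case z of (n, x) \<Rightarrow> sqrt (real n * fisher M p \<theta>0) ^ i * post_moment n x (T n x) i)" for i z
  have lim: "(a i \<longlongrightarrow> lambda_rr i) (whp Pn)" if "i \<le> r" for i
    unfolding a_def
    by (rule post_moment_tendsto[OF sm mle integrable_abs_power_le[OF prior_integrable prior_nonneg r(1) that]])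
  have lam0: "lambda_rr 0 = 1"
    using std_normal_moment_eq_lambda_rr[of 0] integral_std_normal_moment_even[of 0] by simp
  have lam1: "lambda_rr 1 = 0" by (simp add: lambda_rr_def)
  have "((\<lambda>z. \<Sum>i\<le>r. real (r choose i) * a i z * (- a 1 z) ^ (r - i)) \<longlongrightarrow>
      (\<Sum>i\<le>r. real (r choose i) * lambda_rr i * (- lambda_rr 1) ^ (r - i))) (whp Pn)"
    by (intro tendsto_intros lim) (use r(2) in auto)
  \<comment> \<open>The first Gaussian moment is 0, so every term with a positive power of the shift
    vanishes and only i = r survives.\<close>
  moreover have "(\<Sum>i\<le>r. real (r choose i) * lambda_rr i * (- lambda_rr 1) ^ (r - i)) = lambda_rr r"
  proof -
    have "(\<Sum>i\<le>r. real (r choose i) * lambda_rr i * (- lambda_rr 1) ^ (r - i)) =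
        (\<Sum>i\<in>{r}. real (r choose i) * lambda_rr i * (- lambda_rr 1) ^ (r - i))"
      unfolding lam1 by (rule sum.mono_neutral_right) auto
    then show ?thesis by simp
  qed
  moreover have "\<forall>\<^sub>F z in whp Pn. (\<Sum>i\<le>r. real (r choose i) * a i z * (- a 1 z) ^ (r - i)) =
      (case z of (n, x) \<Rightarrow> sqrt (real n * fisher M p \<theta>0) ^ r * post_central_moment p w r n x)"
  proof -
    \<comment> \<open>The zeroth moment is 0 or 1 and tends to 1, which shows that the evidence is
      nonzero with high probability.\<close>
    have "\<forall>\<^sub>F z in whp Pn. 0 < a 0 z"
      using lim[of 0] lam0 by (intro order_tendstoD(1)) auto
    then show ?thesis using whp_space
    proof eventually_elim
      case (elim z)
      obtain n x where z: "z = (n, x)" by force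
      have x: "\<forall>i<n. x i \<in> space M" using elim z by simp
      have "evidence n x \<noteq> 0"
        using elim(1) post_moment_if_evidence_0[OF x] by (auto simp: z a_def)
      from post_central_moment_expansion[OF x r this] show ?case by (simp add: z a_def)
    qed
  qed
  ultimately show ?thesis by (simp add: tendsto_cong)
qed

section \<open>Uniform bounds on the good sets\<close>

text \<open>The expansion starts at n^(-i/2), and all later terms and the error are of no larger
  order. Multiplication by n^(i/2) leaves a bound uniform in n and in the data string.\<close>

lemma good_sets_moment_bound:
  assumes good: "good_sets M p \<theta>0 w T r J S" and J: "r \<le> J" and i: "1 \<le> i" "i \<le> r"
  shows "\<exists>C. \<forall>\<^sub>F n in sequentially. \<forall>x\<in>S n. \<bar>sqrt (real n * fisher M p \<theta>0) ^ i * post_moment n x (T n x) i\<bar> \<le> C"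
proof -
  define I where "I = fisher M p \<theta>0"
  have I: "0 < I" using fisher_pos by (simp add: I_def)
  have Ssp: "S n \<subseteq> space (Pn n)" for n
    using good sets.sets_into_space[of "S n" "Pn n"] by (auto simp: good_sets_def)
  have "\<exists>(lam :: nat \<Rightarrow> nat \<Rightarrow> (nat \<Rightarrow> 'a) \<Rightarrow> real) B C N.
        C > 0 \<and>
        (\<forall>j\<in>{i..J}. \<forall>n. \<forall>x\<in>space (Pn n). \<bar>lam j n x\<bar> \<le> B) \<and>
        (\<forall>n>N. \<forall>x\<in>S n.
           \<bar>(\<integral>\<theta>. I powr (real i / 2) * (\<theta> - T n x) ^ i \<partial>posterior p w n x)
             - (\<Sum>j=i..J. lam j n x * real n powr (- real j / 2))\<bar>
           \<le> C * real n powr (- real (J + 1) / 2))"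
    using good i unfolding good_sets_def I_def by simp
  then obtain lam B C N where C: "C > 0"
    and B: "\<And>j n x. j \<in> {i..J} \<Longrightarrow> x \<in> space (Pn n) \<Longrightarrow> \<bar>lam j n x :: real\<bar> \<le> B"
    and exp: "\<And>n x. N < n \<Longrightarrow> x \<in> S n \<Longrightarrow>
           \<bar>(\<integral>\<theta>. I powr (real i / 2) * (\<theta> - T n x) ^ i \<partial>posterior p w n x)
             - (\<Sum>j=i..J. lam j n x * real n powr (- real j / 2))\<bar>
           \<le> C * real n powr (- real (J + 1) / 2)" by blast
  \<comment> \<open>At most J + 1 coefficients, each bounded by |B|, and the error constant C; n >=
    1 makes powers of n monotone in the exponent.\<close>
  have "\<bar>sqrt (real n * I) ^ i * post_moment n x (T n x) i\<bar> \<le> real (Suc J) * \<bar>B\<bar> + C" if n: "max N 1 < n" and x: "x \<in> S n" for n x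
  proof -
    have n1: "1 \<le> real n" using n by simp
    have pw: "real n powr (- real j / 2) \<le> real n powr (- real i / 2)" if "i \<le> j" for j
      using n1 that by (intro powr_mono) auto
    have "\<bar>\<Sum>j=i..J. lam j n x * real n powr (- real j / 2)\<bar> \<le> (\<Sum>j=i..J. \<bar>lam j n x * real n powr (- real j / 2)\<bar>)"
      by (rule sum_abs)
    also have "\<dots> \<le> (\<Sum>j=i..J. \<bar>B\<bar> * real n powr (- real i / 2))"
    proof (rule sum_mono)
      fix j assume j: "j \<in> {i..J}"
      have "\<bar>lam j n x\<bar> \<le> \<bar>B\<bar>" using B[OF j, of x n] Ssp x by force
      then show "\<bar>lam j n x * real n powr (- real j / 2)\<bar> \<le> \<bar>B\<bar> * real n powr (- real i / 2)"
        unfolding abs_mult using pw[of j] j by (intro mult_mono) auto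
    qed
    also have "\<dots> \<le> real (Suc J) * (\<bar>B\<bar> * real n powr (- real i / 2))"
      by (simp add: mult_right_mono)
    finally have 1: "\<bar>\<Sum>j=i..J. lam j n x * real n powr (- real j / 2)\<bar> \<le> real (Suc J) * (\<bar>B\<bar> * real n powr (- real i / 2))" .
    have "C * real n powr (- real (J + 1) / 2) \<le> C * real n powr (- real i / 2)"
      using C pw[of "J + 1"] J i by (intro mult_left_mono) auto
    then have "\<bar>\<integral>\<theta>. I powr (real i / 2) * (\<theta> - T n x) ^ i \<partial>posterior p w n x\<bar> \<le>
        real (Suc J) * (\<bar>B\<bar> * real n powr (- real i / 2)) + C * real n powr (- real i / 2)"
      using exp[of n x] n x 1 by (auto simp: abs_le_iff)
    also have "\<dots> = (real (Suc J) * \<bar>B\<bar> + C) * real n powr (- real i / 2)"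
      by (simp add: algebra_simps)
    also have "(\<integral>\<theta>. I powr (real i / 2) * (\<theta> - T n x) ^ i \<partial>posterior p w n x) = I powr (real i / 2) * post_moment n x (T n x) i"
      by (simp add: post_moment_def)
    finally have 2: "\<bar>I powr (real i / 2) * post_moment n x (T n x) i\<bar> \<le> (real (Suc J) * \<bar>B\<bar> + C) * real n powr (- real i / 2)" .
    have "sqrt (real n * I) ^ i = (real n * I) powr (real i / 2)"
      using n1 I by (simp add: powr_half_sqrt[symmetric] powr_realpow[symmetric] powr_powr)
    also have "\<dots> = real n powr (real i / 2) * I powr (real i / 2)"
      using I by (simp add: powr_mult)
    finally have s: "sqrt (real n * I) ^ i = real n powr (real i / 2) * I powr (real i / 2)" .
    have "\<bar>sqrt (real n * I) ^ i * post_moment n x (T n x) i\<bar> =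
        real n powr (real i / 2) * \<bar>I powr (real i / 2) * post_moment n x (T n x) i\<bar>"
      unfolding s by (simp add: abs_mult)
    also have "\<dots> \<le> real n powr (real i / 2) * ((real (Suc J) * \<bar>B\<bar> + C) * real n powr (- real i / 2))"
      by (rule mult_left_mono[OF 2]) simp
    also have "\<dots> = (real (Suc J) * \<bar>B\<bar> + C) * (real n powr (real i / 2) * real n powr (- real i / 2))"
      by (simp add: mult_ac)
    also have "real n powr (real i / 2) * real n powr (- real i / 2) = 1"
      using n1 by (simp add: powr_add[symmetric])
    finally show ?thesis by simp
  qed
  then show ?thesis
    unfolding I_def[symmetric]
    by (intro exI[of _ "real (Suc J) * \<bar>B\<bar> + C"] eventually_mono[OF eventually_gt_at_top[of "max N 1"]]) blast
qed

text \<open>Nonnegativity of the constant is part of the claim because the moment is later cut off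
  to 0 outside the good sets and has to obey the same bound there.\<close>

lemma good_sets_central_moment_bound:
  assumes good: "good_sets M p \<theta>0 w T r J S" and J: "r \<le> J"
    and r: "integrable lborel (\<lambda>\<theta>. \<bar>\<theta>\<bar> ^ r * w \<theta>)" "1 \<le> r"
  shows "\<exists>C\<ge>0. \<forall>\<^sub>F n in sequentially. \<forall>x\<in>S n. \<bar>sqrt (real n * fisher M p \<theta>0) ^ r * post_central_moment p w r n x\<bar> \<le> C"
proof -
  define a where "a i n x = sqrt (real n * fisher M p \<theta>0) ^ i * post_moment n x (T n x) i" for i n x
  have Ssp: "\<forall>i<n. x i \<in> space M" if "x \<in> S n" for n x
    using good sets.sets_into_space[of "S n" "Pn n"] that by (intro space_sampleD) (auto simp: good_sets_def)
  have "\<exists>C. \<forall>\<^sub>F n in sequentially. \<forall>x\<in>S n. \<bar>a i n x\<bar> \<le> C" if "i \<le> r" for i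
  \<comment> \<open>Order 0 lies outside the range of the good-set expansions; the total mass is 0
    or 1.\<close>
  proof (cases "i = 0")
    case True
    then show ?thesis using Ssp
      by (intro exI[of _ 1] always_eventually) (auto simp: a_def post_moment_0)
  next
    case False
    then show ?thesis
      unfolding a_def by (intro good_sets_moment_bound[OF good J]) (use that in auto)
  qed
  then have "\<forall>i. \<exists>C. i \<le> r \<longrightarrow> (\<forall>\<^sub>F n in sequentially. \<forall>x\<in>S n. \<bar>a i n x\<bar> \<le> C)" by blast
  then obtain C where "\<forall>i. i \<le> r \<longrightarrow> (\<forall>\<^sub>F n in sequentially. \<forall>x\<in>S n. \<bar>a i n x\<bar> \<le> C i)"
    by (rule choice[THEN exE])
  then have C: "\<And>i. i \<le> r \<Longrightarrow> \<forall>\<^sub>F n in sequentially. \<forall>x\<in>S n. \<bar>a i n x\<bar> \<le> C i" by blast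
  define K where "K = (\<Sum>i\<le>r. real (r choose i) * \<bar>C i\<bar> * \<bar>C 1\<bar> ^ (r - i))"
  have K: "0 \<le> K" unfolding K_def by (intro sum_nonneg) auto
  have "\<forall>\<^sub>F n in sequentially. \<forall>i\<in>{..r}. \<forall>x\<in>S n. \<bar>a i n x\<bar> \<le> C i"
    by (rule eventually_ball_finite) (use C in auto)
  then have "\<forall>\<^sub>F n in sequentially. \<forall>x\<in>S n. \<bar>sqrt (real n * fisher M p \<theta>0) ^ r * post_central_moment p w r n x\<bar> \<le> K"
  proof eventually_elim
    case (elim n)
    show ?case
    proof
      fix x assume x: "x \<in> S n"
      show "\<bar>sqrt (real n * fisher M p \<theta>0) ^ r * post_central_moment p w r n x\<bar> \<le> K"
      proof (cases "evidence n x = 0")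
        case True
        then show ?thesis using K post_moment_if_evidence_0[OF Ssp[OF x] True]
          by (simp add: post_central_moment_eq)
      next
        case False
        have ai: "\<bar>a i n x\<bar> \<le> \<bar>C i\<bar>" if "i \<le> r" for i
          using elim x that by (force intro: order_trans[OF _ abs_ge_self])
        have "\<bar>sqrt (real n * fisher M p \<theta>0) ^ r * post_central_moment p w r n x\<bar> =
            \<bar>\<Sum>i\<le>r. real (r choose i) * a i n x * (- a 1 n x) ^ (r - i)\<bar>"
          unfolding post_central_moment_expansion[OF Ssp[OF x] r False, of _ "T n x"] a_def ..
        also have "\<dots> \<le> (\<Sum>i\<le>r. \<bar>real (r choose i) * a i n x * (- a 1 n x) ^ (r - i)\<bar>)" by (rule sum_abs)
        also have "\<dots> \<le> K"
          unfolding K_def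
        proof (rule sum_mono)
          fix i assume "i \<in> {..r}"
          then show "\<bar>real (r choose i) * a i n x * (- a 1 n x) ^ (r - i)\<bar> \<le> real (r choose i) * \<bar>C i\<bar> * \<bar>C 1\<bar> ^ (r - i)"
            unfolding abs_mult power_abs using ai[of i] ai[of 1] r(2)
            by (intro mult_mono power_mono) auto
        qed
        finally show ?thesis .
      qed
    qed
  qed
  then show ?thesis using K by blast
qed

end

section \<open>From convergence in probability to the expansion of the mean\<close>

text \<open>Good sets control nothing on their complement, where the central moment might fail to be
  integrable and its Bochner integral would default to 0. Hence the identity is claimed for those n
  for which the remainder is a genuine expectation, and integrability of the whole moment is part of
  the conclusion.\<close>

theorem theorem3p1:
  fixes M :: "'a measure" and p :: "'a \<Rightarrow> real \<Rightarrow> real" and \<Omega> :: "real set"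
    and \<theta>0 :: real and w :: "real \<Rightarrow> real"
    and mle :: "nat \<Rightarrow> (nat \<Rightarrow> 'a) \<Rightarrow> real" and S :: "nat \<Rightarrow> (nat \<Rightarrow> 'a) set"
    and r K J :: nat
  assumes "r \<ge> 1" and "K \<ge> r" and "J \<ge> r"
    and "regular_bayes_model M p \<Omega> \<theta>0 w"
    and "loglik_smooth M p \<Omega> \<theta>0 (J + 3)"
    and "\<exists>U. open U \<and> \<theta>0 \<in> U \<and> Ck_on (J + 1) w U"
    and "is_mle M p \<Omega> \<theta>0 mle"
    and "edgeworth_expansion (sample M p \<theta>0) \<theta>0 (fisher M p \<theta>0) K mle"
    and "edgeworth_expansion (sample M p \<theta>0) \<theta>0 (fisher M p \<theta>0) K (post_mean p w)"
    and "integrable lborel (\<lambda>\<theta>. \<bar>\<theta>\<bar> ^ r * w \<theta>)"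
    and "good_sets M p \<theta>0 w mle r J S"
  shows "\<exists>e \<in> o(\<lambda>n. real n powr (- real r / 2)). \<forall>\<^sub>F n in sequentially.
           integrable (sample M p \<theta>0 n) (\<lambda>x. indicator (- S n) x * post_central_moment p w r n x) \<longrightarrow>
             integrable (sample M p \<theta>0 n) (post_central_moment p w r n) \<and>
             (\<integral>x. post_central_moment p w r n x \<partial>sample M p \<theta>0 n) =
               fisher M p \<theta>0 powr (- real r / 2) * lambda_rr r * real n powr (- real r / 2)
               + e n + bad_set_remainder M p \<theta>0 w r S n"
proof -
  interpret regular_bayes_model M p \<Omega> \<theta>0 w by fact
  define I where "I = fisher M p \<theta>0"
  have I: "0 < I" using fisher_pos by (simp add: I_def)
  define g where "g = post_central_moment p w r"
  \<comment> \<open>Cutting off outside \<open>S n\<close> makes the rescaled moment bounded without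
    affecting its limit in probability, so its mean converges.\<close>
  define f where "f n x = indicator (S n) x * (sqrt (real n * I) ^ r * g n x)" for n x
  define main where "main n = I powr (- real r / 2) * lambda_rr r * real n powr (- real r / 2)" for n :: nat
  \<comment> \<open>With this choice the identity is a mere splitting over \<open>S n\<close> and
    its complement; the content lies in the order of \<open>e\<close>.\<close>
  define e where "e n = (\<integral>x. indicator (S n) x * g n x \<partial>Pn n) - main n" for n
  have S[measurable]: "S n \<in> sets (Pn n)" for n using assms(11) by (simp add: good_sets_def)
  have gm[measurable]: "g n \<in> borel_measurable (Pn n)" for n
    unfolding g_def by (rule post_central_moment_measurable)
  have fm: "f n \<in> borel_measurable (Pn n)" for n
    unfolding f_def[abs_def] by measurable
  obtain C where C: "0 \<le> C" "\<forall>\<^sub>F n in sequentially. \<forall>x\<in>S n. \<bar>sqrt (real n * I) ^ r * g n x\<bar> \<le> C"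
    using good_sets_central_moment_bound[OF assms(11,3,10,1)] unfolding I_def g_def by blast
  have fbound: "\<forall>\<^sub>F n in sequentially. \<forall>x\<in>space (Pn n). \<bar>f n x\<bar> \<le> C"
    using C(2) by eventually_elim (use C(1) in \<open>auto simp: f_def indicator_def\<close>)
  have evS: "\<forall>\<^sub>F (n, x) in whp Pn. x \<in> S n"
    unfolding eventually_whp
  proof (intro exI[of _ "\<lambda>n. space (Pn n) - S n"] conjI allI ballI)
    have "(\<lambda>n. measure (Pn n) (space (Pn n) - S n)) \<longlonglongrightarrow> 0"
      using assms(11) unfolding good_sets_def by (auto dest: smalloD_tendsto)
    then have "(\<lambda>n. ennreal (measure (Pn n) (space (Pn n) - S n))) \<longlonglongrightarrow> ennreal 0"
      by (rule tendsto_ennrealI)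
    moreover have "emeasure (Pn n) A = ennreal (measure (Pn n) A)" for n A
    proof -
      interpret Pn: prob_space "Pn n" by (rule prob_Pn)
      show ?thesis by (rule Pn.emeasure_eq_measure)
    qed
    ultimately show "(\<lambda>n. emeasure (Pn n) (space (Pn n) - S n)) \<longlonglongrightarrow> 0" by simp
  qed (use S in auto)
  have "((\<lambda>(n, x). f n x) \<longlongrightarrow> lambda_rr r) (whp Pn)"
  proof (rule Lim_transform_eventually)
    show "((\<lambda>(n, x). sqrt (real n * I) ^ r * g n x) \<longlongrightarrow> lambda_rr r) (whp Pn)"
      unfolding I_def g_def
      by (rule post_central_moment_tendsto[OF assms(5) _ assms(7,10,1)]) simp
    show "\<forall>\<^sub>F z in whp Pn. (case z of (n, x) \<Rightarrow> sqrt (real n * I) ^ r * g n x) = (case z of (n, x) \<Rightarrow> f n x)"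
      using evS by eventually_elim (auto simp: f_def)
  qed
  then have flim: "(\<lambda>n. \<integral>x. f n x \<partial>Pn n) \<longlonglongrightarrow> lambda_rr r"
    by (rule tendsto_whp_integral[OF prob_Pn _ _ fbound]) (simp add: fm)
  have scale: "real n powr (real r / 2) * I powr (real r / 2) = sqrt (real n * I) ^ r" if "0 < n" for n
  proof -
    have "sqrt (real n * I) ^ r = (real n * I) powr (real r / 2)"
      using that I by (simp add: powr_half_sqrt[symmetric] powr_realpow[symmetric] powr_powr)
    then show ?thesis using I by (simp add: powr_mult)
  qed
  have "e \<in> o(\<lambda>n. real n powr (- real r / 2))"
  proof (rule smalloI_tendsto)
    \<comment> \<open>The rescaling uses n * I while the error is measured in n alone; the factor
      I^(-r/2) accounts for the difference.\<close>
    have "(\<lambda>n. I powr (- real r / 2) * ((\<integral>x. f n x \<partial>Pn n) - lambda_rr r)) \<longlonglongrightarrow> I powr (- real r / 2) * (lambda_rr r - lambda_rr r)"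
      by (intro tendsto_intros flim)
    moreover have "\<forall>\<^sub>F n in sequentially. I powr (- real r / 2) * ((\<integral>x. f n x \<partial>Pn n) - lambda_rr r) = e n / real n powr (- real r / 2)"
      using eventually_gt_at_top[of 0]
    proof eventually_elim
      case (elim n)
      define A where "A = (\<integral>x. indicator (S n) x * g n x \<partial>Pn n)"
      have 1: "(\<integral>x. f n x \<partial>Pn n) = sqrt (real n * I) ^ r * A"
        unfolding f_def A_def by (subst integral_mult_right_zero[symmetric]) (simp add: mult_ac)
      have 2: "I powr (- real r / 2) * sqrt (real n * I) ^ r = real n powr (real r / 2)"
        using I unfolding scale[OF elim, symmetric] by (simp add: powr_minus field_simps)
      have 3: "1 / real n powr (- real r / 2) = real n powr (real r / 2)"
        by (simp add: powr_minus field_simps)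
      have 4: "main n / real n powr (- real r / 2) = I powr (- real r / 2) * lambda_rr r"
        using elim by (simp add: main_def)
      have "I powr (- real r / 2) * ((\<integral>x. f n x \<partial>Pn n) - lambda_rr r) =
          (I powr (- real r / 2) * sqrt (real n * I) ^ r) * A - I powr (- real r / 2) * lambda_rr r"
        unfolding 1 by (simp only: right_diff_distrib mult.assoc)
      also have "\<dots> = A * (1 / real n powr (- real r / 2)) - main n / real n powr (- real r / 2)"
        unfolding 2 3 4 by (simp only: mult.commute)
      also have "\<dots> = e n / real n powr (- real r / 2)"
        by (simp only: e_def A_def diff_divide_distrib times_divide_eq_right mult_1_right)
      finally show ?case .
    qed
    ultimately show "(\<lambda>n. e n / real n powr (- real r / 2)) \<longlonglongrightarrow> 0"
      by (simp add: tendsto_cong)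
    show "\<forall>\<^sub>F n in sequentially. real n powr (- real r / 2) \<noteq> 0"
      using eventually_gt_at_top[of 0] by eventually_elim simp
  qed
  moreover have "\<forall>\<^sub>F n in sequentially.
      integrable (Pn n) (\<lambda>x. indicator (- S n) x * g n x) \<longrightarrow>
        integrable (Pn n) (g n) \<and>
        (\<integral>x. g n x \<partial>Pn n) = main n + e n + bad_set_remainder M p \<theta>0 w r S n"
    using fbound eventually_gt_at_top[of 0]
  proof eventually_elim
    case (elim n)
    interpret Pn: prob_space "Pn n" by (rule prob_Pn)
    define c where "c = sqrt (real n * I) ^ r"
    have c: "0 < c" using elim(2) I by (simp add: c_def)
    \<comment> \<open>On the good set integrability is automatic from boundedness, so only the
      complement needs the premise.\<close>
    have "integrable (Pn n) (f n)"
      by (rule Pn.integrable_const_bound[where B = C]) (use elim(1) fm in auto)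
    then have "integrable (Pn n) (\<lambda>x. (1 / c) * f n x)" by (rule integrable_mult_right)
    then have i1: "integrable (Pn n) (\<lambda>x. indicator (S n) x * g n x)"
      using c by (simp add: f_def c_def[symmetric] mult.left_commute)
    show ?case
    proof
      assume i2: "integrable (Pn n) (\<lambda>x. indicator (- S n) x * g n x)"
      have split: "g n x = indicator (S n) x * g n x + indicator (- S n) x * g n x" for x
        by (auto simp: indicator_def)
      have "integrable (Pn n) (\<lambda>x. indicator (S n) x * g n x + indicator (- S n) x * g n x)"
        using i1 i2 by (rule Bochner_Integration.integrable_add)
      then have "integrable (Pn n) (g n)" unfolding split[symmetric] .
      moreover have "(\<integral>x. g n x \<partial>Pn n) = (\<integral>x. indicator (S n) x * g n x \<partial>Pn n) + (\<integral>x. indicator (- S n) x * g n x \<partial>Pn n)"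
        unfolding Bochner_Integration.integral_add[OF i1 i2, symmetric] split[symmetric] ..
      ultimately show "integrable (Pn n) (g n) \<and>
        (\<integral>x. g n x \<partial>Pn n) = main n + e n + bad_set_remainder M p \<theta>0 w r S n"
        by (simp add: e_def bad_set_remainder_def g_def)
    qed
  qed
  ultimately show ?thesis
    unfolding g_def main_def I_def by blast
qed

end
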